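(* Let $q$ be a power of an odd prime $p$ and let $\mathbf{A} = \mathbb{F}_q[T]$. Then $\mathrm{UM}_2(\mathbf{A})$, the set of unimodular pairs in $\mathbf{A}^2$, is a polynomial family over $\mathbf{A}$ with $52$ parameters.
   Context: $\mathbb{F}_q$ is the finite field with $q$ elements and $T$ is an indeterminate. For a commutative ring $R$ with identity, a subset $X \subseteq R^h$ is called a polynomial family over $R$ with $d$ parameters ($d$ a positive integer) if there exist polynomials $P_1, \ldots, P_h \in R[x_1, \ldots, x_d]$ such that $X = \{(P_1(t), \ldots, P_h(t)) : t \in R^d\}$. An $h$-tuple $(m_1, \ldots, m_h) \in R^h$ is called unimodular if there exist $\alpha_1, \ldots, \alpha_h \in R$ with $\sum_{i=1}^h \alpha_i m_i = 1$; $\mathrm{UM}_h(R) \subseteq R^h$ denotes the set of all unimodular $h$-tuples. *)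

theory Defs
  imports
    "HOL-Library.Cardinality"
    "HOL-Library.Poly_Mapping"
    "HOL-Computational_Algebra.Polynomial"
    "HOL-Computational_Algebra.Primes"
begin

text \<open>
  Polynomials in variables indexed by the natural numbers: a finitely supported map from exponent
  vectors (monomials) to coefficients. The ring operations are those of
  HOL-Library.Poly_Mapping, where multiplication is convolution.
\<close>

type_synonym 'a mpoly = "(nat \<Rightarrow>\<^sub>0 nat) \<Rightarrow>\<^sub>0 'a"

text \<open>$R[x_1,\ldots,x_d]$, with $x_{i+1}$ the variable of index \<open>i\<close>.\<close>

definition mpolys :: "nat \<Rightarrow> 'a::comm_ring_1 mpoly set" where
  "mpolys d = {P. \<forall>m \<in> Poly_Mapping.keys P. Poly_Mapping.keys m \<subseteq> {..<d}}"

text \<open>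
  The entry \<open>t ! i\<close> is substituted for the variable of index \<open>i\<close>. This is only meaningful for
  \<open>P \<in> mpolys (length t)\<close>.
\<close>

definition mpoly_eval :: "'a::comm_ring_1 list \<Rightarrow> 'a mpoly \<Rightarrow> 'a" where
  "mpoly_eval t P =
    (\<Sum>m \<in> Poly_Mapping.keys P.
      Poly_Mapping.lookup P m * (\<Prod>i \<in> Poly_Mapping.keys m. (t ! i) ^ Poly_Mapping.lookup m i))"

text \<open>$R^h$ is represented by the lists of length $h$.\<close>

definition tuples :: "nat \<Rightarrow> 'a list set" where
  "tuples h = {v. length v = h}"

definition polynomial_family :: "nat \<Rightarrow> nat \<Rightarrow> 'a::comm_ring_1 list set \<Rightarrow> bool" where
  "polynomial_family h d X \<longleftrightarrow>
    0 < d \<and> X \<subseteq> tuples h \<and>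
    (\<exists>Ps \<in> tuples h. set Ps \<subseteq> mpolys d \<and> X = {map (mpoly_eval t) Ps | t. t \<in> tuples d})"

definition unimodular :: "'a::comm_ring_1 list \<Rightarrow> bool" where
  "unimodular m \<longleftrightarrow> (\<exists>\<alpha> \<in> tuples (length m). (\<Sum>i<length m. \<alpha> ! i * m ! i) = 1)"

definition UM :: "nat \<Rightarrow> 'a::comm_ring_1 list set" where
  "UM h = {m \<in> tuples h. unimodular m}"

end

theory Submission
  imports Defs Complex_Main
    "HOL-Library.Set_Algebras"
    "HOL-Library.Cardinality"
    "HOL-Library.Nonpos_Ints"
    "HOL-Computational_Algebra.Polynomial_Factorial"
    "HOL-Computational_Algebra.Polynomial_FPS"
    "HOL-Number_Theory.Residues"
    "HOL-Algebra.Multiplicative_Group"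
    "HOL-Algebra.Algebraic_Closure_Type"
    "HOL-Analysis.Complex_Transcendental"
begin

text \<open>
  A pair over a commutative ring is unimodular exactly if it is the first row of a $2 \times 2$
  matrix of determinant one. If matrices with polynomial entries and determinant one are multiplied,
  their parameter numbers add up. So it suffices to name finitely many such parametrised matrices,
  with 52 parameters in total, whose products have every unimodular pair among their first rows
  (\<open>polynomial_family_first_rows\<close>, \<open>row_reached\<close>). Euclid's algorithm
  yields elementary matrices, but their number grows with the pair; a few other parametrised
  matrices have to do most of the work. Write $q$ for the size of the field.

  \<^bold>\<open>Scaling.\<close> Conjugation with \<open>diag (1/u, u)\<close> turns a matrix with
  first row $(m, u^2n)$ into one with first row $(m, n)$. If $u$ divides $m - 1$ or $m + 1$, then
  the denominators cancel, and the conjugation becomes a multiplication from both sides by matrices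
  that are polynomial in $u$ and two further parameters (\<open>scale_upper\<close>,
  \<open>scale_lower\<close>). Squares can thus be split off both off-diagonal entries.

  \<^bold>\<open>Frobenius powers.\<close> Let $\alpha$ have determinant one, trace $t$ and
  off-diagonal entries $b$ and $c$, and let $N$ be an even power of $q$. By the theorem of Cayley
  and Hamilton, \<open>\<alpha>^N = f\<alpha> + g\<close>, and as taking $N$-th powers is additive,
  $f = (t^2 - 4)^{(N - 1)/2}$. Since 4 divides $N - 1$, this is a square $u_1^2u_2^2$, and the
  diagonal of $\alpha^N$ satisfies just the congruences that allow to scale by $u_1$ and $u_2$
  (\<open>power_matrix\<close>). So $\alpha^N$ is related to a matrix with first row $(m, b)$ and
  also to a matrix with first column $(m, c)$. The former can be compared with any matrix whose
  first row is $(v, b)$, $v \equiv m$ modulo $b$, and the latter with $\alpha$ itself. In this way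
  $\gamma \alpha$ is connected with $\alpha$ when $\gamma \alpha$ has upper right entry $y^2b$. All
  factors that end up on the right of $\alpha$ are shears, and conjugating them by $\alpha$ gives
  transvections, a polynomial family with three parameters; hence $\gamma$ lies in a fixed family
  (\<open>core_matrix\<close>).

  \<^bold>\<open>Choice of the row.\<close> This applies to $\gamma$ with first row $(a, b)$ when
  $b$ is irreducible, $a \equiv s^{2(q^2 - 1)}$ modulo $b$, and $s^2 + 1$ is a square modulo $b$
  (\<open>core_row\<close>). An arbitrary unimodular pair is brought to this form with six shears,
  each of which adds a multiple of one entry to the other. The residues modulo one entry stay fixed,
  and one has to find irreducible polynomials in a given residue class and with prescribed degree
  modulo some $r$. That these exist is Dirichlet's theorem (\<open>dirichlet\<close>). That the
  remaining entry becomes a high power modulo the irreducible one is a consequence of a reciprocity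
  law: the norm of $h$ modulo $p$ is up to elementary factors the product of the values of $p$ at
  the roots of $h$, so it depends only on $p$ modulo $h$ (\<open>norm_reciprocity\<close>,
  \<open>square_residue\<close>, \<open>power_residue\<close>).

  \<^bold>\<open>Dirichlet's theorem.\<close> Over a finite field the $L$-series of a character
  modulo $M$ is a polynomial, or has the single pole $1/q$ if the character is trivial. Twisting
  with $r$-th roots of unity detects the degree modulo $r$. No $L$-series vanishes at $1/q$
  (\<open>P_nz\<close>), since otherwise the product of all of them would be a polynomial, although
  its coefficients are nonnegative and infinitely many are positive. So the logarithmic derivatives,
  weighted to single out the progression, add up to a function with a pole at $1/q$, which is
  impossible if the irreducible members of the progression have bounded degree.
\<close>

hide_const (open) Divisibility.prime Divisibility.irreducible Module.smult 
  up_ring.coeff up_ring.monom Polynomials.degree Polynomials.lead_coeff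

section \<open>Polynomial families of matrices of determinant one\<close>

definition monomial_eval :: "'a::comm_ring_1 list \<Rightarrow> (nat \<Rightarrow>\<^sub>0 nat) \<Rightarrow> 'a" where
  "monomial_eval t m = (\<Prod>i\<in>Poly_Mapping.keys m. (t ! i) ^ Poly_Mapping.lookup m i)"

text \<open>
  Sums and products over supports are compared on a common finite index set, because the support of
  a sum of polynomials may shrink by cancellation.
\<close>

lemma monomial_eval_superset:
  assumes "finite S" "Poly_Mapping.keys m \<subseteq> S"
  shows "monomial_eval t m = (\<Prod>i\<in>S. (t ! i) ^ Poly_Mapping.lookup m i)"
  unfolding monomial_eval_def using assms
  by (intro prod.mono_neutral_left) (auto simp: in_keys_iff)

lemma monomial_eval_add: "monomial_eval t (m + n) = monomial_eval t m * monomial_eval t n"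
proof -
  let ?S = "Poly_Mapping.keys m \<union> Poly_Mapping.keys n"
  have "Poly_Mapping.keys (m + n) \<subseteq> ?S" by (rule keys_add)
  then show ?thesis
    by (simp add: monomial_eval_superset[of ?S] lookup_add power_add prod.distrib)
qed

lemma mpoly_eval_superset:
  assumes "finite S" "Poly_Mapping.keys P \<subseteq> S"
  shows "mpoly_eval t P = (\<Sum>m\<in>S. Poly_Mapping.lookup P m * monomial_eval t m)"
  unfolding mpoly_eval_def monomial_eval_def using assms
  by (intro sum.mono_neutral_left) (auto simp: in_keys_iff)

lemma mpoly_eval_add: "mpoly_eval t (P + Q) = mpoly_eval t P + mpoly_eval t Q"
proof -
  let ?S = "Poly_Mapping.keys P \<union> Poly_Mapping.keys Q"
  have "Poly_Mapping.keys (P + Q) \<subseteq> ?S" by (rule keys_add)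
  then show ?thesis
    by (simp add: mpoly_eval_superset[of ?S] lookup_add distrib_right sum.distrib)
qed

lemma mpoly_eval_zero [simp]: "mpoly_eval t 0 = 0"
  by (simp add: mpoly_eval_def)

lemma mpoly_eval_sum: "mpoly_eval t (\<Sum>x\<in>A. f x) = (\<Sum>x\<in>A. mpoly_eval t (f x))"
  by (induction A rule: infinite_finite_induct) (simp_all add: mpoly_eval_add)

lemma mpoly_eval_single: "mpoly_eval t (Poly_Mapping.single m c) = c * monomial_eval t m"
  by (subst mpoly_eval_superset[of "{m}"]) auto

lemma sum_singles: "P = (\<Sum>m\<in>Poly_Mapping.keys P. Poly_Mapping.single m (Poly_Mapping.lookup P m))"
  by (rule poly_mapping_eqI) (auto simp: lookup_sum lookup_single when_def in_keys_iff sum.delta)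

lemma mpoly_eval_mult: "mpoly_eval t (P * Q) = mpoly_eval t P * mpoly_eval t Q"
proof -
  let ?L = Poly_Mapping.lookup and ?K = Poly_Mapping.keys
  have PQ: "P * Q = (\<Sum>m\<in>?K P. \<Sum>n\<in>?K Q. Poly_Mapping.single (m + n) (?L P m * ?L Q n))"
    by (subst (1) sum_singles[of P], subst (1) sum_singles[of Q]) (simp add: sum_product mult_single)
  show ?thesis
    unfolding PQ mpoly_eval_sum mpoly_eval_single monomial_eval_add
    by (simp add: mpoly_eval_superset[of "?K P" P] mpoly_eval_superset[of "?K Q" Q]
        sum_product algebra_simps)
qed

text \<open>
  Working with the functions avoids writing down the polynomials, which only have to exist.
\<close>

definition polyfun :: "nat \<Rightarrow> ('a::comm_ring_1 list \<Rightarrow> 'a) \<Rightarrow> bool" where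
  "polyfun d F \<longleftrightarrow> (\<exists>P\<in>mpolys d. \<forall>t\<in>tuples d. mpoly_eval t P = F t)"

lemma polyfun_const: "polyfun d (\<lambda>_. c)"
  unfolding polyfun_def
  by (rule bexI[of _ "Poly_Mapping.single 0 c"])
     (auto simp: mpolys_def mpoly_eval_single monomial_eval_def)

lemma polyfun_var:
  assumes "i < d"
  shows "polyfun d (\<lambda>t. t ! i)"
  unfolding polyfun_def
  by (rule bexI[of _ "Poly_Mapping.single (Poly_Mapping.single i 1) 1"])
     (use assms in \<open>auto simp: mpolys_def mpoly_eval_single monomial_eval_def\<close>)

lemma polyfun_add:
  assumes "polyfun d F" "polyfun d G"
  shows "polyfun d (\<lambda>t. F t + G t)"
proof -
  obtain P Q where "P \<in> mpolys d" "Q \<in> mpolys d"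
    "\<forall>t\<in>tuples d. mpoly_eval t P = F t" "\<forall>t\<in>tuples d. mpoly_eval t Q = G t"
    using assms by (auto simp: polyfun_def)
  then show ?thesis
    unfolding polyfun_def using keys_add[of P Q]
    by (intro bexI[of _ "P + Q"]) (fastforce simp: mpolys_def mpoly_eval_add)+
qed

lemma polyfun_mult:
  assumes "polyfun d F" "polyfun d G"
  shows "polyfun d (\<lambda>t. F t * G t)"
proof -
  obtain P Q where PQ: "P \<in> mpolys d" "Q \<in> mpolys d"
    "\<forall>t\<in>tuples d. mpoly_eval t P = F t" "\<forall>t\<in>tuples d. mpoly_eval t Q = G t"
    using assms by (auto simp: polyfun_def)
  have "Poly_Mapping.keys m \<subseteq> {..<d}" if m: "m \<in> Poly_Mapping.keys (P * Q)" for m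
  proof -
    obtain a b where "m = a + b" "a \<in> Poly_Mapping.keys P" "b \<in> Poly_Mapping.keys Q"
      using m keys_mult[of P Q] by blast
    then show ?thesis
      using PQ(1,2) keys_add[of a b] by (force simp: mpolys_def)
  qed
  then show ?thesis
    unfolding polyfun_def using PQ
    by (intro bexI[of _ "P * Q"]) (auto simp: mpolys_def mpoly_eval_mult)
qed

lemma polyfun_uminus: "polyfun d F \<Longrightarrow> polyfun d (\<lambda>t. - F t)"
  using polyfun_mult[OF polyfun_const[of d "-1"]] by fastforce

lemma polyfun_diff: "polyfun d F \<Longrightarrow> polyfun d G \<Longrightarrow> polyfun d (\<lambda>t. F t - G t)"
  using polyfun_add[OF _ polyfun_uminus] by fastforce

lemma polyfun_power: "polyfun d F \<Longrightarrow> polyfun d (\<lambda>t. F t ^ n)"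
  by (induction n) (auto intro: polyfun_const polyfun_mult)

lemma polyfun_sum: "(\<And>x. x \<in> A \<Longrightarrow> polyfun d (F x)) \<Longrightarrow> polyfun d (\<lambda>t. \<Sum>x\<in>A. F x t)"
  by (induction A rule: infinite_finite_induct) (auto intro: polyfun_const polyfun_add)

lemma polyfun_prod: "(\<And>x. x \<in> A \<Longrightarrow> polyfun d (F x)) \<Longrightarrow> polyfun d (\<lambda>t. \<Prod>x\<in>A. F x t)"
  by (induction A rule: infinite_finite_induct) (auto intro: polyfun_const polyfun_mult)

lemmas polyfun_intros =
  polyfun_const polyfun_var polyfun_add polyfun_mult polyfun_uminus polyfun_diff polyfun_power

lemma polyfun_subst:
  assumes "polyfun n F" "\<And>i. i < n \<Longrightarrow> polyfun d (g i)"
  shows "polyfun d (\<lambda>t. F (map (\<lambda>i. g i t) [0..<n]))"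
proof -
  obtain P where P: "P \<in> mpolys n" "\<forall>t\<in>tuples n. mpoly_eval t P = F t"
    using assms(1) by (auto simp: polyfun_def)
  have keys: "i < n" if "m \<in> Poly_Mapping.keys P" "i \<in> Poly_Mapping.keys m" for m i
    using P(1) that by (auto simp: mpolys_def)
  have "F (map (\<lambda>i. g i t) [0..<n]) = (\<Sum>m\<in>Poly_Mapping.keys P. Poly_Mapping.lookup P m *
      (\<Prod>i\<in>Poly_Mapping.keys m. g i t ^ Poly_Mapping.lookup m i))" for t
  proof -
    have "F (map (\<lambda>i. g i t) [0..<n]) = mpoly_eval (map (\<lambda>i. g i t) [0..<n]) P"
      using P(2) by (simp add: tuples_def)
    then show ?thesis
      unfolding mpoly_eval_def using keys by simp
  qed
  then show ?thesis
    using keys by (simp add: polyfun_sum polyfun_prod polyfun_mult polyfun_const polyfun_power assms(2))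
qed

text \<open>
  Matrices as records of their entries, so that identities between them become ring identities. The
  instance of \<open>monoid_mult\<close> gives the elementwise products and powers of sets of
  matrices.
\<close>

datatype 'a mat2 = Mat (m11: 'a) (m12: 'a) (m21: 'a) (m22: 'a)

instantiation mat2 :: (comm_ring_1) monoid_mult
begin

definition one_mat2 :: "'a mat2" where "1 = Mat 1 0 0 1"

definition times_mat2 :: "'a mat2 \<Rightarrow> 'a mat2 \<Rightarrow> 'a mat2" where
  "A * B = Mat (m11 A * m11 B + m12 A * m21 B) (m11 A * m12 B + m12 A * m22 B)
    (m21 A * m11 B + m22 A * m21 B) (m21 A * m12 B + m22 A * m22 B)"

instance
  by standard (auto simp: one_mat2_def times_mat2_def algebra_simps intro: mat2.expand)

end

lemma Mat_mult [simp]: "Mat a b c d * Mat a' b' c' d' =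
  Mat (a * a' + b * c') (a * b' + b * d') (c * a' + d * c') (c * b' + d * d')"
  by (simp add: times_mat2_def)

definition mdet :: "'a::comm_ring_1 mat2 \<Rightarrow> 'a" where
  "mdet A = m11 A * m22 A - m12 A * m21 A"

lemma mdet_Mat [simp]: "mdet (Mat a b c d) = a * d - b * c"
  by (simp add: mdet_def)

lemma mdet_mult: "mdet (A * B) = mdet A * mdet B"
  by (cases A; cases B) (simp add: algebra_simps)

text \<open>
  The adjugate, which is the inverse for determinant one and is polynomial in the entries.
\<close>

definition adj :: "'a::comm_ring_1 mat2 \<Rightarrow> 'a mat2" where
  "adj A = Mat (m22 A) (- m12 A) (- m21 A) (m11 A)"

lemma adj_Mat [simp]: "adj (Mat a b c d) = Mat d (- b) (- c) a"
  by (simp add: adj_def)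

lemma mdet_adj [simp]: "mdet (adj A) = mdet A"
  by (cases A) (simp add: algebra_simps)

lemma adj_mult: "adj (A * B) = adj B * adj A"
  by (cases A; cases B) (simp add: algebra_simps)

lemma adj_left: "mdet A = 1 \<Longrightarrow> adj A * A = 1"
  by (cases A) (auto simp: one_mat2_def algebra_simps)

lemma adj_right: "mdet A = 1 \<Longrightarrow> A * adj A = 1"
  by (cases A) (auto simp: one_mat2_def algebra_simps)

text \<open>
  The determinant condition is part of the notion because it makes the first rows unimodular.
\<close>

definition matfam :: "nat \<Rightarrow> 'a::comm_ring_1 mat2 set \<Rightarrow> bool" where
  "matfam d S \<longleftrightarrow> (\<forall>A\<in>S. mdet A = 1) \<and>
    (\<exists>F. S = F ` tuples d \<and> (\<forall>m\<in>{m11, m12, m21, m22}. polyfun d (\<lambda>t. m (F t))))"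

lemma matfamI:
  assumes "\<And>t. length t = d \<Longrightarrow> mdet (F t) = 1"
    and "polyfun d (\<lambda>t. m11 (F t))" "polyfun d (\<lambda>t. m12 (F t))"
    and "polyfun d (\<lambda>t. m21 (F t))" "polyfun d (\<lambda>t. m22 (F t))"
  shows "matfam d (F ` tuples d)"
  unfolding matfam_def using assms by (auto simp: tuples_def)

text \<open>
  The two factors get disjoint sets of parameters: the first $d$ entries of the parameter list and
  the last $e$ ones.
\<close>

lemma matfam_mult:
  assumes "matfam d S" "matfam e T"
  shows "matfam (d + e) (S * T)"
proof -
  obtain F G where F: "S = F ` tuples d" "\<And>m. m \<in> {m11, m12, m21, m22} \<Longrightarrow> polyfun d (\<lambda>t. m (F t))"
    and G: "T = G ` tuples e" "\<And>m. m \<in> {m11, m12, m21, m22} \<Longrightarrow> polyfun e (\<lambda>t. m (G t))"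
    using assms unfolding matfam_def by metis
  define h1 where "h1 t = map (\<lambda>i. t ! i) [0..<d]" for t :: "'a list"
  define h2 where "h2 t = map (\<lambda>i. t ! (d + i)) [0..<e]" for t :: "'a list"
  have "S * T = (\<lambda>t. F (h1 t) * G (h2 t)) ` tuples (d + e)" (is "_ = ?R")
  proof
    show "S * T \<subseteq> ?R"
    proof
      fix A assume "A \<in> S * T"
      then obtain s t where st: "length s = d" "length t = e" "A = F s * G t"
        using F(1) G(1) by (auto simp: set_times_def tuples_def)
      have "h1 (s @ t) = s" "h2 (s @ t) = t"
        using st by (auto simp: h1_def h2_def nth_append intro!: nth_equalityI)
      then show "A \<in> ?R"
        using st by (intro image_eqI[of _ _ "s @ t"]) (auto simp: tuples_def)
    qed
    show "?R \<subseteq> S * T"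
      using F(1) G(1) by (auto simp: h1_def h2_def tuples_def intro!: set_times_intro)
  qed
  moreover have "polyfun (d + e) (\<lambda>t. m (F (h1 t)))" "polyfun (d + e) (\<lambda>t. m (G (h2 t)))"
    if "m \<in> {m11, m12, m21, m22}" for m
    unfolding h1_def h2_def using F(2)[OF that] G(2)[OF that]
    by (auto intro!: polyfun_subst[where F = "\<lambda>t. m (F t)"] polyfun_subst[where F = "\<lambda>t. m (G t)"]
        polyfun_var)
  moreover have "\<forall>A\<in>S * T. mdet A = 1"
    using assms by (auto simp: matfam_def set_times_def mdet_mult)
  ultimately show ?thesis
    unfolding matfam_def
    by (intro conjI exI[of _ "\<lambda>t. F (h1 t) * G (h2 t)"])
       (auto simp: times_mat2_def intro!: polyfun_add polyfun_mult)
qed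

lemma matfam_one: "matfam 0 {1}"
  unfolding matfam_def
  by (auto simp: one_mat2_def tuples_def polyfun_const intro!: exI[of _ "\<lambda>_. 1"])

lemma matfam_power: "matfam d S \<Longrightarrow> matfam (n * d) (S ^ n)"
proof (induction n)
  case 0
  then show ?case using matfam_one by (simp add: set_one)
next
  case (Suc n)
  then show ?case using matfam_mult[OF Suc.prems Suc.IH] by simp
qed

section \<open>Rescaling off-diagonal entries\<close>

definition e12 :: "'a::comm_ring_1 \<Rightarrow> 'a mat2" where "e12 x = Mat 1 x 0 1"
definition e21 :: "'a::comm_ring_1 \<Rightarrow> 'a mat2" where "e21 x = Mat 1 0 x 1"

text \<open>
  With $v = (a, c)$ this is the map \<open>w \<mapsto> w + x \<langle>v, w\<rangle> v\<close> for
  the standard symplectic form, a matrix of determinant one for all $x$, $a$, $c$, whether or not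
  $(a, c)$ is unimodular.
\<close>

definition transvection :: "'a::comm_ring_1 \<Rightarrow> 'a \<Rightarrow> 'a \<Rightarrow> 'a mat2" where
  "transvection x a c = Mat (1 - a * c * x) (a\<^sup>2 * x) (- (c\<^sup>2 * x)) (1 + a * c * x)"

text \<open>
  The commutator of \<open>e21 (-1/u)\<close> with a matrix of determinant one whose second column
  is $(u^2 q, y)$, $y = 1 + u s$. It depends on that column only, and the denominators cancel
  because of the congruences modulo $u$ that the column satisfies.
\<close>

definition shear_comm :: "'a::comm_ring_1 \<Rightarrow> 'a \<Rightarrow> 'a \<Rightarrow> 'a mat2" where
  "shear_comm u q s = (let y = 1 + u * s in
     Mat (1 + u * q * y) (- (u ^ 3 * q\<^sup>2)) (2 * s + u * s\<^sup>2 - q * y) (1 - u * q * y + u\<^sup>2 * q\<^sup>2))"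

text \<open>
  \<open>diag (1/u, u) = e21 1 * e12 (u - 1) * e21 (-1/u) * e12 (u - u\<^sup>2)\<close>, where only
  one factor has a denominator. In the conjugation of a matrix by this product that factor and its
  inverse are replaced by a single commutator on the left. What remains on the left is
  \<open>scale_left\<close>, and what remains on the right is \<open>scale_right\<close>, as
  $(u^2 - u) + (1 - u) = (u - 1)^2$.
\<close>

definition scale_left :: "'a::comm_ring_1 \<Rightarrow> 'a \<Rightarrow> 'a \<Rightarrow> 'a mat2" where
  "scale_left u q s = e21 1 * e12 (u - 1) * shear_comm u q s * e12 (u - u\<^sup>2)"

definition scale_right :: "'a::comm_ring_1 \<Rightarrow> 'a mat2" where
  "scale_right u = e12 ((u - 1)\<^sup>2) * e21 (-1)"

text \<open>
  Conjugation by the matrix with rows $(0, 1)$ and $(-1, 0)$. It exchanges the roles of the two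
  off-diagonal entries.
\<close>

definition flip :: "'a::comm_ring_1 mat2 \<Rightarrow> 'a mat2" where
  "flip A = Mat (m22 A) (- m21 A) (- m12 A) (m11 A)"

lemma flip_Mat [simp]: "flip (Mat a b c d) = Mat d (- c) (- b) a"
  by (simp add: flip_def)

lemma flip_mult: "flip (A * B) = flip A * flip B"
  by (cases A; cases B) (simp add: algebra_simps)

lemma mdet_flip [simp]: "mdet (flip A) = mdet A"
  by (cases A) (simp add: algebra_simps)

lemma mdet_e12 [simp]: "mdet (e12 x) = 1" and mdet_e21 [simp]: "mdet (e21 x) = 1"
  by (simp_all add: e12_def e21_def)

lemma mdet_transvection [simp]: "mdet (transvection x a c) = 1"
  by (simp add: transvection_def algebra_simps power2_eq_square)

lemma mdet_shear_comm [simp]: "mdet (shear_comm u q s) = 1"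
  by (simp add: shear_comm_def Let_def algebra_simps power2_eq_square power3_eq_cube)

lemma mdet_scale_left [simp]: "mdet (scale_left u q s) = 1"
  by (simp add: scale_left_def mdet_mult)

lemma mdet_scale_right [simp]: "mdet (scale_right u) = 1"
  by (simp add: scale_right_def mdet_mult)

text \<open>
  The right-hand side is the conjugate \<open>e21 (-1/u) * B * e21 (1/u)\<close> of the matrix $B$
  that \<open>shear_comm\<close> is multiplied with. The premise is the condition that $B$ has
  determinant one, divided by $u$; this form makes the identity hold even where $u$ is a zero
  divisor.
\<close>

lemma shear_comm_mult:
  fixes u :: "'a::comm_ring_1"
  assumes "a' + s + u * a' * s = u * q * k"
  shows "shear_comm u q s * Mat (1 + u * a') (u\<^sup>2 * q) k (1 + u * s) =
    Mat (1 + u * a' + u * q) (u\<^sup>2 * q) (k + s - a' - q) (1 + u * s - u * q)"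
proof -
  have a': "a' = u * q * k - s - u * a' * s"
    using assms by (simp add: algebra_simps)
  have 1: "(1 + u * q * (1 + u * s)) * (1 + u * a') - u ^ 3 * q\<^sup>2 * k = 1 + u * a' + u * q
      + u\<^sup>2 * q * (a' + s + u * a' * s - u * q * k)"
    by (simp add: algebra_simps power2_eq_square power3_eq_cube)
  have 2: "(1 + u * q * (1 + u * s)) * (u\<^sup>2 * q) - u ^ 3 * q\<^sup>2 * (1 + u * s) = u\<^sup>2 * q"
    by (simp add: algebra_simps power2_eq_square power3_eq_cube)
  have 3: "(2 * s + u * s\<^sup>2 - q * (1 + u * s)) * (1 + u * a') +
      (1 - u * q * (1 + u * s) + u\<^sup>2 * q\<^sup>2) * k = k + s - a' - q
      + (a' + s + u * a' * s - u * q * k) * (1 + u * s - u * q)"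
    by (simp add: algebra_simps power2_eq_square power3_eq_cube)
  have 4: "(2 * s + u * s\<^sup>2 - q * (1 + u * s)) * (u\<^sup>2 * q) +
      (1 - u * q * (1 + u * s) + u\<^sup>2 * q\<^sup>2) * (1 + u * s) = 1 + u * s - u * q"
    by (simp add: algebra_simps power2_eq_square power3_eq_cube)
  show ?thesis
    using 1 2 3 4 assms by (simp add: shear_comm_def Let_def)
qed

text \<open>
  The two matrices are conjugate by \<open>diag (1/u, u)\<close>. The determinant forces
  $l \equiv 1$ modulo $u$, and so the second column has the form required for
  \<open>shear_comm\<close>.
\<close>

lemma scale_upper_pos:
  fixes u :: "'a::comm_ring_1"
  assumes det: "m * l - u\<^sup>2 * n * k = 1" and "u dvd m - 1"
  obtains q s where "Mat m n (u\<^sup>2 * k) l = scale_left u q s * Mat m (u\<^sup>2 * n) k l * scale_right u"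
proof -
  obtain m' where m': "m = 1 + u * m'"
    using assms(2) by (metis add.commute diff_add_cancel dvd_def)
  define l' where "l' = u * n * k - m' * l"
  have l': "l = 1 + u * l'"
    using det by (simp add: m' l'_def algebra_simps power2_eq_square)
  have rel: "m' + l' + u * m' * l' = u * n * k"
    using l'_def l' by (simp add: algebra_simps)
  \<comment> \<open>\<open>a'\<close>, \<open>q\<close> and \<open>s\<close> are read off from the matrix after its conjugation by \<open>e12 (u - u\<^sup>2)\<close>.\<close>
  define q where "q = n + (1 - u) * (l' - m') - (1 - u)\<^sup>2 * k"
  define s where "s = l' - (1 - u) * k"
  define a' where "a' = m' + (1 - u) * k"
  have 1: "e12 (u - u\<^sup>2) * Mat m (u\<^sup>2 * n) k l * e12 (u\<^sup>2 - u) =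
      Mat (1 + u * a') (u\<^sup>2 * q) k (1 + u * s)"
    unfolding e12_def m' l' a'_def q_def s_def
    by (simp add: algebra_simps power2_eq_square)
  have rel': "a' + s + u * a' * s = u * q * k"
  proof -
    have "a' + s + u * a' * s - u * q * k = m' + l' + u * m' * l' - u * n * k"
      unfolding a'_def q_def s_def by (simp add: algebra_simps power2_eq_square)
    then show ?thesis using rel by simp
  qed
  have R: "scale_right u = e12 (u\<^sup>2 - u) * (e12 (1 - u) * e21 (-1))"
    by (simp add: scale_right_def e12_def e21_def algebra_simps power2_eq_square)
  have "scale_left u q s * Mat m (u\<^sup>2 * n) k l * scale_right u =
      e21 1 * e12 (u - 1) * (shear_comm u q s * (e12 (u - u\<^sup>2) * Mat m (u\<^sup>2 * n) k l * e12 (u\<^sup>2 - u))) *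
      (e12 (1 - u) * e21 (-1))"
    unfolding scale_left_def R by (simp only: mult.assoc)
  also have "\<dots> = e21 1 * e12 (u - 1) * Mat (1 + u * a' + u * q) (u\<^sup>2 * q) (k + s - a' - q) (1 + u * s - u * q) *
      (e12 (1 - u) * e21 (-1))"
    unfolding 1 shear_comm_mult[OF rel'] ..
  also have "\<dots> = Mat m n (u\<^sup>2 * k) l"
    unfolding e12_def e21_def m' l' a'_def q_def s_def
    by (simp add: algebra_simps power2_eq_square)
  finally show thesis using that by metis
qed

text \<open>
  If $m \equiv -1$, the negative matrix satisfies the congruence of \<open>scale_upper_pos\<close>,
  and the sign is central.
\<close>

lemma scale_upper:
  fixes u :: "'a::comm_ring_1"
  assumes det: "m * l - u\<^sup>2 * n * k = 1" and "u dvd m - 1 \<or> u dvd m + 1"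
  obtains q s where "Mat m n (u\<^sup>2 * k) l = scale_left u q s * Mat m (u\<^sup>2 * n) k l * scale_right u"
  using assms(2)
proof
  assume "u dvd m - 1"
  then show thesis using scale_upper_pos[OF det] that by blast
next
  assume "u dvd m + 1"
  then have "u dvd - m - 1"
    by (metis dvd_minus_iff minus_add_distrib uminus_add_conv_diff add.commute diff_conv_add_uminus)
  moreover have "(- m) * (- l) - u\<^sup>2 * (- n) * (- k) = 1" using det by simp
  ultimately obtain q s where
    "Mat (- m) (- n) (u\<^sup>2 * (- k)) (- l) = scale_left u q s * Mat (- m) (u\<^sup>2 * (- n)) (- k) (- l) * scale_right u"
    using scale_upper_pos by blast
  then have "Mat m n (u\<^sup>2 * k) l = scale_left u q s * Mat m (u\<^sup>2 * n) k l * scale_right u"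
    by (cases "scale_left u q s"; cases "scale_right u")
       (simp, simp add: algebra_simps eq_neg_iff_add_eq_0 neg_eq_iff_add_eq_0 add_eq_0_iff2)
  then show thesis using that by blast
qed

lemma scale_lower:
  fixes u :: "'a::comm_ring_1"
  assumes det: "m * l - u\<^sup>2 * n * k = 1" and "u dvd m - 1 \<or> u dvd m + 1"
  obtains q s where "Mat m (u\<^sup>2 * n) k l = flip (scale_left u q s) * Mat m n (u\<^sup>2 * k) l * flip (scale_right u)"
proof -
  have "u dvd l - 1 \<or> u dvd l + 1"
    using assms(2)
  proof
    assume "u dvd m - 1"
    then have "u dvd (m - 1) * l - u * (u * n * k)" by (intro dvd_diff) auto
    moreover have "(m - 1) * l - u * (u * n * k) = - (l - 1)"
      using det by (simp add: algebra_simps power2_eq_square)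
    ultimately show ?thesis by (metis dvd_minus_iff)
  next
    assume "u dvd m + 1"
    then have "u dvd (m + 1) * l - u * (u * n * k)" by (intro dvd_diff) auto
    moreover have "(m + 1) * l - u * (u * n * k) = l + 1"
      using det by (simp add: algebra_simps power2_eq_square)
    ultimately show ?thesis by simp
  qed
  moreover have "l * m - u\<^sup>2 * (- k) * (- n) = 1"
    using det by (simp add: algebra_simps)
  ultimately obtain q s where
    "Mat l (- k) (u\<^sup>2 * (- n)) m = scale_left u q s * Mat l (u\<^sup>2 * (- k)) (- n) m * scale_right u"
    using scale_upper by blast
  then have "flip (Mat l (- k) (u\<^sup>2 * (- n)) m) = flip (scale_left u q s * Mat l (u\<^sup>2 * (- k)) (- n) m * scale_right u)"
    by simp
  then show thesis using that unfolding flip_mult by simp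
qed

lemma conj_e12:
  assumes "mdet A = 1"
  shows "A * e12 x * adj A = transvection x (m11 A) (m21 A)"
proof (cases A)
  case (Mat a b c d)
  have "A * e12 x * adj A = Mat (mdet A - a * c * x) (a\<^sup>2 * x) (- (c\<^sup>2 * x)) (mdet A + a * c * x)"
    by (simp add: Mat e12_def algebra_simps power2_eq_square)
  then show ?thesis using assms by (simp add: Mat transvection_def)
qed

lemma conj_e21:
  assumes "mdet A = 1"
  shows "A * e21 x * adj A = transvection (- x) (m12 A) (m22 A)"
proof (cases A)
  case (Mat a b c d)
  have "A * e21 x * adj A = Mat (mdet A + b * d * x) (- (b\<^sup>2 * x)) (d\<^sup>2 * x) (mdet A - b * d * x)"
    by (simp add: Mat e21_def algebra_simps power2_eq_square)
  then show ?thesis using assms by (simp add: Mat transvection_def)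
qed

lemma adj_e12 [simp]: "adj (e12 x) = e12 (- x)" and adj_e21 [simp]: "adj (e21 x) = e21 (- x)"
  and flip_e12 [simp]: "flip (e12 x) = e21 (- x)" and flip_e21 [simp]: "flip (e21 x) = e12 (- x)"
  by (simp_all add: e12_def e21_def)

lemma e12_mult: "e12 x * e12 y = e12 (x + y)" and e21_mult: "e21 x * e21 y = e21 (x + y)"
  by (simp_all add: e12_def e21_def algebra_simps)

lemma e12_mult': "e12 x * (e12 y * A) = e12 (x + y) * A" and e21_mult': "e21 x * (e21 y * A) = e21 (x + y) * A"
  by (simp_all add: mult.assoc[symmetric] e12_mult e21_mult)

definition shears12 :: "'a::comm_ring_1 mat2 set" where "shears12 = range e12"
definition shears21 :: "'a::comm_ring_1 mat2 set" where "shears21 = range e21"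

definition transvections :: "'a::comm_ring_1 mat2 set" where
  "transvections = {transvection x a c | x a c. True}"

lemma transvection_in: "transvection x a c \<in> transvections"
  unfolding transvections_def by blast

definition scalings :: "'a::comm_ring_1 mat2 set" where
  "scalings = {scale_left u q s | u q s. True}"

text \<open>
  Each letter is conjugated separately. Thus the number of parameters depends on the length of the
  word only, and not on $A$.
\<close>

lemma conj_word:
  assumes "mdet A = 1" "list_all (\<lambda>E. E \<in> shears12 \<union> shears21) Es"
  shows "A * prod_list Es * adj A \<in> transvections ^ length Es"
  using assms(2)
proof (induction Es)
  case Nil
  then show ?case using adj_right[OF assms(1)] by (simp add: set_one)
next
  case (Cons E Es)
  have "\<exists>x. E = e12 x \<or> E = e21 x"
    using Cons.prems by (auto simp: shears12_def shears21_def)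
  then have "A * E * adj A \<in> transvections"
    using conj_e12[OF assms(1)] conj_e21[OF assms(1)] by (auto simp: transvection_in)
  moreover have "A * prod_list (E # Es) * adj A = (A * E) * (adj A * A) * (prod_list Es * adj A)"
    using adj_left[OF assms(1)] by (simp add: mult.assoc)
  then have "A * prod_list (E # Es) * adj A = (A * E * adj A) * (A * prod_list Es * adj A)"
    by (simp only: mult.assoc)
  moreover have "A * prod_list Es * adj A \<in> transvections ^ length Es"
    using Cons by simp
  ultimately show ?case by (simp add: set_times_intro)
qed

text \<open>
  The factors appear in the order in which \<open>core_matrix\<close> produces them. The parameters
  number $3 + 1 + 3 + 3 + 3 + 3 + 1 + 9 * 3 = 44$.
\<close>

definition core_family :: "'a::comm_ring_1 mat2 set" where
  "core_family = adj ` scalings * shears21 * scalings * scalings *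
    adj ` flip ` scalings * adj ` flip ` scalings * shears12 * transvections ^ 9"

text \<open>
  A shear from the right makes the first rows equal. Two matrices of determinant one with the same
  first row differ by a shear from the left.
\<close>

lemma same_row_shear:
  fixes A B :: "'a::comm_ring_1 mat2"
  assumes "mdet A = 1" "mdet B = 1" "m12 A = m12 B" "m12 B dvd m11 A - m11 B"
  obtains x y where "A = e21 x * B * e21 y"
proof -
  obtain y where y: "m11 A - m11 B = m12 B * y"
    using assms(4) by (auto simp: dvd_def)
  define C where "C = B * e21 y"
  have C: "m11 A = m11 C" "m12 A = m12 C" "mdet C = 1"
    using y assms(2,3) by (auto simp: C_def mdet_mult) (auto simp: times_mat2_def e21_def algebra_simps)
  have "A * adj C = e21 (m21 A * m22 C - m22 A * m21 C)"
    using C assms(1) by (cases A; cases C) (auto simp: e21_def algebra_simps)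
  then have "A * adj C * C = e21 (m21 A * m22 C - m22 A * m21 C) * C" by simp
  then have "A = e21 (m21 A * m22 C - m22 A * m21 C) * C"
    using adj_left[OF C(3)] by (simp add: mult.assoc)
  then show thesis using that unfolding C_def by (metis mult.assoc)
qed

lemma same_column_shear:
  fixes A B :: "'a::comm_ring_1 mat2"
  assumes "mdet A = 1" "mdet B = 1" "m21 A = m21 B" "m21 B dvd m11 A - m11 B"
  obtains x y where "A = e12 x * B * e12 y"
proof -
  obtain x where x: "m11 A - m11 B = m21 B * x"
    using assms(4) by (auto simp: dvd_def)
  define C where "C = e12 x * B"
  have C: "m11 A = m11 C" "m21 A = m21 C" "mdet C = 1"
    using x assms(2,3) by (auto simp: C_def mdet_mult) (auto simp: times_mat2_def e12_def algebra_simps)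
  have "adj C * A = e12 (m22 C * m12 A - m12 C * m22 A)"
    using C assms(1) by (cases A; cases C) (auto simp: e12_def algebra_simps)
  then have "C * adj C * A = C * e12 (m22 C * m12 A - m12 C * m22 A)" by (simp add: mult.assoc)
  then have "A = C * e12 (m22 C * m12 A - m12 C * m22 A)"
    using adj_right[OF C(3)] by simp
  then show thesis using that unfolding C_def by metis
qed

lemma cancel_adj:
  assumes "mdet L = 1" "mdet R = 1" "C = L * M * R"
  shows "M = adj L * C * adj R"
proof -
  have "adj L * C * adj R = (adj L * L) * M * (R * adj R)"
    unfolding assms(3) by (simp only: mult.assoc)
  then show ?thesis using adj_left[OF assms(1)] adj_right[OF assms(2)] by simp
qed

text \<open>
  Here $m$ and $l$ are the diagonal of a matrix \<open>M0\<close> with off-diagonal entries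
  \<open>u1\<^sup>2 u2\<^sup>2 b\<close> and \<open>u1\<^sup>2 u2\<^sup>2 c\<close>. Four matrices
  are linked with \<open>M0\<close> in the middle: scaling \<open>M0\<close> upwards gives $C$ with
  first row $(m, b)$, and \<open>gamma * alpha\<close> scales to a matrix with first row $(v, b)$,
  which agrees with $C$ up to shears as $v \equiv m$ modulo $b$; scaling \<open>M0\<close> downwards
  gives $Z$ with first column $(m, c)$, which agrees with \<open>alpha\<close> up to shears as
  $m \equiv e$ modulo $c$. Hence \<open>gamma * alpha = U * alpha * W\<close>, where $W$ is a word
  of nine shears because \<open>scale_right\<close> consists of shears, and
  \<open>gamma = U * (alpha * W * adj alpha)\<close>.
\<close>

lemma core_matrix:
  fixes b c e :: "'a::comm_ring_1"
  assumes alpha: "alpha = Mat e b c d" "mdet alpha = 1" and gamma: "mdet gamma = 1"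
    and V: "gamma * alpha = Mat v (y\<^sup>2 * b) v' v''" "y dvd v - 1 \<or> y dvd v + 1"
    and M: "m * l - u1\<^sup>2 * (u2\<^sup>2 * b) * (u1\<^sup>2 * (u2\<^sup>2 * c)) = 1"
      "u1 dvd m - 1 \<or> u1 dvd m + 1" "u2 dvd m - 1 \<or> u2 dvd m + 1"
    and "b dvd v - m" "c dvd m - e"
  shows "gamma \<in> core_family"
proof -
  define M0 where "M0 = Mat m (u1\<^sup>2 * (u2\<^sup>2 * b)) (u1\<^sup>2 * (u2\<^sup>2 * c)) l"
  obtain q1 s1 where X1: "Mat m (u2\<^sup>2 * b) (u1\<^sup>2 * (u1\<^sup>2 * (u2\<^sup>2 * c))) l =
      scale_left u1 q1 s1 * M0 * scale_right u1"
    using scale_upper[OF M(1,2)] unfolding M0_def by blast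
  have det1: "m * l - u2\<^sup>2 * b * (u1\<^sup>2 * (u1\<^sup>2 * (u2\<^sup>2 * c))) = 1"
    using M(1) by (simp add: algebra_simps)
  obtain q2 s2 where X2: "Mat m b (u2\<^sup>2 * (u1\<^sup>2 * (u1\<^sup>2 * (u2\<^sup>2 * c)))) l =
      scale_left u2 q2 s2 * (scale_left u1 q1 s1 * M0 * scale_right u1) * scale_right u2"
    using scale_upper[OF det1 M(3)] unfolding X1 by blast
  define C where "C = Mat m b (u2\<^sup>2 * (u1\<^sup>2 * (u1\<^sup>2 * (u2\<^sup>2 * c)))) l"
  have detC: "mdet C = 1" using det1 unfolding C_def by (simp add: algebra_simps)
  have det2: "m * l - u1\<^sup>2 * (u1\<^sup>2 * (u2\<^sup>2 * b)) * (u2\<^sup>2 * c) = 1"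
    using M(1) by (simp add: algebra_simps)
  obtain q3 s3 where Z1: "Mat m (u1\<^sup>2 * (u1\<^sup>2 * (u2\<^sup>2 * b))) (u2\<^sup>2 * c) l =
      flip (scale_left u1 q3 s3) * M0 * flip (scale_right u1)"
    using scale_lower[OF det2 M(2)] unfolding M0_def by blast
  have det3: "m * l - u2\<^sup>2 * (u1\<^sup>2 * (u1\<^sup>2 * (u2\<^sup>2 * b))) * c = 1"
    using M(1) by (simp add: algebra_simps)
  obtain q4 s4 where Z2: "Mat m (u2\<^sup>2 * (u1\<^sup>2 * (u1\<^sup>2 * (u2\<^sup>2 * b)))) c l =
      flip (scale_left u2 q4 s4) * (flip (scale_left u1 q3 s3) * M0 * flip (scale_right u1)) * flip (scale_right u2)"
    using scale_lower[OF det3 M(3)] unfolding Z1 by blast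
  let ?L1 = "scale_left u1 q1 s1" and ?L2 = "scale_left u2 q2 s2"
  let ?F1 = "flip (scale_left u1 q3 s3)" and ?F2 = "flip (scale_left u2 q4 s4)"
  let ?G1 = "flip (scale_right u1)" and ?G2 = "flip (scale_right u2)"
  define Z where "Z = Mat m (u2\<^sup>2 * (u1\<^sup>2 * (u1\<^sup>2 * (u2\<^sup>2 * b)))) c l"
  have detZ: "mdet Z = 1" using det3 unfolding Z_def by simp
  obtain k k' where Zalpha: "Z = e12 k * alpha * e12 k'"
    using same_column_shear[OF detZ alpha(2)] assms(10) by (auto simp: Z_def alpha(1))
  have "M0 = adj (?F1) * (?F1 * M0 * ?G1) *
      adj (?G1)"
    by (rule cancel_adj) simp_all
  also have "?F1 * M0 * ?G1 =
      adj (?F2) * Z * adj (?G2)"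
    by (rule cancel_adj) (simp, simp, simp only: Z_def Z2)
  finally have M0: "M0 = adj (?F1) * adj (?F2) * Z *
      adj (?G2) * adj (?G1)"
    by (simp only: mult.assoc)
  have detV: "v * v'' - y\<^sup>2 * b * v' = 1"
    using mdet_mult[of gamma alpha] alpha(2) gamma V(1) by simp
  obtain q5 s5 where Y: "Mat v b (y\<^sup>2 * v') v'' = scale_left y q5 s5 * (gamma * alpha) * scale_right y"
    using scale_upper[OF detV V(2)] unfolding V(1) by blast
  let ?L = "scale_left y q5 s5"
  have detY: "mdet (Mat v b (y\<^sup>2 * v') v'') = 1" using detV by (simp add: algebra_simps)
  obtain z z' where YC: "Mat v b (y\<^sup>2 * v') v'' = e21 z * C * e21 z'"
    using same_row_shear[OF detY detC] assms(9) by (auto simp: C_def)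
  have "gamma * alpha = adj ?L * (e21 z * C * e21 z') * adj (scale_right y)"
    using cancel_adj[OF _ _ Y] unfolding YC by simp
  also have "C = ?L2 * ?L1 * M0 * scale_right u1 * scale_right u2"
    unfolding C_def X2 by (simp only: mult.assoc)
  finally have 1: "gamma * alpha = adj ?L * e21 z * ?L2 * ?L1 *
      adj (?F1) * adj (?F2) * e12 k * alpha *
      (e12 k' * adj (?G2) * adj (?G1) * scale_right u1 * scale_right u2 * e21 z' *
       adj (scale_right y))"
    unfolding M0 Zalpha by (simp only: mult.assoc)
  \<comment> \<open>Adjacent shears of the same kind are merged, which leaves nine of them.\<close>
  have 2: "e12 k' * adj (?G2) * adj (?G1) * scale_right u1 * scale_right u2 * e21 z' *
       adj (scale_right y) = prod_list [e12 (k' - 1), e21 ((u2 - 1)\<^sup>2), e12 (-1), e21 ((u1 - 1)\<^sup>2),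
         e12 ((u1 - 1)\<^sup>2), e21 (-1), e12 ((u2 - 1)\<^sup>2), e21 (z'), e12 (- (y - 1)\<^sup>2)]"
    (is "?W = prod_list ?Es")
    unfolding scale_right_def flip_mult adj_mult
    by (simp add: mult.assoc e12_mult' e21_mult' e12_mult e21_mult)
  have W: "alpha * ?W * adj alpha \<in> transvections ^ 9"
  proof -
    have "alpha * prod_list ?Es * adj alpha \<in> transvections ^ length ?Es"
      by (rule conj_word[OF alpha(2)]) (simp add: shears12_def shears21_def)
    moreover have "length ?Es = 9" by simp
    ultimately show ?thesis unfolding 2 by (simp only:)
  qed
  have "gamma = gamma * alpha * adj alpha"
    using adj_right[OF alpha(2)] by (simp add: mult.assoc)
  also have "\<dots> = adj ?L * e21 z * ?L2 * ?L1 *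
      adj (?F1) * adj (?F2) * e12 k * (alpha * ?W * adj alpha)"
    unfolding 1 by (simp only: mult.assoc)
  also have "\<dots> \<in> core_family"
    unfolding core_family_def
    by (intro set_times_intro W) (auto simp: scalings_def shears12_def shears21_def intro!: imageI)
  finally show ?thesis .
qed

lemma matfam_adj_flip:
  assumes "matfam d S"
  shows "matfam d (adj ` S)" "matfam d (flip ` S)"
proof -
  obtain F where F: "S = F ` tuples d" "polyfun d (\<lambda>t. m11 (F t))" "polyfun d (\<lambda>t. m12 (F t))"
    "polyfun d (\<lambda>t. m21 (F t))" "polyfun d (\<lambda>t. m22 (F t))"
    using assms unfolding matfam_def by auto
  have det: "mdet (F t) = 1" if "length t = d" for t
    using assms that unfolding matfam_def F(1) by (simp add: tuples_def)
  show "matfam d (adj ` S)"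
    unfolding F(1) image_image by (rule matfamI) (simp add: det, simp_all add: adj_def F polyfun_uminus)
  show "matfam d (flip ` S)"
    unfolding F(1) image_image by (rule matfamI) (simp add: det, simp_all add: flip_def F polyfun_uminus)
qed

lemma matfam_shears12: "matfam 1 (shears12 :: 'a::comm_ring_1 mat2 set)"
proof -
  have eq: "shears12 = (\<lambda>t. e12 (t ! 0) :: 'a mat2) ` tuples 1"
    by (auto simp: shears12_def tuples_def image_iff length_Suc_conv intro!: exI[of _ "[_]"])
  show ?thesis
    unfolding eq by (rule matfamI) (auto simp: e12_def intro!: polyfun_intros)
qed

lemma matfam_shears21: "matfam 1 (shears21 :: 'a::comm_ring_1 mat2 set)"
proof -
  have eq: "shears21 = (\<lambda>t. e21 (t ! 0) :: 'a mat2) ` tuples 1"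
    by (auto simp: shears21_def tuples_def image_iff length_Suc_conv intro!: exI[of _ "[_]"])
  show ?thesis
    unfolding eq by (rule matfamI) (auto simp: e21_def intro!: polyfun_intros)
qed

lemma matfam_transvections: "matfam 3 (transvections :: 'a::comm_ring_1 mat2 set)"
proof -
  have eq: "transvections = (\<lambda>t. transvection (t ! 0) (t ! 1) (t ! 2) :: 'a mat2) ` tuples 3"
    by (auto simp: transvections_def tuples_def image_iff intro!: exI[of _ "[_, _, _]"])
  show ?thesis
    unfolding eq by (rule matfamI) (simp, auto simp: transvection_def intro!: polyfun_intros)
qed

lemma matfam_scalings: "matfam 3 (scalings :: 'a::comm_ring_1 mat2 set)"
proof -
  have eq: "scalings = (\<lambda>t. scale_left (t ! 0) (t ! 1) (t ! 2) :: 'a mat2) ` tuples 3"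
    by (auto simp: scalings_def tuples_def image_iff intro!: exI[of _ "[_, _, _]"])
  show ?thesis
    unfolding eq
    by (rule matfamI)
       (simp, auto simp: scale_left_def e12_def e21_def shear_comm_def Let_def intro!: polyfun_intros)
qed

lemma matfam_core: "matfam 44 (core_family :: 'a::comm_ring_1 mat2 set)"
proof -
  have "matfam (3 + 1 + 3 + 3 + 3 + 3 + 1 + 9 * 3) (core_family :: 'a mat2 set)"
    unfolding core_family_def
    by (intro matfam_mult matfam_power matfam_adj_flip matfam_scalings matfam_shears12
        matfam_shears21 matfam_transvections)
  then show ?thesis by simp
qed

section \<open>Arithmetic of polynomials over a finite field\<close>

text \<open>
  Coprimality as the ideal-theoretic condition, which makes sense in every commutative ring. For a
  pair it is unimodularity.
\<close>

definition comax :: "'a::comm_ring_1 \<Rightarrow> 'a \<Rightarrow> bool" where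
  "comax a b \<longleftrightarrow> (\<exists>u v. u * a + v * b = 1)"

lemma comax_sym: "comax a b \<longleftrightarrow> comax b a"
  unfolding comax_def by (metis add.commute)

lemma comax_mult:
  assumes "comax a m" "comax b m"
  shows "comax (a * b) m"
proof -
  obtain u v u' v' where "u * a + v * m = 1" "u' * b + v' * m = 1"
    using assms by (auto simp: comax_def)
  then have "(u * a + v * m) * (u' * b + v' * m) = 1" by simp
  then have "(u * u') * (a * b) + (u * a * v' + v * u' * b + v * m * v') * m = 1"
    by (simp add: algebra_simps)
  then show ?thesis unfolding comax_def by blast
qed

lemma comax_1 [simp]: "comax 1 m"
  unfolding comax_def by (rule exI[of _ 1], rule exI[of _ 0]) simp

lemma comax_power: "comax a m \<Longrightarrow> comax (a ^ n) m"
  by (induction n) (auto intro: comax_mult)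

lemma comax_mult_iff: "comax (a * b) m \<longleftrightarrow> comax a m \<and> comax b m"
proof
  assume "comax (a * b) m"
  then obtain u v where uv: "u * (a * b) + v * m = 1" by (auto simp: comax_def)
  then have "(u * b) * a + v * m = 1" "(u * a) * b + v * m = 1" by (simp_all add: algebra_simps)
  then show "comax a m \<and> comax b m" unfolding comax_def by blast
qed (auto intro: comax_mult)

lemma comax_cong:
  fixes a b m :: "'a::unique_euclidean_ring"
  assumes "[a = b] (mod m)"
  shows "comax a m \<longleftrightarrow> comax b m"
proof -
  have "comax b m" if "comax a m" "[a = b] (mod m)" for a b :: 'a
  proof -
    obtain u v where uv: "u * a + v * m = 1" using \<open>comax a m\<close> by (auto simp: comax_def)
    obtain k where "a = b + m * k" using \<open>[a = b] (mod m)\<close>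
      by (metis cong_iff_dvd_diff dvd_def diff_eq_eq add.commute)
    then have "u * b + (v + u * k) * m = 1" using uv by (simp add: algebra_simps)
    then show ?thesis unfolding comax_def by blast
  qed
  then show ?thesis using assms cong_sym by blast
qed

lemma comax_inverse:
  fixes a m :: "'a::unique_euclidean_ring"
  assumes "comax a m"
  obtains b where "[a * b = 1] (mod m)" "comax b m"
proof -
  obtain u v where uv: "u * a + v * m = 1" using assms by (auto simp: comax_def)
  then have 1: "a * u - 1 = m * (- v)" by (simp add: algebra_simps)
  have "[a * u = 1] (mod m)" unfolding cong_iff_dvd_diff 1 by simp
  moreover have "comax u m" unfolding comax_def using uv by (metis mult.commute)
  ultimately show thesis using that by blast
qed

lemma cong_comax_cancel:
  fixes a b c m :: "'a::unique_euclidean_ring"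
  assumes "comax c m" "[c * a = c * b] (mod m)"
  shows "[a = b] (mod m)"
proof -
  obtain d where "[c * d = 1] (mod m)" using comax_inverse[OF assms(1)] .
  then have "[d * (c * a) = a] (mod m)" "[d * (c * b) = b] (mod m)"
    using cong_scalar_right[of "c * d" 1 m a] cong_scalar_right[of "c * d" 1 m b]
    by (simp_all add: algebra_simps)
  then show ?thesis using cong_scalar_left[OF assms(2), of d]
    by (meson cong_sym cong_trans)
qed

lemma chinese_remainder_comax:
  fixes a b m n :: "'a::unique_euclidean_ring"
  assumes "comax m n"
  obtains x where "[x = a] (mod m)" "[x = b] (mod n)"
proof -
  obtain u v where uv: "u * m + v * n = 1" using assms by (auto simp: comax_def)
  define x where "x = a * (v * n) + b * (u * m)"
  have vn: "v * n = 1 - u * m" and um: "u * m = 1 - v * n" using uv by (simp_all add: algebra_simps)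
  have "x - a = m * (b * u - a * u)" unfolding x_def vn by (simp add: algebra_simps)
  moreover have "x - b = n * (a * v - b * v)" unfolding x_def um by (simp add: algebra_simps)
  ultimately show thesis using that[of x] unfolding cong_iff_dvd_diff by (metis dvd_triv_left)
qed

lemma bezout_poly:
  fixes a b :: "'a::field poly"
  obtains u v where "u * a + v * b dvd a" "u * a + v * b dvd b"
proof -
  have "\<exists>u v. u * a + v * b dvd a \<and> u * a + v * b dvd b"
  proof (induction "degree b" arbitrary: a b rule: less_induct)
    case less
    show ?case
    proof (cases "b = 0")
      case True
      then show ?thesis by (intro exI[of _ 1] exI[of _ 0]) simp
    next
      case False
      have ab: "a = b * (a div b) + a mod b" by simp
      show ?thesis
      proof (cases "a mod b = 0")
        case True
        then show ?thesis by (intro exI[of _ 0] exI[of _ 1]) (simp add: dvd_eq_mod_eq_0)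
      next
        case F: False
        then have "degree (a mod b) < degree b" using False degree_mod_less by blast
        from less[OF this, of b] obtain u v where
          g: "u * b + v * (a mod b) dvd b" "u * b + v * (a mod b) dvd a mod b" by blast
        have "u * b + v * R = v * a + (u - v * D) * b" if "R = a - b * D" for R D
          unfolding that by (simp add: algebra_simps)
        then have eq: "u * b + v * (a mod b) = v * a + (u - v * (a div b)) * b"
          using minus_mult_div_eq_mod[symmetric] by blast
        have "u * b + v * (a mod b) dvd b * (a div b) + a mod b"
          by (rule dvd_add[OF dvd_mult2[OF g(1)] g(2)])
        then have "u * b + v * (a mod b) dvd a" by simp
        then show ?thesis using g(1) unfolding eq by (intro exI conjI)
      qed
    qed
  qed
  then show thesis using that by blast
qed

lemma irreducible_comax:
  fixes p a :: "'a::field poly"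
  assumes "irreducible p" "\<not> p dvd a"
  shows "comax a p"
proof -
  obtain u v where g: "u * a + v * p dvd a" "u * a + v * p dvd p" by (rule bezout_poly)
  then have "is_unit (u * a + v * p)"
    using assms irreducibleD' by (metis dvd_trans)
  then obtain w where "(u * a + v * p) * w = 1" by (metis dvdE)
  then have "(u * w) * a + (v * w) * p = 1" by (simp add: algebra_simps)
  then show ?thesis unfolding comax_def by blast
qed

lemma comax_not_dvd:
  fixes p a :: "'a::field poly"
  assumes "irreducible p" "comax a p"
  shows "\<not> p dvd a"
proof
  assume "p dvd a"
  moreover obtain u v where "u * a + v * p = 1" using assms(2) by (auto simp: comax_def)
  ultimately have "p dvd 1" by (metis dvd_add dvd_mult dvd_refl)
  then show False using irreducible_not_unit[OF assms(1)] by simp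
qed

text \<open>
  The polynomials of degree less than $n$, where zero counts as such a polynomial even if $n = 0$;
  so there are always $q^n$ of them.
\<close>

definition polys_lt :: "nat \<Rightarrow> 'a::zero poly set" where
  "polys_lt n = {p. \<forall>i\<ge>n. coeff p i = 0}"

lemma polys_lt_Suc: "polys_lt (Suc n) = (\<lambda>(a, p). pCons a p) ` (UNIV \<times> polys_lt n)"
proof (intro equalityI subsetI)
  fix p :: "'a poly" assume p: "p \<in> polys_lt (Suc n)"
  obtain a r where "p = pCons a r" by (cases p)
  then show "p \<in> (\<lambda>(a, p). pCons a p) ` (UNIV \<times> polys_lt n)"
    using p by (auto simp: polys_lt_def image_iff coeff_pCons split: nat.splits) 
qed (auto simp: polys_lt_def coeff_pCons split: nat.splits)

lemma card_polys_lt: "finite (polys_lt n :: 'a::{finite,zero} poly set) \<and>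
    card (polys_lt n :: 'a poly set) = CARD('a) ^ n"
proof (induction n)
  case 0
  have "polys_lt 0 = {0 :: 'a poly}" by (auto simp: polys_lt_def poly_eq_iff)
  then show ?case by simp
next
  case (Suc n)
  have "inj_on (\<lambda>(a, p). pCons a p) (UNIV \<times> polys_lt n :: ('a \<times> 'a poly) set)"
    by (auto simp: inj_on_def)
  then show ?case using Suc unfolding polys_lt_Suc by (simp add: card_image card_cartesian_product)
qed

lemma polys_lt_iff: "n > 0 \<Longrightarrow> p \<in> polys_lt n \<longleftrightarrow> degree p < n"
  by (auto simp: polys_lt_def intro: coeff_eq_0) (metis coeff_0 degree_0 leading_coeff_0_iff not_le)

lemma mod_eq_self_iff:
  fixes a m :: "'a::field poly"
  assumes "m \<noteq> 0"
  shows "a mod m = a \<longleftrightarrow> a \<in> polys_lt (degree m)"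
proof
  assume "a mod m = a"
  then have "a = 0 \<or> degree a < degree m"
    using degree_mod_less[OF assms, of a] by auto
  then show "a \<in> polys_lt (degree m)" by (auto simp: polys_lt_def coeff_eq_0)
next
  assume a: "a \<in> polys_lt (degree m)"
  then have "a = 0 \<or> degree a < degree m"
    by (auto simp: polys_lt_def) (metis leading_coeff_0_iff not_le)
  then show "a mod m = a" by (auto intro: mod_poly_less)
qed

definition residue_units :: "'a::field poly \<Rightarrow> 'a poly monoid" where
  "residue_units m = \<lparr>carrier = {a. a mod m = a \<and> comax a m}, mult = (\<lambda>a b. (a * b) mod m), one = 1 mod m\<rparr>"

lemma residue_units_simps [simp]:
  "a \<in> carrier (residue_units m) \<longleftrightarrow> a mod m = a \<and> comax a m"
  "a \<otimes>\<^bsub>residue_units m\<^esub> b = (a * b) mod m"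
  "\<one>\<^bsub>residue_units m\<^esub> = 1 mod m"
  by (simp_all add: residue_units_def)

lemma comax_mod [simp]: "comax (a mod m) m \<longleftrightarrow> comax a m" for a m :: "'a::field poly"
  by (rule comax_cong) simp

lemma comm_group_residue_units: "comm_group (residue_units m)" for m :: "'a::field poly"
proof (rule comm_groupI)
  fix a assume a: "a \<in> carrier (residue_units m)"
  then have "comax a m" by simp
  then obtain b where "[a * b = 1] (mod m)" "comax b m" by (rule comax_inverse)
  then have "b mod m \<in> carrier (residue_units m)" "(b mod m) \<otimes>\<^bsub>residue_units m\<^esub> a = \<one>\<^bsub>residue_units m\<^esub>"
    by (simp_all add: mod_mult_left_eq mod_mult_right_eq cong_def mult.commute[of _ a])
  then show "\<exists>y\<in>carrier (residue_units m). y \<otimes>\<^bsub>residue_units m\<^esub> a = \<one>\<^bsub>residue_units m\<^esub>" by blast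
qed (auto simp: comax_mult mod_mult_left_eq mod_mult_right_eq mult_ac)

lemma residue_units_pow: "(a mod m) [^]\<^bsub>residue_units m\<^esub> (n::nat) = a ^ n mod m"
proof (induction n)
  case (Suc n)
  then show ?case by (simp add: mod_mult_left_eq mod_mult_right_eq mod_mult_eq mult.commute)
qed (simp add: nat_pow_def)

lemma finite_residue_units:
  "m \<noteq> 0 \<Longrightarrow> finite (carrier (residue_units (m :: 'a::{finite,field} poly)))"
  using card_polys_lt[of "degree m"] mod_eq_self_iff[of m]
  by (auto simp: residue_units_def intro: finite_subset)

lemma order_residue_units_irreducible:
  fixes p :: "'a::{finite,field} poly"
  assumes "irreducible p"
  shows "Coset.order (residue_units p) = CARD('a) ^ degree p - 1"
proof -
  have [simp]: "p \<noteq> 0" using assms by auto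
  have "carrier (residue_units p) = polys_lt (degree p) - {0 :: 'a poly}"
  proof (intro equalityI subsetI)
    fix a assume "a \<in> carrier (residue_units p)"
    then show "a \<in> polys_lt (degree p) - {0}"
      using mod_eq_self_iff[of p a] comax_not_dvd[OF assms, of a] by auto
  next
    fix a :: "'a poly" assume "a \<in> polys_lt (degree p) - {0}"
    then have "a mod p = a" "a \<noteq> 0" using mod_eq_self_iff[of p a] by auto
    then have "\<not> p dvd a" by (metis dvd_imp_mod_0)
    then show "a \<in> carrier (residue_units p)"
      using irreducible_comax[OF assms] \<open>a mod p = a\<close> by simp
  qed
  then have "Coset.order (residue_units p) = card (polys_lt (degree p) - {0 :: 'a poly})"
    by (simp only: Coset.order_def)
  also have "\<dots> = card (polys_lt (degree p) :: 'a poly set) - 1"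
    by (rule card_Diff_singleton) (simp add: polys_lt_def)
  finally show ?thesis
    using card_polys_lt[where 'a = 'a, of "degree p"] by simp
qed

lemma fermat_poly:
  fixes p :: "'a::{finite,field} poly"
  assumes "irreducible p" "comax a p"
  shows "[a ^ (CARD('a) ^ degree p - 1) = 1] (mod p)"
proof -
  interpret comm_group "residue_units p" by (rule comm_group_residue_units)
  have "(a mod p) [^]\<^bsub>residue_units p\<^esub> Coset.order (residue_units p) = \<one>\<^bsub>residue_units p\<^esub>"
    by (rule pow_order_eq_1) (use assms in simp)
  then show ?thesis
    unfolding residue_units_pow order_residue_units_irreducible[OF assms(1)] by (simp add: cong_def)
qed

lemma fermat_poly':
  fixes p :: "'a::{finite,field} poly"
  assumes "irreducible p"
  shows "[a ^ (CARD('a) ^ (degree p * i)) = a] (mod p)"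
proof (induction i)
  case (Suc i)
  have 1: "[b ^ (CARD('a) ^ degree p) = b] (mod p)" for b
  proof (cases "comax b p")
    case True
    have "CARD('a) ^ degree p = (CARD('a) ^ degree p - 1) + 1" by simp
    then have "b ^ (CARD('a) ^ degree p) = b ^ (CARD('a) ^ degree p - 1) * b"
      by (metis power_add power_one_right)
    then show ?thesis using cong_scalar_right[OF fermat_poly[OF assms True], of b] by simp
  next
    case False
    then have "p dvd b" using irreducible_comax[OF assms] by blast
    moreover have "b dvd b ^ (CARD('a) ^ degree p)" by (simp add: dvd_power)
    ultimately show ?thesis by (meson cong_0_iff cong_sym cong_trans dvd_trans)
  qed
  have "a ^ (CARD('a) ^ (degree p * Suc i)) = (a ^ (CARD('a) ^ (degree p * i))) ^ (CARD('a) ^ degree p)"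
    by (simp add: power_add power_mult[symmetric] mult.commute)
  then show ?case using 1[of "a ^ (CARD('a) ^ (degree p * i))"] Suc cong_trans by metis
qed simp

text \<open>
  Fermat's theorem modulo the linear polynomial $x$, whose residue field is the field of constants.
\<close>

lemma finite_field_power_card: "x ^ CARD('a) = x" for x :: "'a::{finite,field}"
proof -
  have "irreducible [:0, 1 :: 'a:]" by (rule irreducible_linear_field_poly) simp
  from fermat_poly'[OF this, of "[:x:]" 1] have "[:0, 1:] dvd [:x:] ^ CARD('a) - [:x:]"
    by (simp add: cong_iff_dvd_diff)
  then have "[:- 0, 1:] dvd [:x:] ^ CARD('a) - [:x:]" by (simp only: minus_zero)
  then have "poly ([:x:] ^ CARD('a) - [:x:]) 0 = 0"
    by (simp only: poly_eq_0_iff_dvd)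
  then show ?thesis by (simp add: poly_power del: poly_eq_0_iff_dvd)
qed

lemma finite_field_power_card_power: "x ^ (CARD('a) ^ n) = x" for x :: "'a::{finite,field}"
  by (induction n) (simp_all add: power_mult finite_field_power_card mult.commute)

lemma finite_field_power_cong_1:
  fixes x :: "'a::{finite,field}"
  assumes "x \<noteq> 0" "[n = 1] (mod (CARD('a) - 1))" "n > 0"
  shows "x ^ n = x"
proof -
  have q: "CARD('a) > 1"
    using card_mono[of UNIV "{0, 1 :: 'a}"] by simp
  have "x ^ (CARD('a) - 1) * x = x"
    using finite_field_power_card[of x] q power_minus_mult[of "CARD('a)" x] by simp
  then have 1: "x ^ (CARD('a) - 1) = 1" using assms(1) by simp
  obtain k where "n = 1 + k * (CARD('a) - 1)"
    using assms(2,3) q by (metis One_nat_def Suc_leI add.commute cong_le_nat mult.commute)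
  then have "x ^ n = x * (x ^ (CARD('a) - 1)) ^ k"
    by (simp add: power_mult[symmetric] mult.commute)
  then show ?thesis using 1 by simp
qed

lemma prime_CHAR_finite: "prime CHAR('a::{finite,field})"
  by (rule prime_CHAR_semidom) (simp add: finite_imp_CHAR_pos)

text \<open>
  The value at a point of the algebraic closure. If $b$ is a root of an irreducible $p$, then
  evaluation at $b$ embeds the residue field modulo $p$ in the algebraic closure
  (\<open>ac_eval_eq_iff_cong\<close>).
\<close>

abbreviation ac_eval :: "'a::field alg_closure \<Rightarrow> 'a poly \<Rightarrow> 'a alg_closure" where
  "ac_eval x f \<equiv> poly (map_poly to_ac f) x"

lemma ac_eval_pCons [simp]: "ac_eval x (pCons a f) = to_ac a + x * ac_eval x f"
  by (simp add: map_poly_pCons)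

lemma ac_eval_add [simp]: "ac_eval x (f + g) = ac_eval x f + ac_eval x g"
proof -
  have "map_poly to_ac (f + g) = map_poly to_ac f + map_poly to_ac g"
    by (rule poly_eqI) (simp add: coeff_map_poly)
  then show ?thesis by simp
qed

lemma ac_eval_smult [simp]: "ac_eval x (smult c f) = to_ac c * ac_eval x f"
  by (induction f) (simp_all add: algebra_simps)

lemma ac_eval_mult [simp]: "ac_eval x (f * g) = ac_eval x f * ac_eval x g"
  by (induction f) (simp_all add: algebra_simps)

lemma ac_eval_1 [simp]: "ac_eval x 1 = 1"
  by (simp add: one_pCons)

lemma ac_eval_minus [simp]: "ac_eval x (f - g) = ac_eval x f - ac_eval x g"
  using ac_eval_add[where f = "f - g" and g = g and x = x] by simp

lemma ac_eval_power [simp]: "ac_eval x (f ^ n) = ac_eval x f ^ n"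
  by (induction n) simp_all

lemma ac_eval_eq_0_iff:
  assumes "irreducible p" "ac_eval b p = 0"
  shows "ac_eval b f = 0 \<longleftrightarrow> p dvd f"
proof
  assume f: "ac_eval b f = 0"
  show "p dvd f"
  proof (rule ccontr)
    assume "\<not> p dvd f"
    then have "comax f p" by (rule irreducible_comax[OF assms(1)])
    from this[unfolded comax_def] obtain u v where "u * f + v * p = 1" by (elim exE)
    then have "ac_eval b (u * f + v * p) = 1" by simp
    then show False using f assms(2) by simp
  qed
next
  assume "p dvd f"
  then show "ac_eval b f = 0" using assms(2) by (auto elim!: dvdE)
qed

lemma ac_eval_eq_iff_cong:
  assumes "irreducible p" "ac_eval b p = 0"
  shows "ac_eval b f = ac_eval b g \<longleftrightarrow> [f = g] (mod p)"
  using ac_eval_eq_0_iff[OF assms, of "f - g"] by (simp add: cong_iff_dvd_diff)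

lemma irreducible_degree_pos:
  fixes p :: "'a::field poly"
  assumes "irreducible p"
  shows "degree p > 0"
proof -
  have "p \<noteq> 0" using assms by auto
  then show ?thesis using irreducible_not_unit[OF assms] is_unit_iff_degree[of p] by simp
qed

lemma ac_root_exists:
  assumes "irreducible (p :: 'a::field poly)"
  obtains b where "ac_eval b p = 0"
proof -
  have "degree (map_poly to_ac p) > 0"
    using irreducible_degree_pos[OF assms] by (subst degree_map_poly) auto
  then show thesis using alg_closed_imp_poly_has_root that by blast
qed

lemma frobenius_add:
  fixes x y :: "'b::comm_ring_1"
  assumes "CARD('a::{finite,field}) = CHAR('a) ^ k" "CHAR('b) = CHAR('a)"
  shows "(x + y) ^ (CARD('a) ^ n) = x ^ (CARD('a) ^ n) + y ^ (CARD('a) ^ n)"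
proof (rule freshmans_dream')
  show "prime CHAR('b)" using prime_CHAR_finite[where 'a = 'a] assms(2) by simp
  show "CARD('a) ^ n = CHAR('b) ^ (k * n)" using assms by (simp add: power_mult)
qed

lemma frobenius_diff:
  fixes x y :: "'b::comm_ring_1"
  assumes "CARD('a::{finite,field}) = CHAR('a) ^ k" "CHAR('b) = CHAR('a)"
  shows "(x - y) ^ (CARD('a) ^ n) = x ^ (CARD('a) ^ n) - y ^ (CARD('a) ^ n)"
  using frobenius_add[OF assms, of "x - y" y n] by (simp add: algebra_simps)

lemma ac_eval_frobenius:
  fixes f :: "'a::{finite,field} poly"
  assumes "CARD('a) = CHAR('a) ^ k"
  shows "ac_eval x f ^ (CARD('a) ^ n) = ac_eval (x ^ (CARD('a) ^ n)) f"
proof (induction f)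
  case (pCons a f)
  have "to_ac a ^ (CARD('a) ^ n) = to_ac a"
    using finite_field_power_card_power[of a n] by (simp flip: to_ac_power)
  then show ?case
    using pCons by (simp add: frobenius_add[OF assms] power_mult_distrib)
qed simp

lemma prod_linear_dvd:
  fixes p :: "'a::field poly"
  assumes "finite A" "\<And>x. x \<in> A \<Longrightarrow> poly p x = 0"
  shows "(\<Prod>x\<in>A. [:- x, 1:]) dvd p"
  using assms
proof (induction A rule: finite_induct)
  case (insert x A)
  then obtain r where r: "p = (\<Prod>x\<in>A. [:- x, 1:]) * r" by (auto elim: dvdE)
  have "poly (\<Prod>x\<in>A. [:- x, 1:]) x \<noteq> 0"
    using insert.hyps by (auto simp: poly_prod)
  then have "poly r x = 0" using insert.prems[of x] r by auto
  then obtain r' where "r = [:- x, 1:] * r'" by (metis dvdE poly_eq_0_iff_dvd)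
  then have "p = (\<Prod>x\<in>insert x A. [:- x, 1:]) * r'"
    unfolding r prod.insert[OF insert.hyps] by (simp only: \<open>r = _\<close> mult_ac)
  then show ?case by (metis dvd_triv_left)
qed simp

text \<open>
  The powers $b^{q^i}$ are roots because the Frobenius map fixes the coefficients, so it suffices
  that they are distinct for $i < j$, \<open>j = degree p\<close>. If two of them agreed, then $b$
  and all values of polynomials at $b$ would be roots of $x^{q^d} - x$ for some $d < j$. But these
  values are the $q^j$ elements of the residue field modulo $p$.
\<close>

lemma ac_conjugates:
  fixes p :: "'a::{finite,field} poly"
  assumes char: "CARD('a) = CHAR('a) ^ k"
    and p: "irreducible p" "lead_coeff p = 1" "ac_eval b p = 0"
  shows "map_poly to_ac p = (\<Prod>i<degree p. [:- (b ^ (CARD('a) ^ i)), 1:])"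
proof -
  let ?q = "CARD('a)" and ?j = "degree p"
  have q: "?q > 1" using card_mono[of UNIV "{0, 1 :: 'a}"] by simp
  have inj: "inj_on (\<lambda>i. b ^ (?q ^ i)) {..<?j}"
  proof (rule linorder_inj_onI)
    fix i l assume il: "i < l" "i \<in> {..<?j}" "l \<in> {..<?j}"
    show "b ^ (?q ^ i) \<noteq> b ^ (?q ^ l)"
    proof
      assume eq: "b ^ (?q ^ i) = b ^ (?q ^ l)"
      define d where "d = l - i"
      have "b ^ (?q ^ l) = (b ^ (?q ^ d)) ^ (?q ^ i)"
        using il by (simp add: d_def power_mult[symmetric] power_add[symmetric])
      then have "(b - b ^ (?q ^ d)) ^ (?q ^ i) = 0"
        using eq by (simp add: frobenius_diff[OF char])
      then have bd: "b ^ (?q ^ d) = b" by simp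
      have d: "0 < d" "d < ?j" using il by (auto simp: d_def)
      define P :: "'a alg_closure poly" where "P = monom 1 (?q ^ d) - monom 1 1"
      have qd: "?q ^ d > 1" using one_less_power[OF q d(1)] .
      have "coeff P (?q ^ d) = 1" using qd by (simp add: P_def)
      then have P: "P \<noteq> 0" by auto
      have degP: "degree P \<le> ?q ^ d"
        unfolding P_def using qd by (intro degree_diff_le degree_monom_le[THEN order_trans]) auto
      have "(\<lambda>f. ac_eval b f) ` polys_lt ?j \<subseteq> {x. poly P x = 0}"
        using ac_eval_frobenius[OF char, where x = b and n = d] bd by (auto simp: P_def poly_monom)
      moreover have "inj_on (\<lambda>f. ac_eval b f) (polys_lt ?j)"
      proof (rule inj_onI)
        fix f g :: "'a poly" assume fg: "f \<in> polys_lt ?j" "g \<in> polys_lt ?j" "ac_eval b f = ac_eval b g"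
        then have "f mod p = g mod p"
          using ac_eval_eq_iff_cong[OF p(1,3)] by (simp add: cong_def)
        moreover have "p \<noteq> 0" using p(2) by auto
        ultimately show "f = g" using fg mod_eq_self_iff[of p] by metis
      qed
      ultimately have "card (polys_lt ?j :: 'a poly set) \<le> card {x. poly P x = 0}"
        by (metis P card_image card_mono poly_roots_finite)
      also have "\<dots> \<le> ?q ^ d" using P card_poly_roots_bound degP order_trans by blast
      finally have "?q ^ ?j \<le> ?q ^ d" using card_polys_lt[where 'a = 'a] by metis
      then show False using q d by simp
    qed
  qed auto
  have root: "poly (map_poly to_ac p) (b ^ (?q ^ i)) = 0" for i
    using ac_eval_frobenius[OF char, where x = b and f = p and n = i] p(3) q by (simp add: power_0_left)
  have "(\<Prod>x\<in>(\<lambda>i. b ^ (?q ^ i)) ` {..<?j}. [:- x, 1:]) dvd map_poly to_ac p"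
    using root by (intro prod_linear_dvd) auto
  then have "(\<Prod>i<?j. [:- (b ^ (?q ^ i)), 1:]) dvd map_poly to_ac p"
    by (simp add: prod.reindex[OF inj])
  then obtain r where r: "map_poly to_ac p = (\<Prod>i<?j. [:- (b ^ (?q ^ i)), 1:]) * r" by (auto elim: dvdE)
  have lead: "lead_coeff (map_poly to_ac p) = 1"
    using p(2) by (subst lead_coeff_map_poly_nz) auto
  have degp: "degree (map_poly to_ac p) = ?j" by (rule degree_map_poly) simp
  have degprod: "degree (\<Prod>i<?j. [:- (b ^ (?q ^ i)), 1:]) = ?j"
    by (subst degree_prod_eq_sum_degree) auto
  have leadprod: "lead_coeff (\<Prod>i<?j. [:- (b ^ (?q ^ i)), 1:]) = 1"
    by (simp add: lead_coeff_prod)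
  have r0: "r \<noteq> 0" using r lead by auto
  have "(\<Prod>i<?j. [:- (b ^ (?q ^ i)), 1:]) \<noteq> 0" using leadprod by auto
  from degree_mult_eq[OF this r0] have "degree (map_poly to_ac p) = ?j + degree r"
    unfolding degprod r[symmetric] .
  then have "degree r = 0" using degp by simp
  moreover have "lead_coeff r = 1"
    using lead leadprod unfolding r lead_coeff_mult by simp
  ultimately have "r = 1" by (metis degree_eq_zeroE lead_coeff_pCons(2) one_pCons)
  then show ?thesis using r by simp
qed

text \<open>
  With $b$ a root of $p$, the power on the left is the norm of $h (b)$, that is, the product of the
  values of $h$ at all roots of $p$. Both sides are the resultant of $p$ and $h$, written as a
  double product over the roots of $p$ and the roots $A$ of $h$. The roots of $h$ do not depend on
  $p$, and so the right-hand side depends on $p$ only through its degree and its residue class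
  modulo $h$.
\<close>

lemma norm_reciprocity:
  fixes h :: "'a::{finite,field} poly"
  assumes char: "CARD('a) = CHAR('a) ^ k" and "h \<noteq> 0"
  obtains A where "size A = degree h" "\<And>x. x \<in># A \<Longrightarrow> ac_eval x h = 0"
    "\<And>p b. irreducible p \<Longrightarrow> lead_coeff p = 1 \<Longrightarrow> ac_eval b p = 0 \<Longrightarrow>
      ac_eval b h ^ (\<Sum>i<degree p. CARD('a) ^ i) =
        to_ac (lead_coeff h) ^ degree p * (- 1) ^ (degree h * degree p) * (\<Prod>x\<in>#A. ac_eval x p)"
proof -
  let ?H = "map_poly to_ac h"
  have "?H \<noteq> 0" using assms(2) by (subst map_poly_eq_0_iff) auto
  then obtain A where A: "size A = degree ?H" "?H = smult (lead_coeff ?H) (\<Prod>x\<in>#A. [:- x, 1:])"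
    using alg_closed_imp_factorization by blast
  have degh: "degree ?H = degree h" by (rule degree_map_poly) simp
  have leadh: "lead_coeff ?H = to_ac (lead_coeff h)"
    using assms(2) by (subst lead_coeff_map_poly_nz) auto
  have evh: "ac_eval y h = to_ac (lead_coeff h) * (\<Prod>x\<in>#A. y - x)" for y
  proof -
    have "poly (\<Prod>x\<in>#A. [:- x, 1:]) y = (\<Prod>x\<in>#A. y - x)"
      by (induction A) (simp_all add: algebra_simps)
    then show ?thesis by (subst A(2)) (simp add: leadh)
  qed
  show thesis
  proof (rule that)
    show "size A = degree h" using A(1) degh by simp
    show "ac_eval x h = 0" if "x \<in># A" for x
      using that unfolding evh by (auto simp: prod_mset_zero_iff)
    fix p :: "'a poly" and b assume p: "irreducible p" "lead_coeff p = 1" "ac_eval b p = 0"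
    let ?j = "degree p"
    let ?b = "\<lambda>i. b ^ (CARD('a) ^ i)"
    have evp: "ac_eval y p = (\<Prod>i<?j. y - ?b i)" for y
      by (simp add: ac_conjugates[OF char p] poly_prod)
    have swap: "(\<Prod>i<?j. \<Prod>x\<in>#A. ?b i - x) = (- 1) ^ (size A * ?j) * (\<Prod>x\<in>#A. ac_eval x p)"
    proof (induction A)
      case (add x A)
      have "(\<Prod>i<?j. ?b i - x) = (\<Prod>i<?j. (- 1) * (x - ?b i))" by simp
      also have "\<dots> = (- 1) ^ ?j * ac_eval x p" by (simp only: prod.distrib evp) simp
      finally show ?case using add by (simp add: prod.distrib power_add mult_ac)
    qed simp
    have "ac_eval b h ^ (\<Sum>i<?j. CARD('a) ^ i) = (\<Prod>i<?j. ac_eval (?b i) h)"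
      by (simp add: power_sum ac_eval_frobenius[OF char])
    also have "\<dots> = to_ac (lead_coeff h) ^ ?j * (\<Prod>i<?j. \<Prod>x\<in>#A. ?b i - x)"
      unfolding evh by (simp add: prod.distrib)
    also have "\<dots> = to_ac (lead_coeff h) ^ ?j * (- 1) ^ (degree h * ?j) * (\<Prod>x\<in>#A. ac_eval x p)"
      unfolding swap using A(1) degh by simp
    finally show "ac_eval b h ^ (\<Sum>i<?j. CARD('a) ^ i) =
      to_ac (lead_coeff h) ^ ?j * (- 1) ^ (degree h * ?j) * (\<Prod>x\<in>#A. ac_eval x p)" .
  qed
qed

section \<open>Characters of finite abelian groups\<close>

text \<open>
  Characters vanish outside the group. Thus a character is determined by its values on the group,
  and for unit groups of residue rings the extension by zero is the usual one to all residues.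
\<close>

definition chars :: "('g, 'b) monoid_scheme \<Rightarrow> ('g \<Rightarrow> complex) set" where
  "chars G = {\<xi>. \<xi> \<one>\<^bsub>G\<^esub> = 1 \<and> (\<forall>x\<in>carrier G. \<forall>y\<in>carrier G. \<xi> (x \<otimes>\<^bsub>G\<^esub> y) = \<xi> x * \<xi> y) \<and>
    (\<forall>x. x \<notin> carrier G \<longrightarrow> \<xi> x = 0)}"

definition trivial_char :: "('g, 'b) monoid_scheme \<Rightarrow> 'g \<Rightarrow> complex" where
  "trivial_char G x = (if x \<in> carrier G then 1 else 0)"

locale finite_comm_group = comm_group G for G (structure) +
  assumes fin: "finite (carrier G)"
begin

abbreviation N :: nat where "N \<equiv> card (carrier G)"

lemma N_pos: "N > 0"
  using fin by (auto simp: card_gt_0_iff)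

lemma pow_N: "x \<in> carrier G \<Longrightarrow> x [^] N = \<one>"
  using pow_order_eq_1 by (simp add: Coset.order_def)

lemma charD:
  assumes "\<xi> \<in> chars G"
  shows "\<xi> \<one> = 1" "x \<in> carrier G \<Longrightarrow> y \<in> carrier G \<Longrightarrow> \<xi> (x \<otimes> y) = \<xi> x * \<xi> y"
    "x \<notin> carrier G \<Longrightarrow> \<xi> x = 0"
  using assms by (auto simp: chars_def)

lemma char_pow: "\<xi> \<in> chars G \<Longrightarrow> x \<in> carrier G \<Longrightarrow> \<xi> (x [^] (n::nat)) = \<xi> x ^ n"
  by (induction n) (auto simp: charD)

lemma char_root: "\<xi> \<in> chars G \<Longrightarrow> x \<in> carrier G \<Longrightarrow> \<xi> x ^ N = 1"
  using char_pow[of \<xi> x N] by (simp add: pow_N charD)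

lemma char_nz: "\<xi> \<in> chars G \<Longrightarrow> x \<in> carrier G \<Longrightarrow> \<xi> x \<noteq> 0"
  using char_root[of \<xi> x] N_pos by (auto simp: power_0_left)

lemma finite_chars: "finite (chars G)"
proof (rule finite_subset)
  show "chars G \<subseteq> {\<xi>. \<forall>x. (x \<in> carrier G \<longrightarrow> \<xi> x \<in> {z. z ^ N = 1}) \<and> (x \<notin> carrier G \<longrightarrow> \<xi> x = 0)}"
    using char_root charD(3) by blast
  have "finite {z::complex. z ^ N = 1}"
    using finite_roots_unity[of N] N_pos by simp
  then show "finite {\<xi> :: _ \<Rightarrow> complex. \<forall>x. (x \<in> carrier G \<longrightarrow> \<xi> x \<in> {z. z ^ N = 1}) \<and> (x \<notin> carrier G \<longrightarrow> \<xi> x = 0)}"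
    using fin by (rule finite_set_of_finite_funs[rotated])
qed

lemma trivial_char_in: "trivial_char G \<in> chars G"
  by (auto simp: chars_def trivial_char_def)

lemma char_mult: "\<xi> \<in> chars G \<Longrightarrow> \<psi> \<in> chars G \<Longrightarrow> (\<lambda>x. \<xi> x * \<psi> x) \<in> chars G"
  by (auto simp: chars_def)

text \<open>
  A character of the subgroup $H$; the values of $\xi$ outside $H$ are arbitrary. For a finite group
  closure under multiplication is enough for a subgroup.
\<close>

definition partial_char :: "'a set \<Rightarrow> ('a \<Rightarrow> complex) \<Rightarrow> bool" where
  "partial_char H \<xi> \<longleftrightarrow> H \<subseteq> carrier G \<and> \<one> \<in> H \<and> (\<forall>x\<in>H. \<forall>y\<in>H. x \<otimes> y \<in> H \<and> \<xi> (x \<otimes> y) = \<xi> x * \<xi> y) \<and>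
    \<xi> \<one> = 1"

lemma partial_char_pow:
  assumes "partial_char H \<xi>" "x \<in> H"
  shows "x [^] (n::nat) \<in> H \<and> \<xi> (x [^] n) = \<xi> x ^ n"
  using assms by (induction n) (auto simp: partial_char_def)

lemma partial_char_inv:
  assumes "partial_char H \<xi>" "x \<in> H"
  shows "inv x \<in> H"
proof -
  have x: "x \<in> carrier G" using assms by (auto simp: partial_char_def)
  have "x [^] (N - 1) \<otimes> x = \<one>"
    using pow_N[OF x] N_pos by (metis Suc_diff_1 nat_pow_Suc)
  then have "inv x = x [^] (N - 1)" using x by (metis inv_equality nat_pow_closed)
  then show ?thesis using partial_char_pow[OF assms] by simp
qed

text \<open>
  If $k$ is the order of $x$ modulo $H$, then the value at $x$ can be any $k$-th root $z$ of
  $\xi (x^k)$: the assignment $h x^i \mapsto \xi (h) z^i$ is well defined, since $x^d \in H$ only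
  for multiples $d$ of $k$.
\<close>

lemma partial_char_extend:
  assumes H: "partial_char H \<xi>" and x: "x \<in> carrier G" "x \<notin> H"
  obtains k where "k \<ge> 2" "x [^] (k::nat) \<in> H"
    "\<And>z. z ^ k = \<xi> (x [^] k) \<Longrightarrow>
      \<exists>H' \<xi>'. partial_char H' \<xi>' \<and> H \<subset> H' \<and> x \<in> H' \<and> (\<forall>h\<in>H. \<xi>' h = \<xi> h) \<and> \<xi>' x = z"
proof -
  have Hc: "H \<subseteq> carrier G" "\<one> \<in> H" using H by (auto simp: partial_char_def)
  define k where "k = (LEAST k::nat. k > 0 \<and> x [^] k \<in> H)"
  have "N > 0 \<and> x [^] N \<in> H" using N_pos pow_N[OF x(1)] Hc by simp
  then have "k > 0 \<and> x [^] k \<in> H" unfolding k_def by (rule LeastI)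
  then have k: "k > 0" "x [^] k \<in> H" by auto
  have kleast: "k \<le> i" if "i > 0" "x [^] i \<in> H" for i
    unfolding k_def using that by (intro Least_le) auto
  have "k \<noteq> 1" using k x by auto
  then have k2: "k \<ge> 2" using k(1) by simp
  have kdvd: "k dvd d" if "x [^] (d::nat) \<in> H" for d :: nat
  proof (rule ccontr)
    assume "\<not> k dvd d"
    then have m: "d mod k > 0" by (simp add: mod_greater_zero_iff_not_dvd)
    have "x [^] d = x [^] (d mod k) \<otimes> (x [^] k) [^] (d div k)"
      using x(1) by (simp add: nat_pow_pow nat_pow_mult)
    then have "x [^] (d mod k) = x [^] d \<otimes> inv ((x [^] k) [^] (d div k))"
      using x(1) by (simp add: m_assoc)
    moreover have "inv ((x [^] k) [^] (d div k)) \<in> H"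
      using partial_char_inv[OF H] partial_char_pow[OF H k(2)] by blast
    ultimately have "x [^] (d mod k) \<in> H" using that H by (auto simp: partial_char_def)
    then show False using kleast[OF m] k(1) by (meson mod_less_divisor not_le)
  qed
  show thesis
  proof (rule that[OF k2 k(2)])
    fix z assume z: "z ^ k = \<xi> (x [^] k)"
    have wd: "\<xi> h * z ^ i = \<xi> h' * z ^ i'"
      if "h \<in> H" "h' \<in> H" "h \<otimes> x [^] i = h' \<otimes> x [^] i'" "i \<le> i'" for h h' and i i' :: nat
    proof -
      have hc: "h \<in> carrier G" "h' \<in> carrier G" using that Hc by auto
      have "x [^] i' = x [^] (i' - i) \<otimes> x [^] i" using that(4) x(1) by (simp add: nat_pow_mult)
      then have eq: "h = h' \<otimes> x [^] (i' - i)"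
        using that(3) hc x(1) by (simp add: m_assoc[symmetric])
      then have "x [^] (i' - i) = inv h' \<otimes> h" using hc x(1) by (simp add: m_assoc[symmetric])
      then have d: "x [^] (i' - i) \<in> H"
        using that partial_char_inv[OF H] H by (auto simp: partial_char_def)
      obtain m where m: "i' - i = k * m" using kdvd[OF d] by (auto elim: dvdE)
      have "\<xi> (x [^] (i' - i)) = z ^ (i' - i)"
        using partial_char_pow[OF H k(2), of m] x(1) unfolding m
        by (simp add: nat_pow_pow[symmetric] z power_mult)
      then have "\<xi> h = \<xi> h' * z ^ (i' - i)"
        using eq d that(2) H by (auto simp: partial_char_def)
      then show ?thesis using that(4) by (simp add: power_add[symmetric])
    qed
    define H' where "H' = {h \<otimes> x [^] (i::nat) | h i. h \<in> H}"
    \<comment> \<open>The value does not depend on the representation of \<open>y\<close>, by \<open>wd\<close>.\<close>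
    define \<xi>' where "\<xi>' y = (SOME c. \<exists>h i. h \<in> H \<and> y = h \<otimes> x [^] (i::nat) \<and> c = \<xi> h * z ^ i)" for y
    have \<xi>': "\<xi>' (h \<otimes> x [^] i) = \<xi> h * z ^ i" if "h \<in> H" for h and i :: nat
    proof -
      have "\<exists>h' i'. h' \<in> H \<and> h \<otimes> x [^] i = h' \<otimes> x [^] (i'::nat) \<and> \<xi>' (h \<otimes> x [^] i) = \<xi> h' * z ^ i'"
        unfolding \<xi>'_def by (rule someI_ex) (use that in blast)
      then obtain h' i' where "h' \<in> H" "h \<otimes> x [^] i = h' \<otimes> x [^] (i'::nat)" "\<xi>' (h \<otimes> x [^] i) = \<xi> h' * z ^ i'"
        by blast
      then show ?thesis using wd[of h h' i i'] wd[of h' h i' i] that by (metis nle_le)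
    qed
    have sub: "h \<in> H'" and ext: "\<xi>' h = \<xi> h" if "h \<in> H" for h
    proof -
      have h: "h = h \<otimes> x [^] (0::nat)" using that Hc by auto
      show "h \<in> H'" unfolding H'_def using h that by blast
      show "\<xi>' h = \<xi> h" using \<xi>'[OF that, of 0] that Hc by auto
    qed
    have "x = \<one> \<otimes> x [^] (1::nat)" using x(1) by simp
    then have xH': "x \<in> H'" and \<xi>x: "\<xi>' x = z"
      using \<xi>'[of \<one> 1] Hc H by (auto simp: H'_def partial_char_def intro!: exI[of _ \<one>] exI[of _ "1::nat"])
    have "partial_char H' \<xi>'"
      unfolding partial_char_def
    proof (intro conjI ballI)
      show "H' \<subseteq> carrier G" using Hc x(1) by (auto simp: H'_def)
      show "\<one> \<in> H'" using sub Hc by blast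
      show "\<xi>' \<one> = 1" using ext Hc H by (auto simp: partial_char_def)
      fix a b assume "a \<in> H'" "b \<in> H'"
      then obtain h i h' i' where ab: "h \<in> H" "h' \<in> H" "a = h \<otimes> x [^] (i::nat)" "b = h' \<otimes> x [^] (i'::nat)"
        by (auto simp: H'_def)
      have hc: "h \<in> carrier G" "h' \<in> carrier G" using ab Hc by auto
      have e: "a \<otimes> b = (h \<otimes> h') \<otimes> x [^] (i + i')"
        unfolding ab using hc x(1) by (simp add: nat_pow_mult[symmetric] m_ac)
      have hh: "h \<otimes> h' \<in> H" "\<xi> (h \<otimes> h') = \<xi> h * \<xi> h'" using ab H by (auto simp: partial_char_def)
      show "a \<otimes> b \<in> H'" unfolding e H'_def using hh by blast
      show "\<xi>' (a \<otimes> b) = \<xi>' a * \<xi>' b"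
        unfolding e \<xi>'[OF hh(1)] unfolding ab \<xi>'[OF ab(1)] \<xi>'[OF ab(2)] hh(2) by (simp add: power_add)
    qed
    moreover have "H \<subset> H'" using sub xH' x(2) by blast
    ultimately show "\<exists>H' \<xi>'. partial_char H' \<xi>' \<and> H \<subset> H' \<and> x \<in> H' \<and> (\<forall>h\<in>H. \<xi>' h = \<xi> h) \<and> \<xi>' x = z"
      using xH' \<xi>x ext by blast
  qed
qed

text \<open>
  Extending the trivial character of the trivial subgroup by $g$, a root of unity other than 1 can
  be chosen as value at $g$. A character on a largest subgroup among those that contain $g$ and
  carry a character with this property is defined everywhere, as it could be extended otherwise.
\<close>

lemma char_separates:
  assumes g: "g \<in> carrier G" "g \<noteq> \<one>"
  obtains \<xi> where "\<xi> \<in> chars G" "\<xi> g \<noteq> 1"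
proof -
  define P where "P = (\<lambda>(H, \<xi>). partial_char H \<xi> \<and> g \<in> H \<and> \<xi> g \<noteq> 1)"
  have "partial_char {\<one>} (\<lambda>_. 1)" by (simp add: partial_char_def)
  then obtain k where k: "k \<ge> 2" "\<And>z. z ^ k = 1 \<Longrightarrow>
      \<exists>H' \<xi>'. partial_char H' \<xi>' \<and> {\<one>} \<subset> H' \<and> g \<in> H' \<and> (\<forall>h\<in>{\<one>}. \<xi>' h = 1) \<and> \<xi>' g = z"
    using partial_char_extend[of "{\<one>}" "\<lambda>_. 1" g] g by (metis singletonD)
  have "\<exists>z::complex. z ^ k = 1 \<and> z \<noteq> 1"
  proof -
    have "card {z::complex. z ^ k = 1} = k" using card_roots_unity_eq[of k] k(1) by simp
    then have "\<not> {z::complex. z ^ k = 1} \<subseteq> {1}"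
      using k(1) card_mono[of "{1::complex}" "{z. z ^ k = 1}"] by auto
    then show ?thesis by auto
  qed
  then have ex: "\<exists>p. P p" using k(2) unfolding P_def by fastforce
  have bound: "card (fst p) < Suc N" if "P p" for p
    using that fin by (auto simp: P_def partial_char_def card_mono less_Suc_eq_le split: prod.splits)
  obtain p where p: "P p" "\<And>p'. P p' \<Longrightarrow> card (fst p') \<le> card (fst p)"
    using ex_has_greatest_nat[of P _ "\<lambda>p. card (fst p)" "Suc N"] ex bound by (metis less_imp_le)
  obtain H \<xi> where pH: "p = (H, \<xi>)" by force
  have H: "partial_char H \<xi>" "g \<in> H" "\<xi> g \<noteq> 1" using p(1) by (auto simp: P_def pH)
  have "H = carrier G"
  proof (rule ccontr)
    assume "H \<noteq> carrier G"
    then obtain x where x: "x \<in> carrier G" "x \<notin> H" using H(1) by (auto simp: partial_char_def)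
    obtain k where k: "k \<ge> 2" "\<And>z. z ^ k = \<xi> (x [^] (k::nat)) \<Longrightarrow>
      \<exists>H' \<xi>'. partial_char H' \<xi>' \<and> H \<subset> H' \<and> x \<in> H' \<and> (\<forall>h\<in>H. \<xi>' h = \<xi> h) \<and> \<xi>' x = z"
      using partial_char_extend[OF H(1) x] by metis
    obtain z where "z ^ k = \<xi> (x [^] k)" using nth_root_exists[of k "\<xi> (x [^] k)"] k(1) by auto
    then obtain H' \<xi>' where H': "partial_char H' \<xi>'" "H \<subset> H'" "\<forall>h\<in>H. \<xi>' h = \<xi> h"
      using k(2) by blast
    then have "P (H', \<xi>')" using H by (auto simp: P_def)
    moreover have "finite H'" using H'(1) fin by (auto simp: partial_char_def intro: finite_subset)
    ultimately show False using p(2) psubset_card_mono[OF _ H'(2)] by (fastforce simp: pH)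
  qed
  define \<xi>0 where "\<xi>0 x = (if x \<in> carrier G then \<xi> x else 0)" for x
  have "\<xi>0 \<in> chars G" using H(1) \<open>H = carrier G\<close> by (auto simp: chars_def \<xi>0_def partial_char_def)
  moreover have "\<xi>0 g \<noteq> 1" using H(3) g(1) by (simp add: \<xi>0_def)
  ultimately show thesis by (rule that)
qed

text \<open>
  Multiplication by a character that is not 1 at $g$ permutes the characters and multiplies the sum
  by that value.
\<close>

lemma sum_chars:
  assumes "g \<in> carrier G"
  shows "(\<Sum>\<xi>\<in>chars G. \<xi> g) = (if g = \<one> then of_nat (card (chars G)) else 0)"
proof (cases "g = \<one>")
  case True
  then show ?thesis by (simp add: charD)
next
  case False
  then obtain \<psi> where \<psi>: "\<psi> \<in> chars G" "\<psi> g \<noteq> 1" using char_separates assms by blast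
  have inj: "inj_on (\<lambda>\<xi> x. \<psi> x * \<xi> x) (chars G)"
  proof (rule inj_onI, rule ext)
    fix \<xi> \<xi>' x assume c: "\<xi> \<in> chars G" "\<xi>' \<in> chars G" and eq: "(\<lambda>x. \<psi> x * \<xi> x) = (\<lambda>x. \<psi> x * \<xi>' x)"
    show "\<xi> x = \<xi>' x"
      using fun_cong[OF eq, of x] char_nz[OF \<psi>(1), of x] charD(3)[OF c(1), of x] charD(3)[OF c(2), of x]
      by (cases "x \<in> carrier G") auto
  qed
  have "(\<lambda>\<xi> x. \<psi> x * \<xi> x) ` chars G = chars G"
    using inj char_mult[OF \<psi>(1)] finite_chars by (intro card_subset_eq) (auto simp: card_image)
  then have "(\<Sum>\<xi>\<in>chars G. \<xi> g) = (\<Sum>\<xi>\<in>(\<lambda>\<xi> x. \<psi> x * \<xi> x) ` chars G. \<xi> g)" by simp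
  also have "\<dots> = \<psi> g * (\<Sum>\<xi>\<in>chars G. \<xi> g)"
    by (subst sum.reindex[OF inj]) (simp add: sum_distrib_left)
  finally show ?thesis using \<psi>(2) False by simp
qed

lemma sum_char:
  assumes "\<xi> \<in> chars G" "\<xi> \<noteq> trivial_char G"
  shows "(\<Sum>x\<in>carrier G. \<xi> x) = 0"
proof -
  obtain g where "\<xi> g \<noteq> trivial_char G g" using assms(2) by auto
  then have g: "g \<in> carrier G" "\<xi> g \<noteq> 1"
    using charD(3)[OF assms(1)] by (auto simp: trivial_char_def split: if_splits)
  have "(\<Sum>x\<in>carrier G. \<xi> x) = (\<Sum>x\<in>carrier G. \<xi> (g \<otimes> x))"
    using g(1) by (intro sum.reindex_bij_witness[of _ "\<lambda>x. g \<otimes> x" "\<lambda>x. inv g \<otimes> x"])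
      (auto simp: m_assoc[symmetric])
  also have "\<dots> = \<xi> g * (\<Sum>x\<in>carrier G. \<xi> x)"
    using g(1) by (simp add: charD[OF assms(1)] sum_distrib_left)
  finally show ?thesis using g(2) by simp
qed

end

section \<open>Counting monic polynomials\<close>

definition monics :: "nat \<Rightarrow> 'a::field poly set" where
  "monics n = {f. degree f = n \<and> lead_coeff f = 1}"

lemma monics_iff: "f \<in> monics n \<longleftrightarrow> coeff f n = 1 \<and> (\<forall>i>n. coeff f i = 0)"
proof
  assume f: "coeff f n = 1 \<and> (\<forall>i>n. coeff f i = 0)"
  then have "degree f = n"
    by (intro antisym degree_le le_degree) auto
  then show "f \<in> monics n" using f by (simp add: monics_def)
qed (auto simp: monics_def coeff_eq_0)

lemma monics_image: "monics n = (\<lambda>p. monom 1 n + p) ` (polys_lt n :: 'a::field poly set)"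
proof (intro equalityI subsetI)
  fix f :: "'a poly" assume "f \<in> monics n"
  then have "f - monom 1 n \<in> polys_lt n"
    by (auto simp: monics_iff polys_lt_def le_less)
  then show "f \<in> (\<lambda>p. monom 1 n + p) ` polys_lt n"
    by (rule rev_image_eqI) simp
qed (auto simp: monics_iff polys_lt_def)

lemma card_monics: "finite (monics n :: 'a::{finite,field} poly set)"
  "card (monics n :: 'a poly set) = CARD('a) ^ n"
  using card_polys_lt[where 'a = 'a, of n] unfolding monics_image by (auto simp: card_image inj_on_def)

lemma monics_mult: "f \<in> monics m \<Longrightarrow> g \<in> monics n \<Longrightarrow> f * g \<in> monics (m + n)"
proof -
  assume "f \<in> monics m" "g \<in> monics n"
  moreover from this have "f \<noteq> 0" "g \<noteq> 0" by (auto simp: monics_def)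
  moreover from calculation have "lead_coeff (f * g) = 1"
    unfolding lead_coeff_mult by (auto simp: monics_def)
  ultimately show ?thesis unfolding monics_def by (simp add: degree_mult_eq)
qed

lemma monics_power: "f \<in> monics m \<Longrightarrow> f ^ k \<in> monics (k * m)"
proof (induction k)
  case 0
  then show ?case by (simp add: monics_iff)
next
  case (Suc k)
  then show ?case using monics_mult[of f m "f ^ k" "k * m"] by simp
qed

lemma monics_cancel:
  assumes "f * g \<in> monics n" "f \<in> monics m"
  shows "m \<le> n \<and> g \<in> monics (n - m)"
proof -
  have nz: "f \<noteq> 0" "g \<noteq> 0" using assms by (auto simp: monics_def)
  then have "n = m + degree g" using assms by (auto simp: monics_def degree_mult_eq)
  moreover have "lead_coeff g = 1" using assms by (auto simp: monics_def lead_coeff_mult)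
  ultimately show ?thesis by (simp add: monics_def)
qed

text \<open>
  The polynomials in question are \<open>a + M' h\<close> with \<open>M'\<close> the monic multiple
  of $M$ and $h$ monic of degree \<open>n - degree M\<close>.
\<close>

lemma card_monics_mod:
  fixes M a :: "'a::{finite,field} poly"
  assumes "degree M > 0" "a mod M = a" "n \<ge> degree M"
  shows "card {f \<in> monics n. f mod M = a} = CARD('a) ^ (n - degree M)"
proof -
  let ?m = "degree M" and ?c = "lead_coeff M"
  define M' where "M' = smult (1 / ?c) M"
  have M0: "M \<noteq> 0" and c0: "?c \<noteq> 0" using assms(1) by auto
  have M': "M' \<in> monics ?m" using c0 by (simp add: M'_def monics_def)
  have a: "a \<in> polys_lt ?m" using assms(2) mod_eq_self_iff[OF M0] by blast
  have dvd: "M' = M * [:1 / ?c:]" by (simp add: M'_def)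
  have "bij_betw (\<lambda>h. a + M' * h) (monics (n - ?m)) {f \<in> monics n. f mod M = a}"
  proof (rule bij_betw_imageI)
    have "M' \<noteq> 0" using c0 M0 by (simp add: M'_def)
    then show "inj_on (\<lambda>h. a + M' * h) (monics (n - ?m))" by (auto simp: inj_on_def)
    show "(\<lambda>h. a + M' * h) ` monics (n - ?m) = {f \<in> monics n. f mod M = a}"
    proof (intro equalityI subsetI)
      fix f assume "f \<in> (\<lambda>h. a + M' * h) ` monics (n - ?m)"
      then obtain h where h: "h \<in> monics (n - ?m)" "f = a + M' * h" by auto
      have "M' * h \<in> monics n" using monics_mult[OF M' h(1)] assms(3) by simp
      then have "f \<in> monics n"
        using a assms(3) unfolding h(2) by (auto simp: monics_iff polys_lt_def)
      moreover have "f mod M = a"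
        unfolding h(2) dvd using assms(2) by (simp only: mult.assoc mod_mult_self2)
      ultimately show "f \<in> {f \<in> monics n. f mod M = a}" by simp
    next
      fix f assume "f \<in> {f \<in> monics n. f mod M = a}"
      then have f: "f \<in> monics n" "f mod M = a" by auto
      define h where "h = smult ?c (f div M)"
      have "f = M * (f div M) + a" using f(2) by (metis mult_div_mod_eq)
      moreover have "M' * h = M * (f div M)" using c0 by (simp add: M'_def h_def)
      ultimately have fh: "f = a + M' * h" by (metis add.commute)
      then have "M' * h = f - a" by simp
      moreover have "f - a \<in> monics n"
        using f(1) a assms(3) by (auto simp: monics_iff polys_lt_def)
      ultimately have "h \<in> monics (n - ?m)" using monics_cancel[of M' h n ?m] M' by auto
      then show "f \<in> (\<lambda>h. a + M' * h) ` monics (n - ?m)" using fh by blast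
    qed
  qed
  from bij_betw_same_card[OF this] show ?thesis by (simp add: card_monics(2))
qed

lemma monic_irreducible_factor:
  fixes f :: "'a::field poly"
  assumes "degree f > 0"
  obtains p where "irreducible p" "lead_coeff p = 1" "p dvd f"
proof -
  have "f dvd f \<and> degree f > 0" using assms by simp
  then obtain p where p: "p dvd f" "degree p > 0"
    and least: "\<And>g. g dvd f \<Longrightarrow> degree g > 0 \<Longrightarrow> degree p \<le> degree g"
    using ex_has_least_nat[of "\<lambda>g. g dvd f \<and> degree g > 0" f degree] by auto
  have p0: "p \<noteq> 0" using p(2) by auto
  have irr: "irreducible p"
  proof (rule Factorial_Ring.irreducibleI)
    show "p \<noteq> 0" by (rule p0)
    show "\<not> is_unit p" using p(2) is_unit_iff_degree[OF p0] by simp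
    fix a b assume ab: "p = a * b"
    then have nz: "a \<noteq> 0" "b \<noteq> 0" using p0 by auto
    then have deg: "degree p = degree a + degree b" using ab by (simp add: degree_mult_eq)
    have "a dvd f" using p(1) ab dvd_mult_left by blast
    then have "degree a = 0 \<or> degree p \<le> degree a" using least by blast
    then have "degree a = 0 \<or> degree b = 0" using deg by linarith
    then show "is_unit a \<or> is_unit b" using nz is_unit_iff_degree by blast
  qed
  define p' where "p' = smult (1 / lead_coeff p) p"
  have u: "is_unit [:1 / lead_coeff p:]" using p0 is_unit_iff_degree[of "[:1 / lead_coeff p:]"] by simp
  have pp: "p' = [:1 / lead_coeff p:] * p" by (simp add: p'_def)
  show thesis
  proof (rule that)
    show "irreducible p'" unfolding pp using irr irreducible_mult_unit_left[OF u, of p] by blast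
    show "lead_coeff p' = 1" using p0 by (simp add: p'_def)
    obtain t where "f = p * t" using p(1) by (auto elim: dvdE)
    then have "f = p' * smult (lead_coeff p) t" using p0 by (simp add: p'_def)
    then show "p' dvd f" by (rule dvdI)
  qed
qed

text \<open>
  Pairs instead of the powers themselves, since the degree of the base is the weight with which a
  prime power is counted.
\<close>

definition prime_powers :: "nat \<Rightarrow> ('a::field poly \<times> nat) set" where
  "prime_powers n = {(p, k). irreducible p \<and> lead_coeff p = 1 \<and> k \<ge> 1 \<and> k * degree p = n}"

definition prime_power_divisors :: "'a::field poly \<Rightarrow> ('a poly \<times> nat) set" where
  "prime_power_divisors f = {(p, k). irreducible p \<and> lead_coeff p = 1 \<and> k \<ge> 1 \<and> p ^ k dvd f}"

lemma prime_powers_0: "prime_powers 0 = {}"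
  using irreducible_degree_pos by (fastforce simp: prime_powers_def)

lemma finite_prime_powers: "finite (prime_powers n :: ('a::{finite,field} poly \<times> nat) set)"
proof (rule finite_subset)
  show "prime_powers n \<subseteq> (\<Union>d\<le>n. monics d :: 'a poly set) \<times> {..n}"
  proof
    fix x :: "'a poly \<times> nat" assume "x \<in> prime_powers n"
    then obtain p k where pk: "irreducible p" "lead_coeff p = 1" "k \<ge> 1" "k * degree p = n" and x: "x = (p, k)"
      by (auto simp: prime_powers_def)
    have "degree p \<ge> 1" using irreducible_degree_pos[OF pk(1)] by simp
    then have "k \<le> n" "degree p \<le> n" using pk(3,4) by (metis mult.right_neutral mult_le_mono2, metis mult_1 mult_le_mono1)
    then show "x \<in> (\<Union>d\<le>n. monics d) \<times> {..n}" using pk(2) by (auto simp: monics_def x)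
  qed
qed (auto simp: card_monics)

lemma monic_irreducible_dvd_eq:
  fixes p r :: "'a::field poly"
  assumes "irreducible p" "lead_coeff p = 1" "irreducible r" "lead_coeff r = 1" "p dvd r"
  shows "p = r"
proof -
  obtain s where s: "r = p * s" using assms(5) by (auto elim: dvdE)
  then have "is_unit s" using Factorial_Ring.irreducibleD[OF assms(3) s] irreducible_not_unit[OF assms(1)] by blast
  then have "degree s = 0" using is_unit_iff_degree[of s] by (cases "s = 0") auto
  moreover have "lead_coeff s = 1" using assms(2,4) unfolding s lead_coeff_mult by simp
  ultimately have "s = 1" by (metis degree_eq_zeroE lead_coeff_pCons(2) one_pCons)
  then show ?thesis using s by simp
qed

text \<open>
  The factorisation of $f$ in additive form: $p$ is counted as often as it divides $f$. It is the
  analogue of \<open>\<Sum>d|n. \<Lambda>(d) = ln n\<close>. In the induction one prime factor $p$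
  is split off, and the only new prime power divisor is the next power of $p$.
\<close>

lemma sum_prime_power_divisors:
  fixes f :: "'a::field poly"
  assumes "lead_coeff f = 1"
  shows "finite (prime_power_divisors f) \<and> (\<Sum>(p, k)\<in>prime_power_divisors f. degree p) = degree f"
  using assms
proof (induction "degree f" arbitrary: f rule: less_induct)
  case less
  show ?case
  proof (cases "degree f = 0")
    case True
    then have "f = 1" using less.prems by (metis degree_eq_zeroE lead_coeff_pCons(2) one_pCons)
    have "\<not> p ^ k dvd 1" if "irreducible p" "k \<ge> 1" for p :: "'a poly" and k
    proof
      assume "p ^ k dvd 1"
      then have "p dvd 1" using that(2) by (metis One_nat_def Suc_le_D dvd_mult_left power_Suc)
      then show False using irreducible_not_unit[OF that(1)] by simp
    qed
    then have "prime_power_divisors f = {}" unfolding prime_power_divisors_def \<open>f = 1\<close> by blast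
    then show ?thesis using True by simp
  next
    case False
    then obtain p where p: "irreducible p" "lead_coeff p = 1" "p dvd f"
      using monic_irreducible_factor[of f] by auto
    obtain g where g: "f = p * g" using p(3) by (auto elim: dvdE)
    have f0: "f \<noteq> 0" "p \<noteq> 0" "g \<noteq> 0" using less.prems g by auto
    have dp: "degree p > 0" by (rule irreducible_degree_pos[OF p(1)])
    have deg: "degree f = degree p + degree g" using g f0 by (simp add: degree_mult_eq)
    have leadg: "lead_coeff g = 1" using less.prems p(2) unfolding g lead_coeff_mult by simp
    have IH: "finite (prime_power_divisors g)" "(\<Sum>(p, k)\<in>prime_power_divisors g. degree p) = degree g"
      using less.hyps[of g] deg dp leadg by auto
    define K where "K = {k. p ^ k dvd g}"
    have Kle: "k \<le> degree g" if "k \<in> K" for k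
    proof -
      have "degree (p ^ k) \<le> degree g" using that f0(3) by (auto simp: K_def intro: dvd_imp_degree_le)
      then have "k * degree p \<le> degree g" by (simp add: degree_power_eq[OF f0(2)])
      then show ?thesis using dp by (metis Suc_leI One_nat_def le_trans mult.right_neutral mult_le_mono2)
    qed
    then have finK: "finite K" by (auto intro: finite_subset[of _ "{..degree g}"])
    define v where "v = Max K"
    have "0 \<in> K" by (simp add: K_def)
    then have vK: "v \<in> K" unfolding v_def using finK by (auto intro: Max_in)
    have Kiff: "p ^ k dvd g \<longleftrightarrow> k \<le> v" for k
    proof
      assume "p ^ k dvd g"
      then show "k \<le> v" unfolding v_def using finK by (intro Max_ge) (auto simp: K_def)
    next
      assume "k \<le> v"
      then have "p ^ k dvd p ^ v" by (rule le_imp_power_dvd)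
      then show "p ^ k dvd g" using vK by (auto simp: K_def intro: dvd_trans)
    qed
    have key: "r ^ k dvd f \<longleftrightarrow> r ^ k dvd g \<or> (r = p \<and> k = v + 1)"
      if r: "irreducible r" "lead_coeff r = 1" "k \<ge> 1" for r k
    proof (cases "r = p")
      case True
      obtain k' where k': "k = Suc k'" using r(3) by (cases k) auto
      have "p ^ k dvd f \<longleftrightarrow> p ^ k' dvd g" unfolding k' g using f0(2) by simp
      then have 1: "r ^ k dvd f \<longleftrightarrow> k' \<le> v" unfolding True Kiff .
      have 2: "r ^ k dvd g \<longleftrightarrow> k \<le> v" unfolding True Kiff ..
      show ?thesis unfolding 1 2 using True k' by auto
    next
      case False
      then have "\<not> r dvd p" using monic_irreducible_dvd_eq[OF r(1,2) p(1,2)] by blast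
      then have "comax p (r ^ k)" using irreducible_comax[OF r(1)] comax_power comax_sym by metis
      then have "r ^ k dvd p * g \<longleftrightarrow> r ^ k dvd g"
        using cong_comax_cancel[of p "r ^ k" g 0] by (auto simp: cong_0_iff)
      then show ?thesis using False g by simp
    qed
    have "prime_power_divisors f = insert (p, v + 1) (prime_power_divisors g)"
      using key p(1,2) unfolding prime_power_divisors_def by auto
    moreover have "(p, v + 1) \<notin> prime_power_divisors g"
      using Kiff[of "v + 1"] by (simp add: prime_power_divisors_def)
    ultimately show ?thesis using IH deg by simp
  qed
qed

text \<open>
  For a multiplicative \<open>ch\<close> these are the coefficients of the $L$-series in the
  variable $q^{-s}$ and, for \<open>Psum\<close>, of its logarithmic derivative.
\<close>

definition Ssum :: "('a::field poly \<Rightarrow> complex) \<Rightarrow> nat \<Rightarrow> complex" where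
  "Ssum ch n = (\<Sum>f\<in>monics n. ch f)"

definition Psum :: "('a::field poly \<Rightarrow> complex) \<Rightarrow> nat \<Rightarrow> complex" where
  "Psum ch n = (\<Sum>(p, k)\<in>prime_powers n. of_nat (degree p) * ch (p ^ k))"

text \<open>
  Replace $n$ on the left by the sum of \<open>sum_prime_power_divisors\<close> and sort the pairs
  of a polynomial $f$ and a prime power divisor $p^k$ by the degree of $p^k$. This is the
  logarithmic derivative of the Euler product, without infinite products.
\<close>

lemma euler_identity:
  fixes ch :: "'a::{finite,field} poly \<Rightarrow> complex"
  assumes mult: "\<And>f g. lead_coeff f = 1 \<Longrightarrow> lead_coeff g = 1 \<Longrightarrow> ch (f * g) = ch f * ch g"
  shows "of_nat n * Ssum ch n = (\<Sum>i=1..n. Psum ch i * Ssum ch (n - i))"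
proof -
  let ?S = "Sigma (monics n) prime_power_divisors :: ('a poly \<times> 'a poly \<times> nat) set"
  let ?T = "Sigma {1..n} (\<lambda>i. prime_powers i \<times> monics (n - i)) :: (nat \<times> ('a poly \<times> nat) \<times> 'a poly) set"
  let ?j = "\<lambda>x :: 'a poly \<times> 'a poly \<times> nat. (snd (snd x) * degree (fst (snd x)), (snd x, fst x div fst (snd x) ^ snd (snd x)))"
  let ?i = "\<lambda>y :: nat \<times> ('a poly \<times> nat) \<times> 'a poly. (fst (fst (snd y)) ^ snd (fst (snd y)) * snd (snd y), fst (snd y))"
  have "of_nat n * Ssum ch n = (\<Sum>f\<in>monics n. \<Sum>(p, k)\<in>prime_power_divisors f. of_nat (degree p) * ch f)"
    unfolding Ssum_def sum_distrib_left
  proof (rule sum.cong[OF refl])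
    fix f :: "'a poly" assume "f \<in> monics n"
    then have "n = (\<Sum>(p, k)\<in>prime_power_divisors f. degree p)"
      using sum_prime_power_divisors[of f] by (auto simp: monics_def)
    then have "(of_nat n :: complex) = (\<Sum>(p, k)\<in>prime_power_divisors f. of_nat (degree p))"
      by (simp add: of_nat_sum case_prod_unfold)
    then show "of_nat n * ch f = (\<Sum>(p, k)\<in>prime_power_divisors f. of_nat (degree p) * ch f)"
      by (simp add: sum_distrib_right case_prod_unfold)
  qed
  also have "\<dots> = (\<Sum>(f, (p, k))\<in>Sigma (monics n) prime_power_divisors. of_nat (degree p) * ch f)"
  proof (subst sum.Sigma)
    show "\<forall>f\<in>monics n. finite (prime_power_divisors f)"
      using sum_prime_power_divisors by (auto simp: monics_def)
  qed (auto simp: card_monics case_prod_unfold)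
  also have "\<dots> = (\<Sum>y\<in>?T. of_nat (degree (fst (fst (snd y)))) * ch (fst (fst (snd y)) ^ snd (fst (snd y))) * ch (snd (snd y)))"
  proof (rule sum.reindex_bij_witness[of _ ?i ?j])
    fix a :: "'a poly \<times> 'a poly \<times> nat" assume "a \<in> ?S"
    then obtain f p k where a: "a = (f, (p, k))" "f \<in> monics n" "irreducible p" "lead_coeff p = 1"
      "k \<ge> 1" "p ^ k dvd f" by (auto simp: prime_power_divisors_def)
    obtain g where g: "f = p ^ k * g" using a(6) by (auto elim: dvdE)
    have pk: "p ^ k \<in> monics (k * degree p)" using a(4) by (intro monics_power) (simp add: monics_def)
    have pk0: "p ^ k \<noteq> 0" using a(4) by auto
    have kn: "k * degree p \<le> n \<and> g \<in> monics (n - k * degree p)"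
      using monics_cancel[of "p ^ k" g n] a(2) pk g by blast
    moreover have "k * degree p \<ge> 1" using irreducible_degree_pos[OF a(3)] a(5) by simp
    ultimately show "?j a \<in> ?T"
      using a pk0 g by (auto simp: prime_powers_def)
    show "?i (?j a) = a" using a pk0 g by simp
    have "ch f = ch (p ^ k) * ch g"
      unfolding g using mult pk kn by (auto simp: monics_def)
    then show "of_nat (degree (fst (fst (snd (?j a))))) * ch (fst (fst (snd (?j a))) ^ snd (fst (snd (?j a)))) * ch (snd (snd (?j a)))
        = (case a of (f, (p, k)) \<Rightarrow> of_nat (degree p) * ch f)"
      using a pk0 g by simp
  next
    fix b :: "nat \<times> ('a poly \<times> nat) \<times> 'a poly" assume "b \<in> ?T"
    then obtain p k g where b: "b = (k * degree p, ((p, k), g))" "irreducible p" "lead_coeff p = 1" "k \<ge> 1"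
      "k * degree p \<le> n" "g \<in> monics (n - k * degree p)" by (auto simp: prime_powers_def)
    have pk: "p ^ k \<in> monics (k * degree p)" using b(3) by (intro monics_power) (simp add: monics_def)
    have pk0: "p ^ k \<noteq> 0" using b(3) by auto
    have "p ^ k * g \<in> monics n" using monics_mult[OF pk b(6)] b(5) by simp
    then show "?i b \<in> ?S" using b by (simp add: prime_power_divisors_def)
    show "?j (?i b) = b" using b pk0 by simp
  qed
  also have "\<dots> = (\<Sum>i=1..n. \<Sum>((p, k), g)\<in>prime_powers i \<times> monics (n - i). of_nat (degree p) * ch (p ^ k) * ch g)"
    by (subst sum.Sigma) (auto simp: card_monics finite_prime_powers case_prod_unfold)
  also have "\<dots> = (\<Sum>i=1..n. Psum ch i * Ssum ch (n - i))"
    unfolding Psum_def Ssum_def by (simp add: sum_product sum.cartesian_product case_prod_unfold)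
  finally show ?thesis .
qed

lemma euler_identity_fps:
  fixes ch :: "'a::{finite,field} poly \<Rightarrow> complex"
  assumes mult: "\<And>f g. lead_coeff f = 1 \<Longrightarrow> lead_coeff g = 1 \<Longrightarrow> ch (f * g) = ch f * ch g"
  shows "fps_X * fps_deriv (Abs_fps (Ssum ch)) = Abs_fps (Psum ch) * Abs_fps (Ssum ch)"
proof (rule fps_ext)
  fix n :: nat
  have "{0..n} = insert 0 {1..n}" by auto
  then have "(\<Sum>i=0..n. Psum ch i * Ssum ch (n - i)) = (\<Sum>i=1..n. Psum ch i * Ssum ch (n - i))"
    by (simp add: Psum_def prime_powers_0)
  moreover have "of_nat n * Ssum ch n = (\<Sum>i=1..n. Psum ch i * Ssum ch (n - i))"
    by (rule euler_identity) (use mult in blast)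
  ultimately show "(fps_X * fps_deriv (Abs_fps (Ssum ch))) $ n = (Abs_fps (Psum ch) * Abs_fps (Ssum ch)) $ n"
    unfolding fps_mult_fps_X_deriv_shift by (simp add: fps_mult_nth)
qed

section \<open>Primes in arithmetic progressions\<close>

lemma log_deriv_prod:
  fixes f g :: "'i \<Rightarrow> 'b::idom fps"
  assumes "finite A" "\<And>i. i \<in> A \<Longrightarrow> fps_X * fps_deriv (f i) = g i * f i"
  shows "fps_X * fps_deriv (\<Prod>i\<in>A. f i) = (\<Sum>i\<in>A. g i) * (\<Prod>i\<in>A. f i)"
  using assms
proof (induction A rule: finite_induct)
  case (insert i A)
  have "fps_X * fps_deriv (\<Prod>i\<in>insert i A. f i) =
      f i * (fps_X * fps_deriv (\<Prod>i\<in>A. f i)) + (fps_X * fps_deriv (f i)) * (\<Prod>i\<in>A. f i)"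
    using insert.hyps by (simp add: algebra_simps)
  also have "fps_X * fps_deriv (\<Prod>i\<in>A. f i) = (\<Sum>i\<in>A. g i) * (\<Prod>i\<in>A. f i)"
    by (rule insert.IH) (use insert.prems in blast)
  also have "fps_X * fps_deriv (f i) = g i * f i"
    by (rule insert.prems) blast
  finally show ?case using insert.hyps by (simp add: algebra_simps)
qed simp

lemma fps_prod_nth_0': "(\<Prod>i\<in>A. f i) $ 0 = (\<Prod>i\<in>A. f i $ 0)" for f :: "'i \<Rightarrow> 'b::idom fps"
  by (induction A rule: infinite_finite_induct) simp_all

text \<open>
  An identity of formal power series may be evaluated inside the disc of convergence. The point is
  that $p$ may vanish at $z$.
\<close>

lemma eval_poly_times_fps:
  fixes p r :: "complex poly" and a :: "nat \<Rightarrow> complex"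
  assumes "summable (\<lambda>n. norm (a n * z ^ n))"
    and eq: "fps_of_poly p * Abs_fps a = fps_of_poly r"
  shows "poly p z * (suminf (\<lambda>n. a n * z ^ n)) = poly r z"
proof -
  have fin: "(\<lambda>n. coeff s n * z ^ n) sums poly s z" "summable (\<lambda>n. norm (coeff s n * z ^ n))" for s :: "complex poly"
  proof -
    have "(\<lambda>n. coeff s n * z ^ n) sums (\<Sum>n\<le>degree s. coeff s n * z ^ n)"
      by (rule sums_finite) (auto simp: coeff_eq_0)
    then show "(\<lambda>n. coeff s n * z ^ n) sums poly s z" by (simp add: poly_altdef)
    show "summable (\<lambda>n. norm (coeff s n * z ^ n))"
      by (rule summable_finite[of "{..degree s}"]) (auto simp: coeff_eq_0)
  qed
  have "(\<lambda>k. \<Sum>i\<le>k. (coeff p i * z ^ i) * (a (k - i) * z ^ (k - i))) sums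
      ((suminf (\<lambda>n. coeff p n * z ^ n)) * (suminf (\<lambda>n. a n * z ^ n)))"
    by (rule Cauchy_product_sums[OF fin(2) assms(1)])
  moreover have "(\<Sum>i\<le>k. (coeff p i * z ^ i) * (a (k - i) * z ^ (k - i))) = coeff r k * z ^ k" for k
  proof -
    have "coeff r k = (fps_of_poly p * Abs_fps a) $ k" unfolding eq by simp
    also have "\<dots> = (\<Sum>i\<le>k. coeff p i * a (k - i))"
      by (simp add: fps_mult_nth atLeast0AtMost)
    finally have "coeff r k * z ^ k = (\<Sum>i\<le>k. coeff p i * a (k - i) * z ^ k)"
      by (simp add: sum_distrib_right)
    also have "\<dots> = (\<Sum>i\<le>k. (coeff p i * z ^ i) * (a (k - i) * z ^ (k - i)))"
      by (rule sum.cong[OF refl]) (simp add: power_add[symmetric] mult_ac)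
    finally show ?thesis by simp
  qed
  ultimately have "(\<lambda>k. coeff r k * z ^ k) sums ((suminf (\<lambda>n. coeff p n * z ^ n)) * (suminf (\<lambda>n. a n * z ^ n)))"
    by simp
  then show ?thesis using fin(1)[of p] fin(1)[of r] sums_unique sums_unique2 by metis
qed

definition roots1 :: "nat \<Rightarrow> complex set" where "roots1 r = {w. w ^ r = 1}"

lemma finite_roots1: "r > 0 \<Longrightarrow> finite (roots1 r)"
  using finite_roots_unity[of r] by (simp add: roots1_def)

lemma sum_roots1:
  assumes "r > 0"
  shows "(\<Sum>w\<in>roots1 r. w ^ n) = (if r dvd n then of_nat (card (roots1 r)) else 0)"
proof (cases "r dvd n")
  case True
  then have "w ^ n = 1" if "w \<in> roots1 r" for w
    using that by (auto simp: roots1_def power_mult elim!: dvdE)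
  then show ?thesis using True by simp
next
  case False
  define w where "w = exp (2 * of_real pi * \<i> * of_nat 1 / of_nat r)"
  have w: "w \<in> roots1 r" using complex_root_unity[of r 1] assms by (simp add: roots1_def w_def)
  have "w ^ n = exp (2 * of_real pi * \<i> * of_nat n / of_nat r)"
    by (simp add: w_def exp_of_nat_mult[symmetric] mult_ac)
  then have wn: "w ^ n \<noteq> 1"
    using complex_root_unity_eq_1[of r n] assms False by simp
  have w0: "w \<noteq> 0" by (simp add: w_def)
  have "(\<Sum>v\<in>roots1 r. v ^ n) = (\<Sum>v\<in>roots1 r. (w * v) ^ n)"
    by (rule sum.reindex_bij_witness[of _ "\<lambda>v. w * v" "\<lambda>v. v / w"])
       (use w w0 in \<open>auto simp: roots1_def power_mult_distrib power_divide\<close>)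
  also have "\<dots> = w ^ n * (\<Sum>v\<in>roots1 r. v ^ n)"
    by (simp add: power_mult_distrib sum_distrib_left)
  finally show ?thesis using wn False by simp
qed

text \<open>
  The modulus $M$ of an arithmetic progression and a modulus $r$ for the degrees. The degree is
  detected by the functions \<open>f \<mapsto> w^(degree f)\<close> for $w^r = 1$ in the same way as
  the residue class by the characters modulo $M$, so everything is indexed by the set $I$ of pairs
  of these.
\<close>

locale progression =
  fixes M :: "'a::{finite,field} poly" and r :: nat
  assumes degM: "degree M > 0" and r: "r > 0"
begin

lemma q_gt_1: "CARD('a) > 1"
  using card_mono[of UNIV "{0, 1 :: 'a}"] by simp

lemma M_nz: "M \<noteq> 0" using degM by auto

sublocale G: finite_comm_group "residue_units M"
proof -
  interpret comm_group "residue_units M" by (rule comm_group_residue_units)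
  show "finite_comm_group (residue_units M)"
    by unfold_locales (rule finite_residue_units[OF M_nz])
qed

abbreviation "chrs \<equiv> chars (residue_units M)"
abbreviation "triv \<equiv> trivial_char (residue_units M)"
abbreviation "I \<equiv> chrs \<times> roots1 r"

lemma finite_I: "finite I"
  using G.finite_chars finite_roots1[OF r] by simp

definition dchar :: "('a poly \<Rightarrow> complex) \<Rightarrow> complex \<Rightarrow> 'a poly \<Rightarrow> complex" where
  "dchar \<xi> w f = \<xi> (f mod M) * w ^ degree f"

lemma chr_mult:
  assumes "\<xi> \<in> chrs"
  shows "\<xi> ((f * g) mod M) = \<xi> (f mod M) * \<xi> (g mod M)"
proof (cases "comax f M \<and> comax g M")
  case True
  then show ?thesis
    using G.charD(2)[OF assms, of "f mod M" "g mod M"] by (simp add: mod_mult_eq)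
next
  case False
  then have "\<xi> ((f * g) mod M) = 0" "\<xi> (f mod M) = 0 \<or> \<xi> (g mod M) = 0"
    using G.charD(3)[OF assms] by (auto simp: comax_mult_iff)
  then show ?thesis by auto
qed

lemma chr_one: "\<xi> \<in> chrs \<Longrightarrow> \<xi> (1 mod M) = 1"
  using G.charD(1) by simp

lemma dchar_mult:
  assumes "\<xi> \<in> chrs" "lead_coeff f = 1" "lead_coeff g = 1"
  shows "dchar \<xi> w (f * g) = dchar \<xi> w f * dchar \<xi> w g"
proof -
  have "f \<noteq> 0" "g \<noteq> 0" using assms by auto
  then show ?thesis
    by (simp add: dchar_def chr_mult[OF assms(1)] degree_mult_eq power_add)
qed

text \<open>
  \<open>L \<xi> w\<close> is the $L$-series in the variable $q^{-s}$, with coefficients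
  \<open>S \<xi> w n\<close>, and \<open>F \<xi> w\<close> is \<open>fps_X\<close> times its
  logarithmic derivative.
\<close>

definition "S \<xi> w n = Ssum (dchar \<xi> w) n"
definition "L \<xi> w = Abs_fps (Ssum (dchar \<xi> w))"
definition "F \<xi> w = Abs_fps (Psum (dchar \<xi> w))"

lemma L_nth [simp]: "L \<xi> w $ n = S \<xi> w n" by (simp add: L_def S_def)

lemma log_deriv_L: "\<xi> \<in> chrs \<Longrightarrow> fps_X * fps_deriv (L \<xi> w) = F \<xi> w * L \<xi> w"
  unfolding L_def F_def by (rule euler_identity_fps) (rule dchar_mult)

lemma S_twist: "S \<xi> w n = w ^ n * S \<xi> 1 n"
  unfolding S_def Ssum_def dchar_def sum_distrib_left
  by (rule sum.cong) (auto simp: monics_def)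

lemma S_0: "\<xi> \<in> chrs \<Longrightarrow> S \<xi> w 0 = 1"
proof -
  assume "\<xi> \<in> chrs"
  have "monics 0 = {1 :: 'a poly}"
    by (auto simp: monics_def) (metis degree_eq_zeroE lead_coeff_pCons(2) one_pCons)
  then show ?thesis using chr_one[OF \<open>\<xi> \<in> chrs\<close>] by (simp add: S_def Ssum_def dchar_def)
qed

text \<open>
  Among the monic polynomials of a degree \<open>n \<ge> degree M\<close> all residue classes occur
  equally often.
\<close>

lemma S_large:
  assumes "\<xi> \<in> chrs" "n \<ge> degree M"
  shows "S \<xi> 1 n = of_nat (CARD('a) ^ (n - degree M)) * (\<Sum>a\<in>carrier (residue_units M). \<xi> a)"
proof -
  let ?R = "polys_lt (degree M) :: 'a poly set"
  have finR: "finite ?R" using card_polys_lt by blast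
  have im: "(\<lambda>f. f mod M) ` monics n \<subseteq> ?R"
  proof
    fix a assume "a \<in> (\<lambda>f. f mod M) ` monics n"
    then have "a mod M = a" by auto
    then show "a \<in> ?R" by (simp only: mod_eq_self_iff[OF M_nz])
  qed
  have "S \<xi> 1 n = (\<Sum>f\<in>monics n. \<xi> (f mod M))" by (simp add: S_def Ssum_def dchar_def)
  also have "\<dots> = (\<Sum>a\<in>?R. \<Sum>f\<in>{f \<in> monics n. f mod M = a}. \<xi> (f mod M))"
    by (rule sum.group[symmetric, OF card_monics(1) finR im])
  also have "\<dots> = (\<Sum>a\<in>?R. of_nat (CARD('a) ^ (n - degree M)) * \<xi> a)"
  proof (rule sum.cong[OF refl])
    fix a assume "a \<in> ?R"
    then have "a mod M = a" using mod_eq_self_iff[OF M_nz] by blast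
    then show "(\<Sum>f\<in>{f \<in> monics n. f mod M = a}. \<xi> (f mod M)) = of_nat (CARD('a) ^ (n - degree M)) * \<xi> a"
      using card_monics_mod[OF degM _ assms(2), of a] by simp
  qed
  also have "\<dots> = of_nat (CARD('a) ^ (n - degree M)) * (\<Sum>a\<in>?R. \<xi> a)" by (simp only: sum_distrib_left)
  also have "(\<Sum>a\<in>?R. \<xi> a) = (\<Sum>a\<in>carrier (residue_units M). \<xi> a)"
  proof (rule sum.mono_neutral_right[OF finR])
    show "carrier (residue_units M) \<subseteq> ?R"
    proof
      fix a assume "a \<in> carrier (residue_units M)"
      then have "a mod M = a" by simp
      then show "a \<in> ?R" by (simp only: mod_eq_self_iff[OF M_nz])
    qed
  qed (use G.charD(3)[OF assms(1)] in blast)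
  finally show ?thesis .
qed

abbreviation "\<phi> \<equiv> card (carrier (residue_units M))"

text \<open>
  \<open>L \<xi> w = P \<xi> w / D \<xi> w\<close>, by \<open>D_times_L\<close>. By
  \<open>S_large\<close>, the coefficients of \<open>L \<xi> w\<close> from degree
  \<open>degree M\<close> on are zero or, for the trivial character, form a geometric progression;
  \<open>head\<close> collects the coefficients before that. So \<open>L \<xi> w\<close> has no pole
  but the zero of $D$.
\<close>

definition head :: "('a poly \<Rightarrow> complex) \<Rightarrow> complex \<Rightarrow> complex poly" where
  "head \<xi> w = (\<Sum>n<degree M. monom (S \<xi> w n) n)"

definition D :: "('a poly \<Rightarrow> complex) \<Rightarrow> complex \<Rightarrow> complex poly" where
  "D \<xi> w = (if \<xi> = triv then [:1, - (of_nat CARD('a) * w):] else 1)"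

definition P :: "('a poly \<Rightarrow> complex) \<Rightarrow> complex \<Rightarrow> complex poly" where
  "P \<xi> w = (if \<xi> = triv then [:1, - (of_nat CARD('a) * w):] * head \<xi> w + monom (w ^ degree M * of_nat \<phi>) (degree M)
     else head \<xi> w)"

lemma coeff_head: "coeff (head \<xi> w) n = (if n < degree M then S \<xi> w n else 0)"
  by (auto simp: head_def coeff_sum sum.delta)

lemma D_times_L:
  assumes \<xi>: "\<xi> \<in> chrs"
  shows "fps_of_poly (D \<xi> w) * L \<xi> w = fps_of_poly (P \<xi> w)"
proof (cases "\<xi> = triv")
  case False
  have "S \<xi> w n = 0" if "n \<ge> degree M" for n
    using S_large[OF \<xi> that] S_twist[of \<xi> w n] G.sum_char[OF \<xi> False] by simp
  then show ?thesis using False by (intro fps_ext) (auto simp: D_def P_def coeff_head)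
next
  case True
  define E where "E = Abs_fps (\<lambda>n. if n < degree M then 0 else w ^ n * of_nat (CARD('a) ^ (n - degree M)) * of_nat \<phi>)"
  have "(\<Sum>a\<in>carrier (residue_units M). \<xi> a) = of_nat \<phi>" by (simp add: True trivial_char_def)
  then have "S \<xi> w n = w ^ n * of_nat (CARD('a) ^ (n - degree M)) * of_nat \<phi>" if "n \<ge> degree M" for n
    using S_large[OF \<xi> that] S_twist[of \<xi> w n] by simp
  then have L: "L \<xi> w = fps_of_poly (head \<xi> w) + E"
    by (intro fps_ext) (auto simp: coeff_head E_def)
  have Dfps: "fps_of_poly (D \<xi> w) = 1 - fps_const (of_nat CARD('a) * w) * fps_X"
    by (rule fps_ext) (auto simp: D_def True coeff_pCons split: nat.splits)
  have "fps_of_poly (D \<xi> w) * E = fps_of_poly (monom (w ^ degree M * of_nat \<phi>) (degree M))"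
  proof (rule fps_ext)
    fix n
    have "(fps_of_poly (D \<xi> w) * E) $ n = E $ n - of_nat CARD('a) * w * (if n = 0 then 0 else E $ (n - 1))"
      unfolding Dfps by (simp add: left_diff_distrib mult.assoc)
    also have "\<dots> = (if n = degree M then w ^ degree M * of_nat \<phi> else 0)"
    proof (cases "n > degree M")
      case True
      then obtain m where m: "n = Suc m" "m \<ge> degree M" by (cases n) auto
      then show ?thesis by (simp add: E_def Suc_diff_le)
    next
      case False
      then show ?thesis using degM by (auto simp: E_def)
    qed
    finally show "(fps_of_poly (D \<xi> w) * E) $ n = fps_of_poly (monom (w ^ degree M * of_nat \<phi>) (degree M)) $ n"
      by (auto simp: coeff_monom)
  qed
  then show ?thesis
    unfolding L P_def D_def using True by (simp only: simp_thms if_True distrib_left fps_of_poly_add fps_of_poly_mult)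
qed

text \<open>
  All twists of a character have the same $L$-series up to a rotation of the variable.
\<close>

lemma poly_P_twist: "poly (P \<xi> w) z = poly (P \<xi> 1) (w * z)"
proof -
  have "poly (head \<xi> w) z = poly (head \<xi> 1) (w * z)"
    unfolding head_def poly_sum poly_monom
    by (rule sum.cong[OF refl]) (simp add: S_twist[of \<xi> w] power_mult_distrib)
  then show ?thesis
    by (cases "\<xi> = triv") (simp_all add: P_def poly_monom power_mult_distrib mult_ac)
qed

lemma sum_I: "(\<Sum>(\<xi>, w)\<in>I. \<xi> (f mod M) * w ^ n) =
    (if [f = 1] (mod M) \<and> r dvd n then of_nat (card chrs * card (roots1 r)) else 0)"
proof -
  have "(\<Sum>(\<xi>, w)\<in>I. \<xi> (f mod M) * w ^ n) = (\<Sum>\<xi>\<in>chrs. \<xi> (f mod M)) * (\<Sum>w\<in>roots1 r. w ^ n)"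
    by (simp add: sum_product sum.cartesian_product)
  moreover have "(\<Sum>\<xi>\<in>chrs. \<xi> (f mod M)) = (if [f = 1] (mod M) then of_nat (card chrs) else 0)"
  proof (cases "comax f M")
    case True
    then show ?thesis using G.sum_chars[of "f mod M"] by (simp add: cong_def)
  next
    case False
    then have "\<not> [f = 1] (mod M)" using comax_cong[of f 1 M] by auto
    moreover have "\<xi> (f mod M) = 0" if "\<xi> \<in> chrs" for \<xi>
      using G.charD(3)[OF that, of "f mod M"] False by simp
    ultimately show ?thesis by (auto intro!: sum.neutral)
  qed
  ultimately show ?thesis by (simp add: sum_roots1[OF r])
qed

text \<open>
  \<open>LL\<close> plays the role of the Dedekind zeta function of an abelian extension, the
  product of its $L$-series. By orthogonality only prime powers that are 1 modulo $M$ and have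
  degree divisible by $r$ contribute to \<open>FF\<close>, each of them positively.
\<close>

definition "FF = (\<Sum>(\<xi>, w)\<in>I. F \<xi> w)"
definition "LL = (\<Prod>(\<xi>, w)\<in>I. L \<xi> w)"

lemma degree_prime_power: "(p, k) \<in> prime_powers n \<Longrightarrow> degree (p ^ k) = n"
  by (cases "p = 0") (auto simp: prime_powers_def degree_power_eq)

lemma FF_nth: "FF $ n = of_nat (\<Sum>(p, k)\<in>prime_powers n. degree p *
    (if [p ^ k = 1] (mod M) \<and> r dvd n then card chrs * card (roots1 r) else 0))"
proof -
  have "FF $ n = (\<Sum>(\<xi>, w)\<in>I. \<Sum>(p, k)\<in>prime_powers n. of_nat (degree p) * (\<xi> (p ^ k mod M) * w ^ n))"
    unfolding FF_def fps_sum_nth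
    by (intro sum.cong refl)
       (auto simp: F_def Psum_def dchar_def degree_prime_power case_prod_unfold intro!: sum.cong)
  also have "\<dots> = (\<Sum>(p, k)\<in>prime_powers n. of_nat (degree p) * (\<Sum>(\<xi>, w)\<in>I. \<xi> (p ^ k mod M) * w ^ n))"
    unfolding case_prod_unfold sum_distrib_left by (rule sum.swap)
  finally show ?thesis
    unfolding sum_I by (simp add: case_prod_unfold if_distrib cong: if_cong)
qed

lemma LL_deriv: "fps_X * fps_deriv LL = FF * LL"
  unfolding LL_def FF_def
  using log_deriv_prod[OF finite_I, of "\<lambda>(\<xi>, w). L \<xi> w" "\<lambda>(\<xi>, w). F \<xi> w"] log_deriv_L by auto

lemma LL_0: "LL $ 0 = 1"
  unfolding LL_def fps_prod_nth_0' by (auto simp: S_0 intro!: prod.neutral)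

lemma LL_rec: "of_nat n * LL $ n = (\<Sum>i=0..n. FF $ i * LL $ (n - i))"
proof -
  have "(fps_X * fps_deriv LL) $ n = (FF * LL) $ n" by (simp only: LL_deriv)
  then show ?thesis unfolding fps_mult_fps_X_deriv_shift by (simp add: fps_mult_nth)
qed

text \<open>
  The recursion \<open>LL_rec\<close> expresses the coefficients through the nonnegative
  coefficients of \<open>FF\<close>.
\<close>

lemma LL_nonneg: "LL $ n \<in> \<real>\<^sub>\<ge>\<^sub>0"
proof (induction n rule: less_induct)
  case (less n)
  show ?case
  proof (cases "n = 0")
    case False
    have FF0: "FF $ 0 = 0" by (simp add: FF_nth prime_powers_0)
    have "(\<Sum>i\<in>A. FF $ i * LL $ (n - i)) \<in> \<real>\<^sub>\<ge>\<^sub>0" if "finite A" for A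
      using that
    proof (induction A rule: finite_induct)
      case (insert i A)
      have "FF $ i * LL $ (n - i) \<in> \<real>\<^sub>\<ge>\<^sub>0"
      proof (cases "i = 0")
        case False
        then show ?thesis using less \<open>n \<noteq> 0\<close>
          by (intro nonneg_Reals_mult_I) (simp only: FF_nth nonneg_Reals_of_nat_I, simp)
      qed (simp add: FF0)
      then show ?case using insert by (simp add: nonneg_Reals_add_I)
    qed simp
    then have "of_nat n * LL $ n \<in> \<real>\<^sub>\<ge>\<^sub>0" unfolding LL_rec by simp
    moreover have "inverse (of_nat n :: complex) \<in> \<real>\<^sub>\<ge>\<^sub>0"
      by (intro nonneg_Reals_inverse_I nonneg_Reals_of_nat_I)
    ultimately have "inverse (of_nat n) * (of_nat n * LL $ n) \<in> \<real>\<^sub>\<ge>\<^sub>0"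
      by (rule nonneg_Reals_mult_I[rotated])
    moreover have "inverse (of_nat n) * (of_nat n * LL $ n) = LL $ n" using False by simp
    ultimately show ?thesis by (simp only:)
  qed (simp add: LL_0)
qed

text \<open>
  A prime factor $p$ of $x M + 1$ is prime to $M$, so $p^k \equiv 1$ for the multiples $k$ of the
  order of the unit group. Those divisible by $r$ make infinitely many coefficients of
  \<open>FF\<close> positive, and with them those of \<open>LL\<close>.
\<close>

lemma LL_not_poly: "LL \<noteq> fps_of_poly R"
proof
  assume LLR: "LL = fps_of_poly R"
  have "degree ([:0, 1:] * M + 1) > 0"
    using M_nz by (simp add: degree_add_eq_left degree_mult_eq)
  then obtain p where p: "irreducible p" "lead_coeff p = 1" "p dvd [:0, 1:] * M + 1"
    using monic_irreducible_factor by blast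
  obtain t where t: "[:0, 1:] * M + 1 = p * t" using p(3) by (auto elim: dvdE)
  then have "t * p = [:0, 1:] * M + 1" by (simp only: mult.commute)
  moreover have "t * p + (- [:0, 1:]) * M = t * p - [:0, 1:] * M"
    by (simp only: mult_minus_left add_uminus_conv_diff)
  ultimately have "t * p + (- [:0, 1:]) * M = 1" by (simp only: add_diff_cancel_left')
  then have cop: "comax p M" unfolding comax_def by blast
  define k where "k = \<phi> * r * Suc (degree R)"
  define n where "n = k * degree p"
  have dp: "degree p \<ge> 1" using irreducible_degree_pos[OF p(1)] by simp
  have "1 * Suc (degree R) \<le> (\<phi> * r) * Suc (degree R)"
    using G.N_pos r by (intro mult_le_mono1) simp
  then have k: "k > degree R" by (simp add: k_def)
  then have n: "n > degree R" unfolding n_def using dp by (metis le_trans mult.right_neutral mult_le_mono2 not_le)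
  have "(p mod M) [^]\<^bsub>residue_units M\<^esub> \<phi> = \<one>\<^bsub>residue_units M\<^esub>"
    using G.pow_N[of "p mod M"] cop by simp
  then have "[p ^ \<phi> = 1] (mod M)" unfolding residue_units_pow by (simp add: cong_def)
  from cong_pow[OF this, of "r * Suc (degree R)"] have pk: "[p ^ k = 1] (mod M)"
    by (simp only: k_def power_mult mult.assoc power_one)
  have "(p, k) \<in> prime_powers n" using p k by (auto simp: prime_powers_def n_def)
  moreover have "r dvd n" by (simp add: n_def k_def)
  moreover have "card chrs > 0" using G.finite_chars G.trivial_char_in by (auto simp: card_gt_0_iff)
  moreover have "1 \<in> roots1 r" by (simp add: roots1_def)
  then have "card (roots1 r) > 0" using finite_roots1[OF r] by (auto simp: card_gt_0_iff)
  ultimately have "(\<Sum>(p, k)\<in>prime_powers n. degree p *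
    (if [p ^ k = 1] (mod M) \<and> r dvd n then card chrs * card (roots1 r) else 0)) > 0"
    using pk dp finite_prime_powers[where 'a = 'a, of n]
    by (intro sum_pos2[of _ "(p, k)"]) auto
  then have FFn: "Re (FF $ n) > 0" by (simp only: FF_nth complex_Re_of_nat of_nat_0_less_iff)
  have "of_nat n * LL $ n = FF $ n * LL $ 0 + (\<Sum>i<n. FF $ i * LL $ (n - i))"
    unfolding LL_rec by (simp add: atLeast0AtMost lessThan_Suc_atMost[symmetric])
  moreover have "Re (\<Sum>i<n. FF $ i * LL $ (n - i)) \<ge> 0"
  proof -
    have "Re (FF $ i * LL $ (n - i)) \<ge> 0" for i
    proof -
      have "FF $ i * LL $ (n - i) \<in> \<real>\<^sub>\<ge>\<^sub>0"
        by (intro nonneg_Reals_mult_I LL_nonneg) (simp only: FF_nth nonneg_Reals_of_nat_I)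
      then show ?thesis by (simp only: complex_nonneg_Reals_iff)
    qed
    then show ?thesis by (simp add: sum_nonneg)
  qed
  ultimately have "Re (of_nat n * LL $ n) > 0" using FFn LL_0 by simp
  moreover have "LL $ n = 0" unfolding LLR using n by (simp add: coeff_eq_0)
  ultimately show False by simp
qed

text \<open>
  The poles of \<open>LL\<close> come from the twists of the trivial character and are simple; they
  are the points $v/q$ with $v^r = 1$. If one \<open>P \<xi> w\<close> vanished at $1/q$, then by
  twisting the product of all $P$ would vanish at each of these points. All poles would cancel and
  \<open>LL\<close> would be a polynomial.
\<close>

lemma P_nz:
  assumes "\<xi> \<in> chrs" "w \<in> roots1 r"
  shows "poly (P \<xi> w) (1 / of_nat CARD('a)) \<noteq> 0"
proof
  assume zero: "poly (P \<xi> w) (1 / of_nat CARD('a)) = 0"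
  let ?q = "of_nat CARD('a) :: complex"
  let ?lin = "\<Prod>y\<in>(\<lambda>v. v * (1 / ?q)) ` roots1 r. [:- y, 1:]"
  let ?const = "\<Prod>w\<in>roots1 r. - (?q * w)"
  define Q where "Q = (\<Prod>(\<xi>, w)\<in>I. D \<xi> w)"
  define W where "W = (\<Prod>(\<xi>, w)\<in>I. P \<xi> w)"
  have w0: "v \<noteq> 0" if "v \<in> roots1 r" for v using that r by (auto simp: roots1_def power_0_left)
  have QLW: "fps_of_poly Q * LL = fps_of_poly W"
    unfolding Q_def W_def LL_def fps_of_poly_prod prod.distrib[symmetric]
    by (intro prod.cong refl) (use D_times_L in auto)
  have rootW: "poly W (v * (1 / ?q)) = 0" if "v \<in> roots1 r" for v
  proof -
    have "w / v \<in> roots1 r" using that assms(2) by (simp add: roots1_def power_divide)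
    moreover have "poly (P \<xi> (w / v)) (v * (1 / ?q)) = 0"
      using zero w0[OF that] unfolding poly_P_twist[of \<xi> "w / v"] poly_P_twist[of \<xi> w] by simp
    ultimately show ?thesis
      unfolding W_def poly_prod using assms(1) finite_I by (intro prod_zero) auto
  qed
  have "Q = (\<Prod>w\<in>roots1 r. [:1, - (?q * w):])"
  proof -
    have "Q = (\<Prod>i\<in>(\<lambda>w. (triv, w)) ` roots1 r. case i of (\<xi>, w) \<Rightarrow> D \<xi> w)"
      unfolding Q_def using finite_I G.trivial_char_in
      by (intro prod.mono_neutral_right) (auto simp: D_def)
    also have "\<dots> = (\<Prod>w\<in>roots1 r. [:1, - (?q * w):])"
      by (subst prod.reindex) (auto simp: inj_on_def D_def)
    finally show ?thesis .
  qed
  also have "\<dots> = (\<Prod>w\<in>roots1 r. smult (- (?q * w)) [:- (inverse w * (1 / ?q)), 1:])"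
    using w0 q_gt_1 by (intro prod.cong) auto
  also have "\<dots> = smult ?const (\<Prod>w\<in>roots1 r. [:- (inverse w * (1 / ?q)), 1:])"
    by (rule prod_smult)
  also have "(\<Prod>w\<in>roots1 r. [:- (inverse w * (1 / ?q)), 1:]) = ?lin"
  proof -
    have "(\<Prod>w\<in>roots1 r. [:- (inverse w * (1 / ?q)), 1:]) = (\<Prod>v\<in>roots1 r. [:- (v * (1 / ?q)), 1:])"
      by (rule prod.reindex_bij_witness[of _ inverse inverse]) (auto simp: roots1_def power_inverse)
    also have "\<dots> = ?lin"
      using q_gt_1 by (subst prod.reindex) (auto simp: inj_on_def)
    finally show ?thesis .
  qed
  finally have Q: "Q = smult ?const ?lin" .
  have c: "?const \<noteq> (0 :: complex)"
    using w0 q_gt_1 finite_roots1[OF r] by auto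
  have "?lin dvd W"
    using rootW finite_roots1[OF r] by (intro prod_linear_dvd) auto
  then have "Q dvd W" unfolding Q using c by (simp add: smult_dvd_iff)
  then obtain R where R: "W = Q * R" by (auto elim: dvdE)
  have Q0: "Q \<noteq> 0" unfolding Q using c finite_roots1[OF r] by (auto simp: prod_zero_iff)
  have "fps_of_poly Q * LL = fps_of_poly Q * fps_of_poly R" unfolding QLW R fps_of_poly_mult ..
  then have "LL = fps_of_poly R" using Q0 fps_of_poly_eq_iff[of Q 0] by simp
  then show False using LL_not_poly by blast
qed

text \<open>
  A proper power of degree $n$ has a base of degree at most $n/2$.
\<close>

lemma prime_powers_ge2_bound:
  "card {(p :: 'a poly, k) \<in> prime_powers n. k \<ge> 2} \<le> CARD('a) ^ Suc (n div 2)"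
proof -
  let ?A = "{(p :: 'a poly, k) \<in> prime_powers n. k \<ge> 2}"
  have inj: "inj_on fst ?A"
    by (rule inj_onI) (auto simp: prime_powers_def dest: irreducible_degree_pos)
  have "fst ` ?A \<subseteq> polys_lt (Suc (n div 2))"
  proof
    fix p assume "p \<in> fst ` ?A"
    then obtain k where "k \<ge> 2" "k * degree p = n" by (auto simp: prime_powers_def)
    then have "2 * degree p \<le> n" by (metis mult_le_mono1)
    then show "p \<in> polys_lt (Suc (n div 2))" by (auto simp: polys_lt_iff)
  qed
  then have "card (fst ` ?A) \<le> card (polys_lt (Suc (n div 2)) :: 'a poly set)"
    using card_polys_lt by (intro card_mono) blast+
  then show ?thesis using card_polys_lt[where 'a = 'a, of "Suc (n div 2)"] by (simp add: card_image[OF inj])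
qed

text \<open>
  Dirichlet's theorem for polynomials over a finite field, with an additional condition on the
  degree. Let $A$ be the sum of all \<open>F \<xi> w\<close>, weighted with the value of $\xi$ at
  the inverse of $g$ and with $1/w$. By orthogonality its coefficients count the prime powers that
  satisfy the two congruences. If all primes among them had degree at most $B$, then only proper
  powers would contribute beyond degree $B$, and these are rare enough for $A$ to converge at $1/q$.
  But all terms of $A$ are regular at $1/q$ by \<open>P_nz\<close>, except the one of the trivial
  character without twist, which has a simple pole. To avoid meromorphic functions, $A$ is
  multiplied by all $D$ and $P$. At $1/q$ their product vanishes, due to the pole, but the resulting
  polynomial $R$ does not.
\<close>

theorem dirichlet:
  assumes g: "comax g M"
  obtains p where "irreducible p" "lead_coeff p = 1" "[p = g] (mod M)" "[degree p = 1] (mod r)" "degree p > B"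
proof (rule ccontr)
  assume contra: "\<not> thesis"
  note obt = that
  have none: "degree p \<le> B"
    if "irreducible p" "lead_coeff p = 1" "[p = g] (mod M)" "[degree p = 1] (mod r)" for p
    using obt[OF that] contra by (meson not_le)
  let ?z = "1 / of_nat CARD('a) :: complex"
  let ?sel = "\<lambda>p k n. [p ^ k = g] (mod M) \<and> [n = 1] (mod r)"
  obtain g' where g': "[g * g' = 1] (mod M)" "comax g' M" using comax_inverse[OF g] .
  define c where "c = (\<lambda>(\<xi>, w). \<xi> (g' mod M) * inverse w :: complex)"
  define A where "A = (\<Sum>i\<in>I. fps_const (c i) * case_prod F i)"
  define a where "a n = A $ n" for n
  define C where "C = card chrs * card (roots1 r)"
  have a_eq: "a n = of_nat (\<Sum>(p, k)\<in>prime_powers n. degree p *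
      (if ?sel p k n then C else 0))" if n: "n \<ge> 1" for n
  proof -
    have iw: "inverse w * w ^ n = w ^ (n - 1)" if "w \<in> roots1 r" for w
      using that r n by (cases n) (auto simp: roots1_def power_0_left field_simps)
    have "a n = (\<Sum>(\<xi>, w)\<in>I. \<Sum>(p, k)\<in>prime_powers n. of_nat (degree p) * (\<xi> ((g' * p ^ k) mod M) * w ^ (n - 1)))"
      unfolding a_def A_def fps_sum_nth
    proof (rule sum.cong[OF refl], clarify)
      fix \<xi> w assume \<xi>: "\<xi> \<in> chrs" and w: "w \<in> roots1 r"
      have "(fps_const (c (\<xi>, w)) * F \<xi> w) $ n =
          (\<Sum>(p, k)\<in>prime_powers n. of_nat (degree p) * (\<xi> (g' mod M) * \<xi> (p ^ k mod M) * (inverse w * w ^ n)))"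
        by (auto simp: c_def F_def Psum_def dchar_def degree_prime_power case_prod_unfold sum_distrib_left
            intro!: sum.cong)
      then show "(fps_const (c (\<xi>, w)) * F \<xi> w) $ n =
          (\<Sum>(p, k)\<in>prime_powers n. of_nat (degree p) * (\<xi> ((g' * p ^ k) mod M) * w ^ (n - 1)))"
        unfolding iw[OF w] chr_mult[OF \<xi>] by (simp add: mult.assoc)
    qed
    also have "\<dots> = (\<Sum>(p, k)\<in>prime_powers n. of_nat (degree p) * (\<Sum>(\<xi>, w)\<in>I. \<xi> ((g' * p ^ k) mod M) * w ^ (n - 1)))"
      unfolding case_prod_unfold sum_distrib_left by (rule sum.swap)
    also have "\<dots> = (\<Sum>(p, k)\<in>prime_powers n. of_nat (degree p) *
      (if ?sel p k n then of_nat C else 0))"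
    proof -
      have "[g' * x = 1] (mod M) \<longleftrightarrow> [x = g] (mod M)" for x
      proof
        assume "[g' * x = 1] (mod M)"
        then have "[g' * x = g' * g] (mod M)" using g'(1) by (metis cong_sym cong_trans mult.commute)
        then show "[x = g] (mod M)" by (rule cong_comax_cancel[OF g'(2)])
      next
        assume "[x = g] (mod M)"
        then have "[g' * x = g' * g] (mod M)" by (rule cong_scalar_left)
        then show "[g' * x = 1] (mod M)" using g'(1) by (metis cong_trans mult.commute)
      qed
      moreover have "r dvd n - 1 \<longleftrightarrow> [n = 1] (mod r)"
        using n by (metis cong_altdef_nat cong_sym)
      ultimately show ?thesis unfolding sum_I C_def by simp
    qed
    finally show ?thesis by (simp add: case_prod_unfold if_distrib cong: if_cong)
  qed
  \<comment> \<open>About \<open>sqrt q ^ n\<close> proper powers, each weighted with a multiple of \<open>n\<close>, against \<open>q ^ n\<close>.\<close>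
  have bound: "norm (a n * ?z ^ n) \<le> (of_nat C * of_nat CARD('a)) * (of_nat (Suc n) * (1 / sqrt (of_nat CARD('a))) ^ n)"
    if n: "n > B" for n
  proof -
    let ?q = "real CARD('a)"
    have q: "?q > 1" using q_gt_1 by simp
    have "(\<Sum>(p, k)\<in>prime_powers n. degree p * (if ?sel p k n then C else 0))
        \<le> (\<Sum>(p :: 'a poly, k)\<in>prime_powers n. if k \<ge> 2 then n * C else 0)"
    proof (intro sum_mono, clarify)
      fix p :: "'a poly" and k assume pk: "(p, k) \<in> prime_powers n"
      then have p: "irreducible p" "lead_coeff p = 1" "k \<ge> 1" "k * degree p = n" by (auto simp: prime_powers_def)
      show "degree p * (if ?sel p k n then C else 0) \<le> (if k \<ge> 2 then n * C else 0)"
      proof (cases "k \<ge> 2")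
        case True
        have "degree p \<le> n" using p(3,4) by (metis mult_1 mult_le_mono1)
        then show ?thesis using True by simp
      next
        case False
        then have "k = 1" using p(3) by simp
        then have "\<not> (?sel p k n)" using none[of p] p n by auto
        then show ?thesis by auto
      qed
    qed
    also have "\<dots> = card {(p :: 'a poly, k) \<in> prime_powers n. k \<ge> 2} * (n * C)"
    proof -
      have "{x \<in> prime_powers n. snd x \<ge> 2} = {(p :: 'a poly, k) \<in> prime_powers n. k \<ge> 2}" by auto
      then show ?thesis
        using finite_prime_powers[where 'a = 'a, of n]
        by (simp add: case_prod_unfold sum.If_cases Int_def)
    qed
    also have "\<dots> \<le> CARD('a) ^ Suc (n div 2) * (n * C)"
      by (rule mult_le_mono1[OF prime_powers_ge2_bound])
    finally have "norm (a n) \<le> real (CARD('a) ^ Suc (n div 2) * (n * C))"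
      using a_eq[of n] n by (simp only: norm_of_nat of_nat_le_iff)
    also have "\<dots> \<le> ?q * sqrt ?q ^ n * (real (Suc n) * C)"
    proof -
      have "?q ^ (n div 2) = sqrt ?q ^ (2 * (n div 2))" using q by (simp add: power_mult)
      also have "\<dots> \<le> sqrt ?q ^ n" using q by (intro power_increasing) auto
      finally have "?q ^ (n div 2) \<le> sqrt ?q ^ n" .
      then have "(?q * ?q ^ (n div 2)) * (real n * C) \<le> (?q * sqrt ?q ^ n) * (real (Suc n) * C)"
        using q by (intro mult_mono) auto
      then show ?thesis by simp
    qed
    finally have "norm (a n) * (1 / ?q) ^ n \<le> ?q * sqrt ?q ^ n * (real (Suc n) * C) * (1 / ?q) ^ n"
      using q by (intro mult_right_mono) auto
    also have "\<dots> = (C * ?q) * (real (Suc n) * (sqrt ?q * (1 / ?q)) ^ n)"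
      unfolding power_mult_distrib by (simp only: mult_ac)
    also have "sqrt ?q * (1 / ?q) = 1 / sqrt ?q"
      using q by (simp add: field_simps)
    finally show ?thesis by (simp add: norm_mult norm_power norm_divide)
  qed
  have "summable (\<lambda>n. norm (a n * ?z ^ n))"
  proof (rule summable_comparison_test_ev)
    show "eventually (\<lambda>n. norm (norm (a n * ?z ^ n)) \<le>
      (of_nat C * of_nat CARD('a)) * (of_nat (Suc n) * (1 / sqrt (of_nat CARD('a))) ^ n)) sequentially"
      using eventually_gt_at_top[of B] by eventually_elim (use bound in simp)
    have "norm (1 / sqrt (real CARD('a))) < 1" using q_gt_1 by simp
    from sums_summable[OF geometric_deriv_sums[OF this]]
    show "summable (\<lambda>n. (of_nat C * of_nat CARD('a)) * (of_nat (Suc n) * (1 / sqrt (real CARD('a))) ^ n))"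
      by (rule summable_mult)
  qed
  note summ = this
  define D' where "D' = (\<lambda>(\<xi>, w). D \<xi> w)"
  define P' where "P' = (\<lambda>(\<xi>, w). P \<xi> w)"
  define F' where "F' = (\<lambda>(\<xi>, w). F \<xi> w)"
  let ?DPs = "(\<Prod>i\<in>I. D' i) * (\<Prod>i\<in>I. P' i)"
  let ?DP = "\<lambda>i. (\<Prod>j\<in>I - {i}. D' j) * (\<Prod>j\<in>I - {i}. P' j)"
  \<comment> \<open>\<open>fps_X\<close> times the logarithmic derivative of \<open>P' i / D' i\<close>, multiplied by \<open>D' i * P' i\<close>.\<close>
  define T where "T i = [:0, 1:] * (pderiv (P' i) * D' i - pderiv (D' i) * P' i)" for i
  define R where "R = (\<Sum>i\<in>I. smult (c i) (?DP i * T i))"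
  have T: "fps_of_poly (D' i * P' i) * F' i = fps_of_poly (T i)" if iI: "i \<in> I" for i
  proof -
    obtain \<xi> w where i: "i = (\<xi>, w)" "\<xi> \<in> chrs" using iI by (cases i) auto
    define d p l f where "d = fps_of_poly (D \<xi> w)" and "p = fps_of_poly (P \<xi> w)" and "l = L \<xi> w" and "f = F \<xi> w"
    have dl: "d * l = p" unfolding d_def l_def p_def by (rule D_times_L[OF i(2)])
    have ld: "fps_X * fps_deriv l = f * l" unfolding l_def f_def by (rule log_deriv_L[OF i(2)])
    have "fps_X * fps_deriv (d * l) * d = fps_X * fps_deriv d * (d * l) + d * d * (fps_X * fps_deriv l)"
      by (simp add: algebra_simps)
    then have "fps_X * fps_deriv p * d = fps_X * fps_deriv d * p + d * d * (f * l)"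
      by (simp only: ld dl)
    moreover have "d * d * (f * l) = d * p * f" unfolding dl[symmetric] by (simp only: mult_ac)
    ultimately have "fps_X * fps_deriv p * d = fps_X * fps_deriv d * p + d * p * f" by (simp only:)
    then have "d * p * f = fps_X * fps_deriv p * d - fps_X * fps_deriv d * p" by (simp only: add_diff_cancel_left')
    then have "d * p * f = fps_X * (fps_deriv p * d - fps_deriv d * p)"
      by (simp only: right_diff_distrib mult.assoc)
    then show ?thesis
      by (simp add: i T_def D'_def P'_def F'_def d_def p_def f_def fps_of_poly_mult fps_of_poly_diff
          fps_of_poly_pderiv fps_of_poly_pCons)
  qed
  have "fps_of_poly (?DPs) * A = fps_of_poly R"
    unfolding A_def R_def sum_distrib_left fps_of_poly_sum
  proof (rule sum.cong[OF refl])
    fix i assume i: "i \<in> I"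
    have "?DPs = (?DP i) * (D' i * P' i)"
      by (simp only: prod.remove[OF finite_I i] mult_ac)
    then have "fps_of_poly (?DPs) * (fps_const (c i) * F' i) =
      fps_const (c i) * (fps_of_poly (?DP i) * (fps_of_poly (D' i * P' i) * F' i))"
      by (simp only: fps_of_poly_mult mult_ac)
    also have "\<dots> = fps_of_poly (smult (c i) (?DP i * T i))"
      unfolding T[OF i] by (simp only: fps_of_poly_mult fps_of_poly_smult)
    finally show "fps_of_poly (?DPs) * (fps_const (c i) * case_prod F i) =
      fps_of_poly (smult (c i) (?DP i * T i))"
      by (simp only: F'_def)
  qed
  moreover have "A = Abs_fps a" by (simp add: a_def fps_eq_iff)
  ultimately have eval: "poly (?DPs) ?z * (suminf (\<lambda>n. a n * ?z ^ n)) = poly R ?z"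
    by (intro eval_poly_times_fps[OF summ]) (simp only:)
  define i0 where "i0 = (triv, 1 :: complex)"
  have i0: "i0 \<in> I" using G.trivial_char_in by (simp add: i0_def roots1_def)
  have D0: "poly (D' i0) ?z = 0" by (simp add: D'_def i0_def D_def)
  have Dnz: "poly (D' i) ?z \<noteq> 0" if "i \<in> I" "i \<noteq> i0" for i
    using that by (auto simp: D'_def i0_def D_def split: if_splits)
  have Pnz: "poly (P' i) ?z \<noteq> 0" if "i \<in> I" for i
    using that P_nz by (auto simp: P'_def)
  have zero: "poly ((\<Prod>i\<in>I. D' i) * (\<Prod>i\<in>I. P' i)) ?z = 0"
    using D0 i0 finite_I by (auto simp: poly_prod)
  have "poly R ?z = 0" unfolding eval[symmetric] zero mult_zero_left ..
  moreover have "poly R ?z = c i0 * (poly (\<Prod>j\<in>I - {i0}. D' j) ?z * poly (\<Prod>j\<in>I - {i0}. P' j) ?z * poly (T i0) ?z)"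
  proof -
    have "poly (\<Prod>j\<in>I - {i}. D' j) ?z = 0" if "i \<in> I" "i \<noteq> i0" for i
      unfolding poly_prod using D0 i0 finite_I that by (intro prod_zero) auto
    then have "(\<Sum>i\<in>I - {i0}. poly (smult (c i) ((\<Prod>j\<in>I - {i}. D' j) * (\<Prod>j\<in>I - {i}. P' j) * T i)) ?z) = 0"
      by (intro sum.neutral) auto
    then show ?thesis
      unfolding R_def sum.remove[OF finite_I i0] poly_add poly_sum by (simp add: poly_sum)
  qed
  moreover have "c i0 = 1" using g'(2) by (simp add: c_def i0_def trivial_char_def)
  moreover have "poly (\<Prod>j\<in>I - {i0}. D' j) ?z \<noteq> 0" "poly (\<Prod>j\<in>I - {i0}. P' j) ?z \<noteq> 0"
    using Dnz Pnz finite_I by (auto simp: poly_prod)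
  moreover have "poly (T i0) ?z \<noteq> 0"
  proof -
    have "poly (T i0) ?z = - (?z * poly (pderiv (D' i0)) ?z * poly (P' i0) ?z)"
      using D0 by (simp add: T_def)
    moreover have "poly (pderiv (D' i0)) ?z \<noteq> 0"
      by (simp add: D'_def i0_def D_def pderiv_pCons)
    ultimately show ?thesis using Pnz[OF i0] by simp
  qed
  ultimately show False by simp
qed

end

section \<open>Every unimodular pair is a first row\<close>

context
  fixes k :: nat
  assumes char: "CARD('a::{finite,field}) = CHAR('a) ^ k" and odd: "odd CARD('a)"
begin

lemma two_nz: "(2 :: 'a) \<noteq> 0"
proof
  assume "(2 :: 'a) = 0"
  then have "of_nat 2 = (0 :: 'a)" by simp
  then have "CHAR('a) dvd 2" by (simp only: of_nat_eq_0_iff_char_dvd)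
  then have "CHAR('a) = 2" using prime_CHAR_finite[where 'a = 'a] by (simp add: primes_dvd_imp_eq)
  then have "CARD('a) = 2 ^ k" using char by simp
  moreover have "CARD('a) > 1" using card_mono[of UNIV "{0, 1 :: 'a}"] by simp
  ultimately show False using odd by (cases k) auto
qed

lemma const_power: "[:x :: 'a:] ^ (CARD('a) ^ n) = [:x:]"
  by (simp add: poly_const_pow finite_field_power_card_power)

lemma poly_frobenius_add: "(f + g :: 'a poly) ^ (CARD('a) ^ n) = f ^ (CARD('a) ^ n) + g ^ (CARD('a) ^ n)"
  by (rule frobenius_add[OF char]) simp

lemma poly_frobenius_diff: "(f - g :: 'a poly) ^ (CARD('a) ^ n) = f ^ (CARD('a) ^ n) - g ^ (CARD('a) ^ n)"
  by (rule frobenius_diff[OF char]) simp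

text \<open>
  The matrix $\alpha$ with rows $(e, b)$ and $(c, d)$ has an $N$-th power of the form
  $f \alpha + g$. Since $(2 \alpha - t)^2 = t^2 - 4$ for the trace $t$, and since taking $N$-th
  powers is additive on commuting matrices,
  $2 \alpha^N - t^N = (2 \alpha - t)^N = (t^2 - 4)^{(N - 1)/2} (2 \alpha - t)$, from which $f$ and
  $g$ are read off. Below, $m$ and $l$ are the diagonal entries of $f \alpha + g$. The number $N$ is
  an odd square, so that $(N - 1)/2$ is even and $f$ is the product of the squares of
  \<open>u1\<close> and \<open>u2\<close>, which are powers of $t - 2$ and $t + 2$. Modulo $b$ or
  $c$ the matrix $\alpha$ is triangular, hence $m \equiv e^N$.
\<close>

lemma power_matrix:
  fixes e d b c :: "'a poly"
  assumes det: "e * d - b * c = 1" and n: "n > 0"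
  defines "N \<equiv> CARD('a) ^ (2 * n)"
  obtains u1 u2 m l where
    "m * l - u1\<^sup>2 * (u2\<^sup>2 * b) * (u1\<^sup>2 * (u2\<^sup>2 * c)) = 1" "u1 dvd m - 1" "u2 dvd m + 1"
    "[m = e ^ N] (mod b)" "[m = e ^ N] (mod c)"
proof -
  define t where "t = e + d"
  define h where "h = (N - 1) div 4"
  have "4 dvd N - 1"
  proof -
    have "odd (CARD('a) ^ n)" using odd by simp
    then obtain z where z: "CARD('a) ^ n = 2 * z + 1" by (rule oddE)
    have "N = (CARD('a) ^ n)\<^sup>2" by (simp add: N_def power_mult[symmetric] mult.commute)
    then have "N - 1 = 4 * (z * z + z)" unfolding z by (simp add: power2_eq_square algebra_simps)
    then show ?thesis by simp
  qed
  moreover have "N > 0" by (simp add: N_def)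
  ultimately have N: "N = 4 * h + 1" by (simp add: h_def)
  have two: "(2 :: 'a poly) ^ N = 2" and four: "(4 :: 'a poly) ^ N = 4"
    unfolding N_def using const_power[of 2 "2 * n"] const_power[of 4 "2 * n"] by (simp_all only: numeral_poly)
  define i2 :: "'a poly" where "i2 = [:1 / 2:]"
  have i2: "i2 * 2 = 1" unfolding i2_def numeral_poly using two_nz by (simp add: one_pCons)
  define u1 where "u1 = (t - 2) ^ h"
  define u2 where "u2 = (t + 2) ^ h"
  define f where "f = u1\<^sup>2 * u2\<^sup>2"
  have f: "f = (t\<^sup>2 - 4) ^ (2 * h)"
  proof -
    have "f = ((t - 2) * (t + 2)) ^ (2 * h)"
      by (simp add: f_def u1_def u2_def power_mult_distrib power_mult[symmetric] mult.commute)
    also have "(t - 2) * (t + 2) = t\<^sup>2 - 4" by (simp add: algebra_simps power2_eq_square)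
    finally show ?thesis .
  qed
  define g where "g = i2 * (t ^ N - f * t)"
  have g: "2 * g = t ^ N - f * t" using i2 by (simp add: g_def mult.assoc[symmetric] mult.commute[of 2])
  define m where "m = f * e + g"
  define l where "l = f * d + g"
  have cancel2: "x = y" if "2 * x = 2 * y" for x y :: "'a poly"
    using arg_cong[OF that, of "\<lambda>z. i2 * z"] i2 by (simp add: mult.assoc[symmetric])
  have ff: "f\<^sup>2 * (t\<^sup>2 - 4) = (t ^ N)\<^sup>2 - 4"
  proof -
    have "f\<^sup>2 * (t\<^sup>2 - 4) = (t\<^sup>2 - 4) ^ N"
      unfolding f N by (simp add: power_mult[symmetric] mult.commute)
    also have "\<dots> = (t\<^sup>2) ^ N - 4" unfolding N_def using poly_frobenius_diff[of "t\<^sup>2" 4 "2 * n"] four[unfolded N_def] by simp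
    finally show ?thesis by (simp add: power_mult[symmetric] mult.commute)
  qed
  have "m * l - u1\<^sup>2 * (u2\<^sup>2 * b) * (u1\<^sup>2 * (u2\<^sup>2 * c)) = f\<^sup>2 * (e * d - b * c) + f * g * t + g\<^sup>2"
    by (simp add: m_def l_def f_def t_def algebra_simps power2_eq_square)
  also have "\<dots> = f\<^sup>2 + f * g * t + g\<^sup>2" by (simp add: det)
  also have "\<dots> = 1"
  proof (rule cancel2, rule cancel2)
    have "2 * (2 * (f\<^sup>2 + f * g * t + g\<^sup>2)) = (2 * g + f * t)\<^sup>2 - f\<^sup>2 * (t\<^sup>2 - 4)"
      by (simp add: algebra_simps power2_eq_square)
    also have "2 * g + f * t = t ^ N" unfolding g by simp
    finally show "2 * (2 * (f\<^sup>2 + f * g * t + g\<^sup>2)) = 2 * (2 * 1)" unfolding ff by simp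
  qed
  finally have 1: "m * l - u1\<^sup>2 * (u2\<^sup>2 * b) * (u1\<^sup>2 * (u2\<^sup>2 * c)) = 1" .
  have half: "x dvd y" if "x dvd 2 * y" for x y :: "'a poly"
  proof -
    have "x dvd i2 * (2 * y)" using that by (rule dvd_mult)
    then show ?thesis using i2 by (simp add: mult.assoc[symmetric])
  qed
  have hN: "h \<le> N" unfolding N by simp
  have uf: "u1 dvd f" "u2 dvd f" by (auto simp: f_def power2_eq_square)
  have 2: "u1 dvd m - 1"
  proof (rule half)
    have "(t - 2) ^ N = t ^ N - 2" unfolding N_def using poly_frobenius_diff[of t 2 "2 * n"] two[unfolded N_def] by simp
    then have "2 * (m - 1) = f * (2 * e - t) + (t - 2) ^ N"
      using g by (simp add: m_def algebra_simps)
    moreover have "u1 dvd (t - 2) ^ N" unfolding u1_def by (rule le_imp_power_dvd[OF hN])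
    ultimately show "u1 dvd 2 * (m - 1)" using uf by simp
  qed
  have 3: "u2 dvd m + 1"
  proof (rule half)
    have "(t + 2) ^ N = t ^ N + 2" unfolding N_def using poly_frobenius_add[of t 2 "2 * n"] two[unfolded N_def] by simp
    then have "2 * (m + 1) = f * (2 * e - t) + (t + 2) ^ N"
      using g by (simp add: m_def algebra_simps)
    moreover have "u2 dvd (t + 2) ^ N" unfolding u2_def by (rule le_imp_power_dvd[OF hN])
    ultimately show "u2 dvd 2 * (m + 1)" using uf by simp
  qed
  \<comment> \<open>Modulo \<open>x\<close> the discriminant \<open>t\<^sup>2 - 4\<close> is the square of the difference \<open>e - d\<close> of the eigenvalues.\<close>
  have 4: "[m = e ^ N] (mod x)" if x: "x dvd e * d - 1" for x
  proof -
    have eq: "(e - d)\<^sup>2 - (t\<^sup>2 - 4) = - 4 * (e * d - 1)" by (simp add: t_def algebra_simps power2_eq_square)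
    have "[(e - d)\<^sup>2 = t\<^sup>2 - 4] (mod x)" unfolding cong_iff_dvd_diff eq using x by (rule dvd_mult)
    then have "[((e - d)\<^sup>2) ^ (2 * h) = f] (mod x)" unfolding f by (rule cong_pow)
    then have "[((e - d)\<^sup>2) ^ (2 * h) * (e - d) = f * (e - d)] (mod x)" by (rule cong_scalar_right)
    moreover have "((e - d)\<^sup>2) ^ (2 * h) * (e - d) = (e - d) ^ N"
      unfolding N by (simp add: power_mult[symmetric])
    moreover have "(e - d) ^ N = e ^ N - d ^ N" unfolding N_def by (rule poly_frobenius_diff)
    moreover have "t ^ N = e ^ N + d ^ N" unfolding N_def t_def by (rule poly_frobenius_add)
    then have "2 * (m - e ^ N) = f * (e - d) - (e ^ N - d ^ N)"
      using g by (simp add: m_def t_def algebra_simps)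
    ultimately have "x dvd 2 * (m - e ^ N)" by (metis cong_iff_dvd_diff cong_sym)
    then show ?thesis unfolding cong_iff_dvd_diff by (rule half)
  qed
  have "e * d - 1 = b * c" using det by (simp add: algebra_simps)
  then show thesis using that[OF 1 2 3] 4[of b] 4[of c] by simp
qed

text \<open>
  Let $e = s^2$. Dirichlet's theorem gives an irreducible $c$ that completes $(e, b)$ to a matrix
  $\alpha$ with lower left entry $c$, and with \<open>degree c \<equiv> 1\<close> modulo
  \<open>degree b\<close>. For \<open>N = q^(2 degree c)\<close> Fermat's theorem yields
  $e^N \equiv e$ modulo $c$, as \<open>core_matrix\<close> requires, and $e^N \equiv e^{q^2}$ modulo
  $b$. So the first row $(a, b)$ of \<open>gamma\<close> has to satisfy $a e \equiv e^{q^2}$ modulo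
  $b$, which is the given condition on \<open>a0\<close>. The upper right entry of
  \<open>gamma * alpha\<close> is $(a + d) b$, and $a + d$ has to be a square. With $d \equiv 1/e$
  modulo $b$ this asks for $(e^{q^2} + 1)/e$ to be a square modulo $b$, and
  $e^{q^2} + 1 = (s^2 + 1)^{q^2}$.
\<close>

lemma core_row:
  fixes b s r a0 :: "'a poly"
  assumes b: "irreducible b" and s: "degree s > 0" "comax s b"
    and sq: "[r\<^sup>2 = s\<^sup>2 + 1] (mod b)" and a0: "[a0 = s ^ (2 * (CARD('a)\<^sup>2 - 1))] (mod b)"
  obtains A where "A \<in> core_family" "m12 A = b" "[m11 A = a0] (mod b)"
proof -
  let ?K = "CARD('a)\<^sup>2" and ?j = "degree b"
  define e where "e = s\<^sup>2"
  have j: "?j > 0" by (rule irreducible_degree_pos[OF b])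
  have s0: "s \<noteq> 0" using s by auto
  have dege: "degree e > 0" using s s0 by (simp add: e_def degree_power_eq)
  interpret progression e ?j by standard (use dege j in auto)
  have eb: "comax e b" unfolding e_def by (rule comax_power[OF s(2)])
  then have "comax b e" by (simp add: comax_sym)
  then obtain b' where b': "[b * b' = 1] (mod e)" "comax b' e" by (rule comax_inverse)
  have "comax (- b') e"
  proof -
    obtain u v where "u * b' + v * e = 1" using b'(2) unfolding comax_def by blast
    then have "(- u) * (- b') + v * e = 1" by simp
    then show ?thesis unfolding comax_def by blast
  qed
  then obtain c where c: "irreducible c" "[c = - b'] (mod e)" "[degree c = 1] (mod ?j)"
    by (rule dirichlet[where B = 0])
  let ?n = "degree c"
  have n: "?n > 0" by (rule irreducible_degree_pos[OF c(1)])
  have "[b * c = - (b * b')] (mod e)" using cong_scalar_left[OF c(2), of b] by simp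
  moreover have "[- (b * b') = - 1] (mod e)" by (rule cong_uminus[OF b'(1)])
  ultimately have "[b * c = - 1] (mod e)" by (rule cong_trans)
  then obtain d where d: "b * c + 1 = e * d" by (auto simp: cong_iff_dvd_diff elim: dvdE)
  then have det: "e * d - b * c = 1" by (simp add: algebra_simps)
  let ?N = "CARD('a) ^ (2 * ?n)"
  obtain u1 u2 m l where M: "m * l - u1\<^sup>2 * (u2\<^sup>2 * b) * (u1\<^sup>2 * (u2\<^sup>2 * c)) = 1" "u1 dvd m - 1" "u2 dvd m + 1"
    "[m = e ^ ?N] (mod b)" "[m = e ^ ?N] (mod c)"
    using power_matrix[OF det n] by metis
  have "[e ^ ?N = e] (mod c)" using fermat_poly'[OF c(1), of e 2] by (simp add: mult.commute)
  with M(5) have mc: "[m = e] (mod c)" by (rule cong_trans)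
  have eN: "[e ^ ?N = e ^ ?K] (mod b)"
  proof -
    obtain i where i: "?n = 1 + i * ?j"
      using c(3) n by (metis One_nat_def Suc_leI add.commute cong_le_nat)
    have "e ^ ?N = (e ^ ?K) ^ (CARD('a) ^ (?j * (2 * i)))"
      unfolding i by (simp add: power_mult[symmetric] power_add[symmetric] algebra_simps)
    then show ?thesis using fermat_poly'[OF b] by simp
  qed
  with M(4) have mb: "[m = e ^ ?K] (mod b)" by (rule cong_trans)
  obtain s' where s': "[s * s' = 1] (mod b)" by (rule comax_inverse[OF s(2)])
  define y where "y = r ^ ?K * s'"
  define a where "a = y\<^sup>2 - d"
  have ye: "[y\<^sup>2 * e = e ^ ?K + 1] (mod b)"
  proof -
    have "y\<^sup>2 * e = (r\<^sup>2) ^ ?K * (s * s')\<^sup>2"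
      by (simp add: y_def e_def power_mult_distrib power_mult[symmetric] mult_ac)
    also have "[(r\<^sup>2) ^ ?K * (s * s')\<^sup>2 = (s\<^sup>2 + 1) ^ ?K * 1\<^sup>2] (mod b)"
      by (intro cong_mult cong_pow sq s')
    also have "(s\<^sup>2 + 1) ^ ?K * 1\<^sup>2 = e ^ ?K + 1"
      using poly_frobenius_add[of "s\<^sup>2" 1 2] by (simp add: e_def)
    finally show ?thesis .
  qed
  have ae: "[a * e = e ^ ?K] (mod b)"
  proof -
    have eq: "a * e - e ^ ?K = (y\<^sup>2 * e - (e ^ ?K + 1)) - b * c"
      using det by (simp add: a_def algebra_simps)
    show ?thesis
      unfolding cong_iff_dvd_diff eq using ye[unfolded cong_iff_dvd_diff] by (rule dvd_diff) simp
  qed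
  have K: "?K \<ge> 1" by simp
  have "[e * a = e * a0] (mod b)"
  proof -
    have "e * s ^ (2 * (?K - 1)) = e ^ Suc (?K - 1)"
      by (simp only: e_def power_mult power_Suc)
    then have "e * s ^ (2 * (?K - 1)) = e ^ ?K" using K by simp
    then have "[e * a0 = e ^ ?K] (mod b)" using cong_scalar_left[OF a0, of e] by simp
    then show ?thesis using ae by (metis cong_sym cong_trans mult.commute)
  qed
  then have aa0: "[a = a0] (mod b)" by (rule cong_comax_cancel[OF eb])
  have "comax (a * e) b" using comax_cong[OF ae] comax_power[OF eb] by blast
  then have "comax a b" using comax_mult_iff by blast
  then obtain x z where xz: "x * a + z * b = 1" by (auto simp: comax_def)
  define gamma where "gamma = Mat a b (- z) x"
  have "gamma \<in> core_family"
  proof (rule core_matrix)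
    show "mdet (Mat e b c d) = 1" using det by simp
    show "mdet gamma = 1" using xz by (simp add: gamma_def algebra_simps)
    have "a * b + b * d = y\<^sup>2 * b" by (simp add: a_def algebra_simps)
    then show "gamma * Mat e b c d = Mat (a * e + b * c) (y\<^sup>2 * b) (- z * e + x * c) (- z * b + x * d)"
      by (simp add: gamma_def)
    have "a * e + b * c + 1 = y * (y * e)"
      using det by (simp add: a_def algebra_simps power2_eq_square)
    then show "y dvd a * e + b * c - 1 \<or> y dvd a * e + b * c + 1" by simp
    show "b dvd a * e + b * c - m"
    proof -
      have "b dvd a * e - m" using ae mb by (metis cong_iff_dvd_diff cong_sym cong_trans)
      then have "b dvd (a * e - m) + b * c" by simp
      then show ?thesis by (simp add: algebra_simps)
    qed
    show "c dvd m - e" using mc by (simp add: cong_iff_dvd_diff)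
  qed (use M in auto)
  then show thesis using that aa0 by (simp add: gamma_def)
qed

lemma ac_eval_cong:
  assumes "[f = g] (mod h)" "ac_eval x h = 0"
  shows "ac_eval x f = ac_eval x (g :: 'a poly)"
proof -
  obtain z where "f - g = h * z" using assms(1) by (auto simp: cong_iff_dvd_diff elim: dvdE)
  then have "ac_eval x (f - g) = 0" using assms(2) by simp
  then show ?thesis by simp
qed

text \<open>
  The constants already are $q$ roots of $x^q - x$, hence all of them.
\<close>

lemma range_to_ac:
  assumes "x ^ CARD('a) = x"
  shows "x \<in> range (to_ac :: 'a \<Rightarrow> 'a alg_closure)"
proof -
  let ?q = "CARD('a)"
  define p :: "'a alg_closure poly" where "p = monom 1 ?q - monom 1 1"
  have q: "?q > 1" using card_mono[of UNIV "{0, 1 :: 'a}"] by simp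
  have "coeff p ?q = 1" using q by (simp add: p_def)
  then have p: "p \<noteq> 0" by auto
  have deg: "degree p \<le> ?q"
    unfolding p_def using q by (intro degree_diff_le degree_monom_le[THEN order_trans]) auto
  have sub: "range (to_ac :: 'a \<Rightarrow> _) \<subseteq> {x. poly p x = 0}"
    using finite_field_power_card[where 'a = 'a] by (auto simp: p_def poly_monom simp flip: to_ac_power)
  have "card (range (to_ac :: 'a \<Rightarrow> _)) = ?q" by (rule card_image[OF inj_to_ac])
  moreover have "card {x. poly p x = 0} \<le> ?q" using card_poly_roots_bound[OF p] deg by simp
  ultimately have "range (to_ac :: 'a \<Rightarrow> _) = {x. poly p x = 0}"
    using sub poly_roots_finite[OF p] by (intro card_subset_eq) (auto dest: card_mono)
  then show ?thesis using assms by (auto simp: p_def poly_monom)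
qed

lemma geometric_sum: "(\<Sum>i<n. CARD('a) ^ i) * (CARD('a) - 1) = CARD('a) ^ n - 1"
proof -
  have "(\<Sum>i<n. Suc Q ^ i) * Q + 1 = Suc Q ^ n" for Q
    by (induction n) (simp_all add: algebra_simps)
  moreover have "CARD('a) = Suc (CARD('a) - 1)" using zero_less_card_finite[where 'a = 'a] by simp
  ultimately show ?thesis by (metis add_diff_cancel_right')
qed

text \<open>
  As $p \equiv 1$ modulo $h$ and \<open>degree h\<close> is even, reciprocity makes the norm of $h$
  modulo $p$ a power of the leading coefficient, hence a square. The norm is the power of $h$ whose
  exponent is the sum of $q^i$ over \<open>i < degree p\<close>. This is odd, and dividing by an
  even power of $h$ leaves $h$.
\<close>

lemma square_residue:
  fixes h p :: "'a poly"
  assumes p: "irreducible p" "lead_coeff p = 1" "odd (degree p)" "[p = 1] (mod h)"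
    and h: "even (degree h)" "lead_coeff h = \<mu>\<^sup>2" "h \<noteq> 0"
  obtains r where "[r\<^sup>2 = h] (mod p)"
proof -
  obtain A where A: "size A = degree h" "\<And>x. x \<in># A \<Longrightarrow> ac_eval x h = 0"
    "\<And>p b. irreducible p \<Longrightarrow> lead_coeff p = 1 \<Longrightarrow> ac_eval b p = 0 \<Longrightarrow>
      ac_eval b h ^ (\<Sum>i<degree p. CARD('a) ^ i) =
        to_ac (lead_coeff h) ^ degree p * (- 1) ^ (degree h * degree p) * (\<Prod>x\<in>#A. ac_eval x p)"
    by (rule norm_reciprocity[OF char h(3)]) blast
  obtain b where b: "ac_eval b p = 0" using ac_root_exists[OF p(1)] .
  let ?m = "\<Sum>i<degree p. CARD('a) ^ i"
  have "ac_eval x p = 1" if "x \<in># A" for x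
    using ac_eval_cong[OF p(4) A(2)[OF that]] by simp
  then have "(\<Prod>x\<in>#A. ac_eval x p) = 1" by (simp add: prod_mset.neutral)
  then have "ac_eval b h ^ ?m = to_ac (\<mu>\<^sup>2) ^ degree p"
    using A(3)[OF p(1,2) b] h(1) by (simp add: h(2) power_even_eq[symmetric])
  then have "ac_eval b (h ^ ?m) = ac_eval b ([:\<mu> ^ degree p:]\<^sup>2)"
    by (simp add: power_mult[symmetric] mult.commute)
  then have hm: "[h ^ ?m = [:\<mu> ^ degree p:]\<^sup>2] (mod p)"
    using ac_eval_eq_iff_cong[OF p(1) b] by blast
  have "odd ?m"
  proof -
    have "even (\<Sum>i<n. CARD('a) ^ i) = even n" for n
      using odd by (induction n) auto
    then show ?thesis using p(3) by blast
  qed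
  then obtain z where z: "?m = 2 * z + 1" by (rule oddE)
  have "comax p h" using comax_cong[OF p(4)] by simp
  then have "comax h p" by (simp add: comax_sym)
  then obtain h' where h': "[h * h' = 1] (mod p)" by (rule comax_inverse)
  have "([:\<mu> ^ degree p:] * h' ^ z)\<^sup>2 = [:\<mu> ^ degree p:]\<^sup>2 * (h' ^ z)\<^sup>2" by (rule power_mult_distrib)
  also have "[[:\<mu> ^ degree p:]\<^sup>2 * (h' ^ z)\<^sup>2 = h ^ ?m * (h' ^ z)\<^sup>2] (mod p)"
    by (rule cong_scalar_right[OF cong_sym[OF hm]])
  also have "h ^ ?m * (h' ^ z)\<^sup>2 = h * ((h * h') ^ z)\<^sup>2"
  proof -
    have "h ^ (2 * z + 1) = h * (h ^ z)\<^sup>2" by (simp add: power_even_eq)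
    then show ?thesis unfolding z power_mult_distrib by (simp only: mult.assoc)
  qed
  also have "[h * ((h * h') ^ z)\<^sup>2 = h * (1 ^ z)\<^sup>2] (mod p)"
    by (intro cong_scalar_left cong_pow h')
  finally show thesis using that by simp
qed

text \<open>
  $q^4 - 1 = (q^2 - 1)(q^2 + 1)$ is a multiple of $w$, as $q^2 + 1$ is even. So the powers of $q$
  have period 4 modulo $w$, and after the term 1 there are $w n$ full periods.
\<close>

lemma geometric_sum_cong:
  assumes "w = 2 * (CARD('a)\<^sup>2 - 1)"
  shows "[(\<Sum>i<1 + 4 * w * n. CARD('a) ^ i) = 1] (mod w)"
proof -
  let ?q = "CARD('a)"
  have q4: "[?q ^ 4 = 1] (mod w)"
  proof -
    obtain z where z: "?q\<^sup>2 + 1 = 2 * z" using odd by (metis evenE even_add even_power odd_one power2_eq_square even_mult_iff)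
    have 1: "?q\<^sup>2 \<ge> 1" by simp
    have "?q ^ 4 - 1 = (?q\<^sup>2 - 1) * (?q\<^sup>2 + 1)"
      using 1 by (simp add: algebra_simps power_add[symmetric] diff_mult_distrib)
    also have "\<dots> = w * z" unfolding z assms by simp
    finally have "?q ^ 4 - 1 = w * z" .
    moreover have "?q ^ 4 > 0" by simp
    ultimately have "?q ^ 4 = 1 + w * z" by linarith
    then show ?thesis by (simp only: cong_def mod_mult_self2)
  qed
  have blocks: "[(\<Sum>i<4 * m. ?q ^ i) = m * (1 + ?q + ?q\<^sup>2 + ?q ^ 3)] (mod w)" for m
  proof (induction m)
    case (Suc m)
    have 4: "4 * Suc m = Suc (Suc (Suc (Suc (4 * m))))" by simp
    have "(\<Sum>i<4 * Suc m. ?q ^ i) = (\<Sum>i<4 * m. ?q ^ i) + (?q ^ 4) ^ m * (1 + ?q + ?q\<^sup>2 + ?q ^ 3)"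
      unfolding 4 sum.lessThan_Suc power_mult[symmetric]
      by (simp add: algebra_simps power2_eq_square power3_eq_cube)
    also have "[(\<Sum>i<4 * m. ?q ^ i) + (?q ^ 4) ^ m * (1 + ?q + ?q\<^sup>2 + ?q ^ 3) =
        m * (1 + ?q + ?q\<^sup>2 + ?q ^ 3) + 1 ^ m * (1 + ?q + ?q\<^sup>2 + ?q ^ 3)] (mod w)"
      by (intro cong_add Suc cong_scalar_right cong_pow q4)
    finally show ?case by (simp add: algebra_simps)
  qed simp
  have "(\<Sum>i<1 + 4 * (w * n). ?q ^ i) = 1 + ?q * (\<Sum>i<4 * (w * n). ?q ^ i)"
    by (simp only: plus_1_eq_Suc sum.lessThan_Suc_shift sum_distrib_left power_Suc power_0)
  also have "[\<dots> = 1 + ?q * (w * n * (1 + ?q + ?q\<^sup>2 + ?q ^ 3))] (mod w)"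
    by (intro cong_add cong_refl cong_scalar_left blocks)
  also have "1 + ?q * (w * n * (1 + ?q + ?q\<^sup>2 + ?q ^ 3)) = 1 + w * (?q * n * (1 + ?q + ?q\<^sup>2 + ?q ^ 3))"
    by (simp only: mult_ac)
  also have "[\<dots> = 1] (mod w)" by (simp only: cong_def mod_mult_self2)
  finally show ?thesis by (simp only: mult.assoc)
qed

text \<open>
  If the norm \<open>a0^m\<close> of \<open>a0\<close> modulo $p$ is 1 and $m$ is prime to
  $w = 2 (q^2 - 1)$, then \<open>a0\<close> is a $w$-th power modulo $p$; by
  \<open>geometric_sum_cong\<close> the exponent $m$ is prime to $w$ when
  \<open>degree p \<equiv> 1\<close> modulo $4 w$. By reciprocity all such $p$ in the class of
  \<open>b0\<close> yield the same norm $\beta$, a nonzero constant. The scalar $\kappa = \beta$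
  corrects it: for $p$ in the class of \<open>b0 / \<kappa>\<close> the norm is divided by
  \<open>\<kappa>^(degree a0)\<close>, which is $\kappa$ because \<open>degree a0 \<equiv> 1\<close>
  modulo $q - 1$.
\<close>

lemma power_residue:
  fixes a0 b0 :: "'a poly"
  assumes a0: "lead_coeff a0 = 1" "[degree a0 = 1] (mod (CARD('a) - 1))" "degree a0 > 0" and cop: "comax b0 a0"
  obtains \<kappa> p s where "\<kappa> \<noteq> 0" "irreducible p" "[smult \<kappa> p = b0] (mod a0)"
    "degree s > 0" "comax s p" "[s ^ (2 * (CARD('a)\<^sup>2 - 1)) = a0] (mod p)"
proof -
  let ?q = "CARD('a)"
  define w where "w = 2 * (?q\<^sup>2 - 1)"
  have q: "?q > 1" using card_mono[of UNIV "{0, 1 :: 'a}"] by simp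
  have "?q ^ 1 < ?q\<^sup>2" using q by (intro power_strict_increasing) auto
  then have w: "w > 0" using q by (simp add: w_def)
  interpret progression a0 "4 * w" by standard (use a0 w in auto)
  have a0nz: "a0 \<noteq> 0" using a0 by auto
  let ?m = "\<lambda>p :: 'a poly. \<Sum>i<degree p. ?q ^ i"
  obtain A where A: "size A = degree a0" "\<And>x. x \<in># A \<Longrightarrow> ac_eval x a0 = 0"
    "\<And>p b. irreducible p \<Longrightarrow> lead_coeff p = 1 \<Longrightarrow> ac_eval b p = 0 \<Longrightarrow>
      ac_eval b a0 ^ ?m p =
        to_ac (lead_coeff a0) ^ degree p * (- 1) ^ (degree a0 * degree p) * (\<Prod>x\<in>#A. ac_eval x p)"
    by (rule norm_reciprocity[OF char a0nz]) blast
  define \<beta> where "\<beta> = (- 1) ^ degree a0 * (\<Prod>x\<in>#A. ac_eval x b0)"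
  have deg: "\<exists>i. degree p = 1 + 4 * w * i" if "[degree p = 1] (mod 4 * w)" "degree p > 0" for p :: "'a poly"
    using that by (metis One_nat_def Suc_leI add.commute cong_le_nat mult.commute)
  have key: "ac_eval b a0 ^ ?m p = to_ac (inverse \<kappa>) * \<beta>"
    if p: "irreducible p" "lead_coeff p = 1" "ac_eval b p = 0" "[degree p = 1] (mod 4 * w)"
      "[smult \<kappa> p = b0] (mod a0)" "\<kappa> \<noteq> 0" for p b \<kappa>
  proof -
    obtain i where "degree p = 1 + 4 * w * i" using deg p irreducible_degree_pos by blast
    then have odd_deg: "odd (degree p)" by simp
    have ev: "ac_eval x p = to_ac (inverse \<kappa>) * ac_eval x b0" if "x \<in># A" for x
    proof -
      have "to_ac \<kappa> * ac_eval x p = ac_eval x b0"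
        using ac_eval_cong[OF p(5) A(2)[OF that]] by simp
      moreover have "to_ac (inverse \<kappa>) * to_ac \<kappa> = 1" using p(6) by (simp flip: to_ac_mult)
      ultimately show ?thesis by (metis mult.assoc mult_1_left)
    qed
    have "(\<Prod>x\<in>#A. ac_eval x p) = (\<Prod>x\<in>#A. to_ac (inverse \<kappa>) * ac_eval x b0)"
      using ev by (intro arg_cong[of _ _ prod_mset] image_mset_cong) auto
    also have "\<dots> = to_ac (inverse \<kappa>) ^ size A * (\<Prod>x\<in>#A. ac_eval x b0)"
      by (simp only: prod_mset.distrib prod_mset_constant)
    also have "to_ac (inverse \<kappa>) ^ size A = to_ac (inverse \<kappa> ^ degree a0)"
      unfolding A(1) by simp
    also have "inverse \<kappa> ^ degree a0 = inverse \<kappa>"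
      using p(6) a0(2,3) by (intro finite_field_power_cong_1) auto
    finally have "(\<Prod>x\<in>#A. ac_eval x p) = to_ac (inverse \<kappa>) * (\<Prod>x\<in>#A. ac_eval x b0)" .
    moreover have "(- 1 :: 'a alg_closure) ^ (degree a0 * degree p) = (- 1) ^ degree a0"
      using odd_deg by (simp add: power_mult minus_one_power_iff)
    ultimately show ?thesis using A(3)[OF p(1-3)] a0(1) by (simp add: \<beta>_def)
  qed
  \<comment> \<open>Some auxiliary \<open>p0\<close> shows that \<open>\<beta>\<close> is a nonzero constant.\<close>
  obtain p0 where p0: "irreducible p0" "lead_coeff p0 = 1" "[p0 = b0] (mod a0)" "[degree p0 = 1] (mod 4 * w)"
    using dirichlet[OF cop, where B = 0] by metis
  obtain x0 where x0: "ac_eval x0 p0 = 0" using ac_root_exists[OF p0(1)] .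
  have \<beta>: "ac_eval x0 a0 ^ ?m p0 = \<beta>" using key[of p0 x0 1] p0 x0 by simp
  have "comax a0 p0" using cop comax_cong[OF p0(3)] comax_sym by metis
  then have "[a0 ^ (?q ^ degree p0 - 1) = 1] (mod p0)" by (rule fermat_poly[OF p0(1)])
  then have "ac_eval x0 (a0 ^ (?q ^ degree p0 - 1)) = ac_eval x0 1"
    using ac_eval_eq_iff_cong[OF p0(1) x0] by blast
  then have "ac_eval x0 a0 ^ (?m p0 * (?q - 1)) = 1" unfolding geometric_sum by simp
  then have \<beta>1: "\<beta> ^ (?q - 1) = 1" unfolding \<beta>[symmetric] by (simp add: power_mult)
  then have "\<beta> * \<beta> ^ (?q - 1) = \<beta>" by simp
  then have "\<beta> ^ ?q = \<beta>" using q by (simp add: power_eq_if)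
  then obtain \<kappa> where \<kappa>: "\<beta> = to_ac \<kappa>" using range_to_ac by blast
  have \<kappa>0: "\<kappa> \<noteq> 0" using \<beta>1 q \<kappa> by (auto simp: power_0_left)
  have "comax (smult (inverse \<kappa>) b0) a0"
  proof -
    obtain u v where "u * b0 + v * a0 = 1" using cop by (auto simp: comax_def)
    then have "smult \<kappa> u * smult (inverse \<kappa>) b0 + v * a0 = 1" using \<kappa>0 by simp
    then show ?thesis unfolding comax_def by blast
  qed
  then obtain p where p: "irreducible p" "lead_coeff p = 1" "[p = smult (inverse \<kappa>) b0] (mod a0)"
    "[degree p = 1] (mod 4 * w)"
    using dirichlet[where B = 0] by metis
  have pb0: "[smult \<kappa> p = b0] (mod a0)"
    using cong_scalar_left[OF p(3), of "[:\<kappa>:]"] \<kappa>0 by simp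
  obtain x where x: "ac_eval x p = 0" using ac_root_exists[OF p(1)] .
  have "ac_eval x a0 ^ ?m p = to_ac (inverse \<kappa> * \<kappa>)"
    using key[OF p(1,2) x p(4) pb0 \<kappa>0] \<kappa> by simp
  then have "ac_eval x (a0 ^ ?m p) = ac_eval x 1" using \<kappa>0 by simp
  then have a0m: "[a0 ^ ?m p = 1] (mod p)" using ac_eval_eq_iff_cong[OF p(1) x] by blast
  have dp: "degree p > 0" by (rule irreducible_degree_pos[OF p(1)])
  obtain i where i: "degree p = 1 + 4 * w * i" using deg[OF p(4) dp] by blast
  have "[?m p = 1] (mod w)" unfolding i by (rule geometric_sum_cong) (simp add: w_def)
  then have "coprime (?m p) w" using cong_imp_coprime[of 1 "?m p" w] cong_sym by auto
  then have "coprime w (?m p)" by (simp add: coprime_commute)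
  then obtain z0 where z0: "[w * z0 = 1] (mod ?m p)" using cong_solve_coprime_nat by (metis One_nat_def)
  define z where "z = z0 + ?m p"
  have mp: "?m p > 0" unfolding i by (simp add: sum_pos)
  have "[w * z = 1] (mod ?m p)" using z0 by (simp add: z_def distrib_left cong_def)
  moreover have "w * z \<ge> 1" using w mp by (simp add: z_def)
  ultimately obtain l where l: "w * z = 1 + l * ?m p" by (metis add.commute cong_le_nat)
  define s0 where "s0 = a0 ^ z"
  have "s0 ^ w = a0 * (a0 ^ ?m p) ^ l"
    by (simp add: s0_def power_mult[symmetric] mult.commute[of z] l mult.commute[of l])
  moreover have "[a0 * (a0 ^ ?m p) ^ l = a0 * 1 ^ l] (mod p)"
    by (intro cong_scalar_left cong_pow a0m)
  ultimately have s0w: "[s0 ^ w = a0] (mod p)" by simp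
  \<comment> \<open>\<open>s\<close> must not be constant, as it is used as a modulus later.\<close>
  define s where "s = (if degree s0 > 0 then s0 else s0 + p)"
  have ss0: "[s = s0] (mod p)" by (simp add: s_def cong_def)
  have "[s ^ w = a0] (mod p)" using cong_pow[OF ss0] s0w by (rule cong_trans)
  moreover have "comax s p"
  proof -
    have "comax p a0"
      using cop comax_cong[OF pb0] comax_mult_iff[of "[:\<kappa>:]" p a0] by simp
    then have "comax a0 p" by (simp add: comax_sym)
    then have "comax s0 p" unfolding s0_def by (rule comax_power)
    then show ?thesis using comax_cong[OF ss0] by blast
  qed
  moreover have "degree s > 0" using dp by (auto simp: s_def degree_add_eq_right)
  ultimately show thesis using that[OF \<kappa>0 p(1) pb0] by (simp add: w_def)
qed

lemma m_mult_e21: "m11 (A * e21 x) = m11 A + m12 A * x" "m12 (A * e21 x) = m12 A"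
  and m_mult_e12: "m11 (A * e12 x) = m11 A" "m12 (A * e12 x) = m11 A * x + m12 A"
  for A :: "'b::comm_ring_1 mat2"
  by (simp_all add: times_mat2_def e12_def e21_def)

text \<open>
  The entries are changed alternately:
  \<open>(a, b) \<rightarrow> (a, b0) \<rightarrow> (a0, b0) \<rightarrow> (a0, b1) \<rightarrow> (a1, b1) \<rightarrow> (a1, b2) \<rightarrow> (m11 A, b2)\<close>.
  The first two steps make \<open>a0\<close> monic of a degree that fits
  \<open>power_residue\<close>, which then gives \<open>b1 = \<kappa> p\<close> and the power
  \<open>a1 = s^w\<close>. To satisfy \<open>core_row\<close>, \<open>b1\<close> is replaced by an
  irreducible \<open>b2\<close> with \<open>b2 \<equiv> b1\<close> modulo \<open>a1\<close> and
  \<open>b2 \<equiv> 1\<close> modulo $h = s^2 + 1$, of odd degree, so that $h$ becomes a square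
  modulo \<open>b2\<close>. The two moduli are coprime because $s$ and $s^2 + 1$ are. Multiplying
  $A$ from the right by the inverse shears in reverse order leads back to $(a, b)$.
\<close>

lemma row_reached:
  fixes a b :: "'a poly"
  assumes "comax a b"
  obtains A where "A \<in> core_family * (shears21 * shears12) ^ 4" "m11 A = a" "m12 A = b"
proof -
  let ?q = "CARD('a)"
  define w where "w = 2 * (?q\<^sup>2 - 1)"
  have q: "?q > 1" using card_mono[of UNIV "{0, 1 :: 'a}"] by simp
  have "?q ^ 1 < ?q\<^sup>2" using q by (intro power_strict_increasing) auto
  then have w: "w > 0" using q by (simp add: w_def)
  obtain u v where uv: "u * a + v * b = 1" using assms by (auto simp: comax_def)
  \<comment> \<open>If \<open>b = 0\<close>, then \<open>a\<close> is a unit, and adding \<open>a\<close> makes the second entry nonzero.\<close>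
  define y0 where "y0 = (if b = 0 then 1 else 0 :: 'a poly)"
  define b0 where "b0 = b + a * y0"
  have b0: "b0 \<noteq> 0" using uv by (auto simp: b0_def y0_def)
  \<comment> \<open>A degree that is 1 modulo \<open>q - 1\<close> and larger than both degrees, so that \<open>b0 * x0\<close> determines the leading term.\<close>
  define n0 where "n0 = 1 + (?q - 1) * (degree a + degree b0 + 1)"
  have "1 * (degree a + degree b0 + 1) \<le> (?q - 1) * (degree a + degree b0 + 1)"
    using q by (intro mult_le_mono1) simp
  then have n0: "n0 > degree a" "n0 > degree b0" by (simp_all add: n0_def)
  define x0 where "x0 = monom (inverse (lead_coeff b0)) (n0 - degree b0)"
  have x0: "x0 \<noteq> 0" using b0 by (simp add: x0_def)
  have "degree x0 = n0 - degree b0" using b0 by (simp add: x0_def degree_monom_eq)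
  then have dx: "degree (b0 * x0) = n0" using b0 x0 n0(2) by (simp add: degree_mult_eq)
  have "lead_coeff x0 = inverse (lead_coeff b0)" unfolding x0_def by (rule lead_coeff_monom)
  then have lx: "lead_coeff (b0 * x0) = 1" unfolding lead_coeff_mult using b0 by simp
  define a0 where "a0 = a + b0 * x0"
  have dega0: "degree a0 = n0" unfolding a0_def using dx n0(1) by (simp add: degree_add_eq_right)
  have leada0: "lead_coeff a0 = 1"
    using dx lx n0(1) unfolding dega0 unfolding a0_def by (simp add: coeff_eq_0)
  have "comax b0 a0"
  proof -
    have "comax a b0"
    proof -
      have "(u - v * y0) * a + v * b0 = 1" using uv by (simp add: b0_def algebra_simps)
      then show ?thesis unfolding comax_def by blast
    qed
    then obtain u' v' where "u' * a + v' * b0 = 1" by (auto simp: comax_def)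
    then have "(v' - u' * x0) * b0 + u' * a0 = 1" by (simp add: a0_def algebra_simps)
    then show ?thesis unfolding comax_def by blast
  qed
  moreover have "[degree a0 = 1] (mod (?q - 1))" unfolding dega0 n0_def by (simp only: cong_def mod_mult_self2)
  moreover have "degree a0 > 0" using dega0 by (simp add: n0_def)
  ultimately obtain \<kappa> p s where ps: "\<kappa> \<noteq> 0" "irreducible p" "[smult \<kappa> p = b0] (mod a0)"
    "degree s > 0" "comax s p" "[s ^ w = a0] (mod p)"
    using power_residue[OF leada0] unfolding w_def by metis
  define b1 where "b1 = smult \<kappa> p"
  obtain y1 where y1: "b1 - b0 = a0 * y1" using ps(3) unfolding b1_def cong_iff_dvd_diff by (auto elim: dvdE)
  define a1 where "a1 = s ^ w"
  obtain x1' where x1': "a1 - a0 = p * x1'" using ps(6) unfolding a1_def cong_iff_dvd_diff by (auto elim: dvdE)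
  define x1 where "x1 = smult (inverse \<kappa>) x1'"
  have x1: "a1 - a0 = b1 * x1" using x1' ps(1) by (simp add: b1_def x1_def)
  define h where "h = s\<^sup>2 + 1"
  have s0: "s \<noteq> 0" using ps(4) by auto
  have ds2: "degree (s\<^sup>2) = 2 * degree s" using s0 by (simp add: degree_power_eq)
  then have degh: "degree h = 2 * degree s"
    unfolding h_def using ps(4) by (subst degree_add_eq_left) auto
  have leadh: "lead_coeff h = (lead_coeff s)\<^sup>2"
    unfolding degh unfolding h_def using ps(4) ds2 lead_coeff_power[of s 2] by (simp add: coeff_eq_0)
  have h0: "h \<noteq> 0" using degh ps(4) by auto
  have "comax s h"
  proof -
    have "(- s) * s + 1 * h = 1" by (simp add: h_def power2_eq_square)
    then show ?thesis unfolding comax_def by blast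
  qed
  then have coph: "comax a1 h" unfolding a1_def by (rule comax_power)
  have "comax b1 a1"
  proof -
    have "comax p s" using ps(5) by (simp add: comax_sym)
    moreover have "comax [:\<kappa>:] s"
    proof -
      have "[:inverse \<kappa>:] * [:\<kappa>:] + 0 * s = 1" using ps(1) by (simp add: one_pCons)
      then show ?thesis unfolding comax_def by blast
    qed
    ultimately have "comax b1 s" using comax_mult[of "[:\<kappa>:]" s p] by (simp add: b1_def)
    then have "comax s b1" by (simp add: comax_sym)
    then have "comax a1 b1" unfolding a1_def by (rule comax_power)
    then show ?thesis by (simp add: comax_sym)
  qed
  obtain g where g: "[g = b1] (mod a1)" "[g = 1] (mod h)" by (rule chinese_remainder_comax[OF coph])
  have "comax g (a1 * h)"
  proof -
    have "comax a1 g" using \<open>comax b1 a1\<close> comax_cong[OF g(1)] by (simp add: comax_sym)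
    moreover have "comax h g" using comax_cong[OF g(2)] by (simp add: comax_sym)
    ultimately have "comax (a1 * h) g" by (rule comax_mult)
    then show ?thesis by (simp add: comax_sym)
  qed
  have "a1 \<noteq> 0" using s0 by (simp add: a1_def)
  then have "degree (a1 * h) > 0" using degh ps(4) h0 by (simp add: degree_mult_eq)
  interpret progression "a1 * h" 2 by standard (fact, simp)
  obtain b2 where b2: "irreducible b2" "lead_coeff b2 = 1" "[b2 = g] (mod (a1 * h))" "[degree b2 = 1] (mod 2)"
    using dirichlet[OF \<open>comax g (a1 * h)\<close>, where B = 0] by metis
  have b2a1: "[b2 = b1] (mod a1)" and b2h: "[b2 = 1] (mod h)"
    using b2(3) g cong_modulus_mult[of b2 g a1 h] cong_modulus_mult[of b2 g h a1]
    by (auto simp: mult.commute intro: cong_trans)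
  have "odd (degree b2)" using b2(4) by (simp add: cong_def odd_iff_mod_2_eq_one)
  then obtain r where r: "[r\<^sup>2 = h] (mod b2)"
    using square_residue[OF b2(1,2) _ b2h _ leadh h0] degh by auto
  have "comax s b2"
  proof -
    have "comax a1 b2" using \<open>comax b1 a1\<close> comax_cong[OF b2a1] by (simp add: comax_sym)
    moreover have "a1 = s * s ^ (w - 1)" using w by (simp add: a1_def power_eq_if)
    ultimately show ?thesis by (simp add: comax_mult_iff)
  qed
  then obtain A where A: "A \<in> core_family" "m12 A = b2" "[m11 A = a1] (mod b2)"
    using core_row[OF b2(1) ps(4) _ r[unfolded h_def], of a1] unfolding a1_def w_def by auto
  obtain x2 where x2: "m11 A - a1 = b2 * x2" using A(3) by (auto simp: cong_iff_dvd_diff elim: dvdE)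
  obtain y2 where y2: "b2 - b1 = a1 * y2" using b2a1 by (auto simp: cong_iff_dvd_diff elim: dvdE)
  \<comment> \<open>The chain has six shears; the last pair is trivial and only fills up the fourth factor.\<close>
  define R where "R = A * ((e21 (- x2) * e12 (- y2)) * ((e21 (- x1) * e12 (- y1)) *
    ((e21 (- x0) * e12 (- y0)) * (e21 0 * e12 0))))"
  have "R = A * e21 (- x2) * e12 (- y2) * e21 (- x1) * e12 (- y1) * e21 (- x0) * e12 (- y0) * e21 0 * e12 0"
    unfolding R_def by (simp only: mult.assoc)
  moreover have "m11 A + b2 * - x2 = a1" "b2 + a1 * - y2 = b1" "a1 + b1 * - x1 = a0" "b1 + a0 * - y1 = b0"
      "a0 + b0 * - x0 = a" "b0 + a * - y0 = b"
    using x2 y2 x1 y1 by (simp_all add: a0_def b0_def algebra_simps)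
  ultimately have "m11 R = a" "m12 R = b"
    by (simp_all only: m_mult_e21 m_mult_e12 A(2) add.commute[of "_ * _"] mult_zero_right add_0_right add_0_left)
  moreover have "R \<in> core_family * (shears21 * shears12) ^ 4"
  proof -
    have "(shears21 * shears12) ^ 4 = (shears21 * shears12) * ((shears21 * shears12) * ((shears21 * shears12) *
        (shears21 * shears12 :: 'a poly mat2 set)))"
      by (simp only: power4_eq_xxxx mult.assoc)
    then show ?thesis
      unfolding R_def by (auto intro!: set_times_intro A(1) simp: shears12_def shears21_def)
  qed
  ultimately show thesis using that by blast
qed

end

lemma polynomial_family_first_rows:
  fixes S :: "'a::comm_ring_1 mat2 set"
  assumes S: "matfam d S" and "d > 0" and rows: "\<And>a b. comax a b \<Longrightarrow> \<exists>A\<in>S. m11 A = a \<and> m12 A = b"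
  shows "polynomial_family 2 d (UM 2 :: 'a list set)"
proof -
  obtain F where F: "S = F ` tuples d" "polyfun d (\<lambda>t. m11 (F t))" "polyfun d (\<lambda>t. m12 (F t))"
    using S unfolding matfam_def by auto
  obtain P1 P2 where P: "P1 \<in> mpolys d" "P2 \<in> mpolys d"
    "\<And>t. t \<in> tuples d \<Longrightarrow> mpoly_eval t P1 = m11 (F t)" "\<And>t. t \<in> tuples d \<Longrightarrow> mpoly_eval t P2 = m12 (F t)"
    using F(2,3) unfolding polyfun_def by metis
  have "UM 2 = {map (mpoly_eval t) [P1, P2] | t. t \<in> tuples d}"
  proof (intro equalityI subsetI)
    fix m :: "'a list" assume "m \<in> UM 2"
    then obtain \<alpha> where m: "length m = 2" "length \<alpha> = 2" "(\<Sum>i<2. \<alpha> ! i * m ! i) = 1"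
      by (auto simp: UM_def unimodular_def tuples_def)
    obtain a b where ab: "m = [a, b]" using m(1) by (auto simp: length_Suc_conv numeral_2_eq_2)
    have "comax a b" unfolding comax_def using m(3) by (auto simp: ab numeral_2_eq_2)
    then obtain A where "A \<in> S" "m11 A = a" "m12 A = b" using rows by blast
    then obtain t where "t \<in> tuples d" "m11 (F t) = a" "m12 (F t) = b" using F(1) by auto
    then show "m \<in> {map (mpoly_eval t) [P1, P2] | t. t \<in> tuples d}"
      using P(3,4) by (intro CollectI exI[of _ t]) (simp add: ab)
  next
    fix m assume "m \<in> {map (mpoly_eval t) [P1, P2] | t. t \<in> tuples d}"
    then obtain t where t: "t \<in> tuples d" "m = [m11 (F t), m12 (F t)]" using P(3,4) by auto
    have "F t \<in> S" using t(1) F(1) by blast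
    then have "mdet (F t) = 1" using S by (auto simp: matfam_def)
    then have "(\<Sum>i<2. [m22 (F t), - m21 (F t)] ! i * m ! i) = 1"
      by (simp add: t(2) numeral_2_eq_2 mdet_def algebra_simps)
    moreover have "length m = 2" by (simp add: t(2))
    ultimately have "unimodular m"
      unfolding unimodular_def by (intro bexI[of _ "[m22 (F t), - m21 (F t)]"]) (simp_all add: tuples_def)
    then show "m \<in> UM 2" using \<open>length m = 2\<close> by (simp add: UM_def tuples_def)
  qed
  moreover have "(UM 2 :: 'a list set) \<subseteq> tuples 2" by (auto simp: UM_def)
  ultimately show ?thesis
    unfolding polynomial_family_def using P(1,2) assms(2)
    by (intro conjI bexI[of _ "[P1, P2]"]) (auto simp: tuples_def)
qed

theorem corollary1p6:
  fixes p k q :: nat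
  assumes "prime p" and "odd p" and "k \<ge> 1" and "q = p ^ k"
    and "CARD('a::{finite,field}) = q"
  shows "polynomial_family 2 52 (UM 2 :: 'a poly list set)"
proof -
  have "CHAR('a) dvd p ^ k" using CHAR_dvd_CARD[where 'a = 'a] assms(4,5) by simp
  then have "CHAR('a) dvd p" using prime_CHAR_finite[where 'a = 'a] prime_dvd_power by blast
  then have "CHAR('a) = p" using prime_CHAR_finite[where 'a = 'a] assms(1) primes_dvd_imp_eq by blast
  then have char: "CARD('a) = CHAR('a) ^ k" using assms(4,5) by simp
  have odd: "odd CARD('a)" using assms by simp
  have "matfam (44 + 4 * (1 + 1)) (core_family * (shears21 * shears12) ^ 4 :: 'a poly mat2 set)"
    by (intro matfam_mult matfam_power matfam_core matfam_shears12 matfam_shears21)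
  then have fam: "matfam 52 (core_family * (shears21 * shears12) ^ 4 :: 'a poly mat2 set)" by simp
  show ?thesis
    by (rule polynomial_family_first_rows[OF fam]) (simp, metis row_reached[OF char odd])
qed

end
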